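(* Let $W$ be the Weyl group of type $C$ (with root system of type $C_n$) and let $k$ be an odd positive integer. Then $x_k=M_{W,k}=H_{W,k}$; that is, for each $w\in W$ the coefficient of $w$ in $x_k$ equals $M_{W,k}(w)$ and equals $H_{W,k}(w)$.
   Context: Definition of $x_k$ (Cellini). Let $W$ be the Weyl group of an irreducible crystallographic root system of rank $r$ with simple roots $\Pi=\{\alpha_1,\dots,\alpha_r\}$, highest root $\theta$, and coroot lattice $Y$; put $\alpha_0=-\theta$ and $\tilde\Pi=\Pi\cup\{\alpha_0\}$. Let $Cdes(w)$ be the set of elements of $\tilde\Pi$ mapped to negative roots by $w$. For a positive integer $k$ and $I\subseteq\tilde\Pi$, let $a_{k,I}$ be the number of $t\in Y$ such that $\langle\alpha_i,t\rangle=0$ for all $\alpha_i\in I\cap\Pi$, $\langle\alpha_i,t\rangle>0$ for all $\alpha_i\in\Pi-I$, and moreover $\langle\theta,t\rangle=k$ if $\alpha_0\in I$, while $\langle\theta,t\rangle<k$ if $\alpha_0\notin I$. Then $x_k=\sum_{w\in W}\Big(\frac1{k^r}\sum_{I\subseteq\tilde\Pi-Cdes(w)}a_{k,I}\Big)w$. For $W$ of rank $n$ acting on its $n$-dimensional reflection representation $V$: $Des(w)=\{\alpha\in\Pi: w(\alpha)\text{ negative}\}$. On subsets of $\Pi$ put $J\sim K$ iff $w(J)=K$ for some $w\in W$; $\lambda$ denotes a class, $\lambda(K)$ the class of $K$, $|\lambda|$ its number of elements, $\|\lambda\|=|J|$ for $J\in\lambda$. Definition of $M_{W,x}$ ($x\neq0$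 real): for $J\subseteq\Pi$ let $X_J=\{w: Des(w)\cap J=\emptyset\}$, $x_J=\sum_{w\in X_J}w$ (not to be confused with $x_k$). For $K\subseteq J$ let $\mu_K^J=\frac{|\{w\in X_J:w(K)\subseteq\Pi\}|}{|\lambda(K)|}$, and $\mu_K^J=0$ if $K\not\subseteq J$; let $(\beta_K^J)$ be the inverse of the matrix $(\mu_K^J)$ (rows $J$, columns $K$); $e_\lambda=\frac1{|\lambda|}\sum_{J\in\lambda}\sum_{K\subseteq J}\beta_K^Jx_K$; $M_{W,x}=\sum_\lambda e_\lambda/x^{\|\lambda\|}$, and $M_{W,x}(w)$ is the coefficient of $w$. Definition of $H_{W,x}$: let $L$ be the set of intersections of root hyperplanes (including $V$), ordered by reverse inclusion, with Möbius function $\mu$; $L^X=\{Y\in L:Y\ge X\}$, $\chi(L^X,x)=\sum_{Y\ge X}\mu(X,Y)x^{\dim Y}$. $W_K$ is the parabolic subgroup generated by reflections in the roots of $K\subseteq\Pi$, $Fix(W_K)$ its fixed space, $N_W(W_K)$ its normalizer. $H_{W,x}(w)=\sum_{K\subseteq\Pi-Des(w)}\frac{|W_K|\chi(L^{Fix(W_K)},x)}{x^n|N_W(W_K)||\lambda(K)|}$. *)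

theory Defs
  imports "HOL-Analysis.Analysis"
begin

text \<open>
  Roots, coroots and hyperplanes all live in one Euclidean space; the pairing of roots with
  coroots is the inner product. Throughout, \<open>\<Phi>\<close> is a finite root system and \<open>\<Delta>\<close> a simple system.
\<close>

definition coroot :: "'a::real_inner \<Rightarrow> 'a" where
  "coroot \<alpha> = (2 / (\<alpha> \<bullet> \<alpha>)) *\<^sub>R \<alpha>"

definition reflection :: "'a::real_inner \<Rightarrow> 'a \<Rightarrow> 'a" where
  "reflection \<alpha> v = v - (v \<bullet> coroot \<alpha>) *\<^sub>R \<alpha>"

text \<open>The group generated by a set of reflections; these are involutions, so closure under
  inverses is automatic.\<close>

inductive_set reflection_group :: "'a::real_inner set \<Rightarrow> ('a \<Rightarrow> 'a) set"
  for A :: "'a set" where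
  id: "id \<in> reflection_group A"
| step: "\<alpha> \<in> A \<Longrightarrow> w \<in> reflection_group A \<Longrightarrow> reflection \<alpha> \<circ> w \<in> reflection_group A"

abbreviation weyl_group :: "'a::real_inner set \<Rightarrow> ('a \<Rightarrow> 'a) set" where
  "weyl_group \<equiv> reflection_group"

definition nonneg_combinations :: "'a::real_vector set \<Rightarrow> 'a set" where
  "nonneg_combinations \<Delta> = {(\<Sum>\<alpha>\<in>\<Delta>. c \<alpha> *\<^sub>R \<alpha>) | c. \<forall>\<alpha>\<in>\<Delta>. 0 \<le> c \<alpha>}"

definition pos_roots :: "'a::real_vector set \<Rightarrow> 'a set \<Rightarrow> 'a set" where
  "pos_roots \<Phi> \<Delta> = \<Phi> \<inter> nonneg_combinations \<Delta>"

definition neg_roots :: "'a::real_vector set \<Rightarrow> 'a set \<Rightarrow> 'a set" where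
  "neg_roots \<Phi> \<Delta> = uminus ` pos_roots \<Phi> \<Delta>"

definition highest_root :: "'a::real_vector set \<Rightarrow> 'a set \<Rightarrow> 'a" where
  "highest_root \<Phi> \<Delta> = (THE \<theta>. \<theta> \<in> \<Phi> \<and> (\<forall>\<beta>\<in>\<Phi>. \<theta> - \<beta> \<in> nonneg_combinations \<Delta>))"

definition coroot_lattice :: "'a::real_inner set \<Rightarrow> 'a set" where
  "coroot_lattice \<Phi> = {(\<Sum>\<alpha>\<in>\<Phi>. of_int (c \<alpha>) *\<^sub>R coroot \<alpha>) | c. True}"

definition Des :: "'a::real_vector set \<Rightarrow> 'a set \<Rightarrow> ('a \<Rightarrow> 'a) \<Rightarrow> 'a set" where
  "Des \<Phi> \<Delta> w = {\<alpha> \<in> \<Delta>. w \<alpha> \<in> neg_roots \<Phi> \<Delta>}"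

text \<open>
  An element of the real group algebra of \<open>W\<close> is represented by its coefficient function, of
  which only the values on \<open>W\<close> matter.
\<close>

definition affine_simple :: "'a::real_vector set \<Rightarrow> 'a set \<Rightarrow> 'a set" where
  "affine_simple \<Phi> \<Delta> = insert (- highest_root \<Phi> \<Delta>) \<Delta>"

definition Cdes :: "'a::real_vector set \<Rightarrow> 'a set \<Rightarrow> ('a \<Rightarrow> 'a) \<Rightarrow> 'a set" where
  "Cdes \<Phi> \<Delta> w = {\<alpha> \<in> affine_simple \<Phi> \<Delta>. w \<alpha> \<in> neg_roots \<Phi> \<Delta>}"

definition cellini_a :: "'a::real_inner set \<Rightarrow> 'a set \<Rightarrow> nat \<Rightarrow> 'a set \<Rightarrow> nat" where
  "cellini_a \<Phi> \<Delta> k I = card {t \<in> coroot_lattice \<Phi>.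
     (\<forall>\<alpha> \<in> I \<inter> \<Delta>. \<alpha> \<bullet> t = 0) \<and> (\<forall>\<alpha> \<in> \<Delta> - I. \<alpha> \<bullet> t > 0) \<and>
     (if - highest_root \<Phi> \<Delta> \<in> I then highest_root \<Phi> \<Delta> \<bullet> t = real k
      else highest_root \<Phi> \<Delta> \<bullet> t < real k)}"

definition cellini_x :: "'a::real_inner set \<Rightarrow> 'a set \<Rightarrow> nat \<Rightarrow> ('a \<Rightarrow> 'a) \<Rightarrow> real" where
  "cellini_x \<Phi> \<Delta> k w = 1 / real k ^ card \<Delta> *
     (\<Sum>I \<in> Pow (affine_simple \<Phi> \<Delta> - Cdes \<Phi> \<Delta> w). real (cellini_a \<Phi> \<Delta> k I))"

definition subset_conj :: "'a::real_inner set \<Rightarrow> 'a set \<Rightarrow> ('a set \<times> 'a set) set" where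
  "subset_conj \<Phi> \<Delta> = {(J, K). J \<subseteq> \<Delta> \<and> K \<subseteq> \<Delta> \<and> (\<exists>w \<in> weyl_group \<Phi>. w ` J = K)}"

definition subset_classes :: "'a::real_inner set \<Rightarrow> 'a set \<Rightarrow> 'a set set set" where
  "subset_classes \<Phi> \<Delta> = Pow \<Delta> // subset_conj \<Phi> \<Delta>"

definition subset_class :: "'a::real_inner set \<Rightarrow> 'a set \<Rightarrow> 'a set \<Rightarrow> 'a set set" where
  "subset_class \<Phi> \<Delta> K = subset_conj \<Phi> \<Delta> `` {K}"

definition class_rank :: "'a set set \<Rightarrow> nat" where
  "class_rank l = (THE m. \<forall>J\<in>l. card J = m)"

definition X_set :: "'a::real_inner set \<Rightarrow> 'a set \<Rightarrow> 'a set \<Rightarrow> ('a \<Rightarrow> 'a) set" where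
  "X_set \<Phi> \<Delta> J = {w \<in> weyl_group \<Phi>. Des \<Phi> \<Delta> w \<inter> J = {}}"

definition x_elem :: "'a::real_inner set \<Rightarrow> 'a set \<Rightarrow> 'a set \<Rightarrow> ('a \<Rightarrow> 'a) \<Rightarrow> real" where
  "x_elem \<Phi> \<Delta> J = indicator (X_set \<Phi> \<Delta> J)"

definition mu_mat :: "'a::real_inner set \<Rightarrow> 'a set \<Rightarrow> 'a set \<Rightarrow> 'a set \<Rightarrow> real" where
  "mu_mat \<Phi> \<Delta> J K = (if K \<subseteq> J
     then real (card {w \<in> X_set \<Phi> \<Delta> J. w ` K \<subseteq> \<Delta>}) / real (card (subset_class \<Phi> \<Delta> K))
     else 0)"

text \<open>Inverse of a square matrix indexed by a finite set \<open>S\<close>; entries outside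
  \<open>S \<times> S\<close> are set to zero to make the inverse unique.\<close>

definition matrix_inv_on :: "'i set \<Rightarrow> ('i \<Rightarrow> 'i \<Rightarrow> real) \<Rightarrow> 'i \<Rightarrow> 'i \<Rightarrow> real" where
  "matrix_inv_on S A = (THE B.
     (\<forall>i j. i \<notin> S \<or> j \<notin> S \<longrightarrow> B i j = 0) \<and>
     (\<forall>i\<in>S. \<forall>j\<in>S. (\<Sum>l\<in>S. A i l * B l j) = (if i = j then 1 else 0)) \<and>
     (\<forall>i\<in>S. \<forall>j\<in>S. (\<Sum>l\<in>S. B i l * A l j) = (if i = j then 1 else 0)))"

definition beta_mat :: "'a::real_inner set \<Rightarrow> 'a set \<Rightarrow> 'a set \<Rightarrow> 'a set \<Rightarrow> real" where
  "beta_mat \<Phi> \<Delta> = matrix_inv_on (Pow \<Delta>) (mu_mat \<Phi> \<Delta>)"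

definition e_elem :: "'a::real_inner set \<Rightarrow> 'a set \<Rightarrow> 'a set set \<Rightarrow> ('a \<Rightarrow> 'a) \<Rightarrow> real" where
  "e_elem \<Phi> \<Delta> l w = 1 / real (card l) *
     (\<Sum>J\<in>l. \<Sum>K\<in>Pow J. beta_mat \<Phi> \<Delta> J K * x_elem \<Phi> \<Delta> K w)"

definition M_elem :: "'a::real_inner set \<Rightarrow> 'a set \<Rightarrow> real \<Rightarrow> ('a \<Rightarrow> 'a) \<Rightarrow> real" where
  "M_elem \<Phi> \<Delta> x w = (\<Sum>l \<in> subset_classes \<Phi> \<Delta>. e_elem \<Phi> \<Delta> l w / x ^ class_rank l)"

text \<open>Moebius function of a poset \<open>P\<close> under \<open>le\<close>; well defined only for finite \<open>P\<close>.\<close>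

definition moebius :: "'b set \<Rightarrow> ('b \<Rightarrow> 'b \<Rightarrow> bool) \<Rightarrow> 'b \<Rightarrow> 'b \<Rightarrow> int" where
  "moebius P le = (THE f.
     (\<forall>x y. \<not> (x \<in> P \<and> y \<in> P \<and> le x y) \<longrightarrow> f x y = 0) \<and>
     (\<forall>x\<in>P. f x x = 1) \<and>
     (\<forall>x\<in>P. \<forall>y\<in>P. le x y \<and> x \<noteq> y \<longrightarrow> (\<Sum>z | z \<in> P \<and> le x z \<and> le z y. f x z) = 0))"

definition intersection_lattice :: "'a::real_inner set \<Rightarrow> 'a set set" where
  "intersection_lattice \<Phi> = {(\<Inter>\<alpha>\<in>S. {v. \<alpha> \<bullet> v = 0}) | S. S \<subseteq> \<Phi>}"

definition char_poly_above :: "'a::euclidean_space set \<Rightarrow> 'a set \<Rightarrow> real \<Rightarrow> real" where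
  "char_poly_above \<Phi> X x = (\<Sum>Y | Y \<in> intersection_lattice \<Phi> \<and> Y \<subseteq> X.
     of_int (moebius (intersection_lattice \<Phi>) (\<supseteq>) X Y) * x ^ dim Y)"

definition fixed_space :: "('a \<Rightarrow> 'a) set \<Rightarrow> 'a set" where
  "fixed_space G = {v. \<forall>u\<in>G. u v = v}"

definition normalizer_in :: "('a \<Rightarrow> 'a) set \<Rightarrow> ('a \<Rightarrow> 'a) set \<Rightarrow> ('a \<Rightarrow> 'a) set" where
  "normalizer_in G U = {w \<in> G. (\<lambda>u. w \<circ> u \<circ> inv w) ` U = U}"

definition H_elem :: "'a::euclidean_space set \<Rightarrow> 'a set \<Rightarrow> real \<Rightarrow> ('a \<Rightarrow> 'a) \<Rightarrow> real" where
  "H_elem \<Phi> \<Delta> x w = (\<Sum>K \<in> Pow (\<Delta> - Des \<Phi> \<Delta> w).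
     real (card (reflection_group K)) *
     char_poly_above \<Phi> (fixed_space (reflection_group K)) x /
     (x ^ card \<Delta> * real (card (normalizer_in (weyl_group \<Phi>) (reflection_group K))) *
      real (card (subset_class \<Phi> \<Delta> K))))"

text \<open>Here \<open>b 1, \<dots>, b n\<close> with \<open>n = DIM('a)\<close> is an orthonormal basis of the space.\<close>

definition C_roots :: "(nat \<Rightarrow> 'a::euclidean_space) \<Rightarrow> 'a set" where
  "C_roots b =
     {s *\<^sub>R b i + t *\<^sub>R b j | s t i j. s \<in> {1, -1} \<and> t \<in> {1, -1} \<and> 1 \<le> i \<and> i < j \<and> j \<le> DIM('a)} \<union>
     {(2 * s) *\<^sub>R b i | s i. s \<in> {1, -1} \<and> 1 \<le> i \<and> i \<le> DIM('a)}"

definition C_simple :: "(nat \<Rightarrow> 'a::euclidean_space) \<Rightarrow> 'a set" where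
  "C_simple b = insert (2 *\<^sub>R b DIM('a)) {b i - b (i + 1) | i. 1 \<le> i \<and> i < DIM('a)}"

end

theory Submission
  imports Defs
begin

text \<open>
  Write \<open>k = 2 m + 1\<close>. All three functions have the form
  \<open>w \<mapsto> \<Sum>K\<subseteq>\<Delta> - Des w. c K\<close>, and in each case \<open>c K\<close> is the number
  \<open>m choose (n - |K|)\<close> of points of \<open>\<int>\<^sup>n\<close> with coordinates in \<open>[-m, m]\<close> in the open face of
  the dominant chamber belonging to \<open>K\<close>, divided by \<open>k ^ n\<close>.
  For \<open>x\<^sub>k\<close> this is nearly the definition: \<open>\<theta> = 2 b\<^sub>1\<close> pairs evenly with the coroot lattice
  \<open>\<int>\<^sup>n\<close>, so the sets \<open>I\<close> containing \<open>-\<theta>\<close> do not contribute.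
  For \<open>H\<close>, every flat \<open>Y\<close> contains \<open>k ^ dim Y\<close> points of the cube, hence by Moebius inversion
  the characteristic polynomial counts the generic points of \<open>Fix W\<^sub>K\<close>; these are the points
  \<open>w\<^sup>-\<^sup>1 t\<close> with \<open>w K \<subseteq> \<Delta>\<close> and \<open>t\<close> in the open face of \<open>w K\<close>, and the number of such
  \<open>w\<close> is \<open>|N(W\<^sub>K)| |\<lambda>(K)| / |W\<^sub>K|\<close>.
  For \<open>M\<close>, inverting \<open>\<mu>\<close> reduces the claim to
  \<open>\<Sum>J\<supseteq>K. (m choose (n - |J|)) |{w \<in> X\<^sub>J. w K \<subseteq> \<Delta>}| = k ^ (n - |K|)\<close>. The summand counts pairs
  of a point \<open>t\<close> in the open face of \<open>J\<close> and a generic point \<open>q\<close> of \<open>Fix W\<^sub>K\<close> with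
  coordinates in \<open>[-d, d]\<close>, \<open>d = n - |K|\<close>, that is positive on \<open>J - K\<close>; the points
  \<open>(2 d + 1) t + q\<close> are determined by their sets of nonzero coordinates, which are the systems of
  representatives of the residue classes \<open>\<plusminus>1, \<dots>, \<plusminus>d\<close> modulo \<open>2 d + 1\<close>.
\<close>

subsection \<open>Reflection groups\<close>

text \<open>For odd \<open>k\<close> the interval [-m, m] has exactly \<open>k\<close> integers and
  is symmetric, so the cube is stable under \<open>W\<close>, whose elements permute coordinates and
  change signs. This is what lets flats and faces be moved to standard position before counting. The
  obstacle is \<open>M\<close>: the inverse matrix \<beta> is never computed. The coefficients of
  \<open>M\<close> form a row vector g \<beta> with g J = 1 / (|\<lambda>(J)| k^|J|), so it suffices
  to check f \<mu> = g for the expected row vector f. In that identity group elements have to become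
  lattice points. The number d = n - |K| is the least radius at which the cube meets Fix W_K in
  generic points, and at this radius every w with w K inside \<Delta> yields exactly one of them, q
  = w^-1 t with t the smallest integral point in the open face of w K. Descents of w then turn into
  signs of simple roots at q. The modulus 2 d + 1 is the number of values open to a coordinate of q,
  and the radius M = (2 d + 1) m + d satisfies 2 M + 1 = (2 d + 1) (2 m + 1). The sum (2 d + 1) t +
  q is lexicographic: t decides, and q breaks the ties of t.\<close>

lemma reflection_eq: "reflection \<alpha> v = v - (2 * (v \<bullet> \<alpha>) / (\<alpha> \<bullet> \<alpha>)) *\<^sub>R \<alpha>"
  by (simp add: reflection_def coroot_def)

lemma linear_reflection: "linear (reflection \<alpha>)"
  unfolding reflection_def
  by (rule linearI) (auto simp: inner_add_left scaleR_add_left algebra_simps)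

lemma reflection_inner: "reflection \<alpha> v \<bullet> reflection \<alpha> w = v \<bullet> w"
  by (cases "\<alpha> = 0")
    (auto simp: reflection_eq inner_diff_left inner_diff_right field_simps inner_commute)

lemma reflection_self: "reflection \<alpha> \<alpha> = - \<alpha>"
  by (cases "\<alpha> = 0") (auto simp: reflection_eq scaleR_2)

lemma reflection_involution: "reflection \<alpha> (reflection \<alpha> v) = v"
proof -
  interpret linear "reflection \<alpha>" by (rule linear_reflection)
  have "reflection \<alpha> (reflection \<alpha> v) = reflection \<alpha> (v - (v \<bullet> coroot \<alpha>) *\<^sub>R \<alpha>)"
    by (simp add: reflection_def)
  also have "\<dots> = v"
    by (simp add: diff scaleR reflection_self) (simp add: reflection_def)
  finally show ?thesis .
qed

lemma reflection_fixes_iff: "reflection \<alpha> v = v \<longleftrightarrow> \<alpha> \<bullet> v = 0"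
  by (cases "\<alpha> = 0") (auto simp: reflection_eq inner_commute)

lemma reflection_group_linear:
  assumes "w \<in> reflection_group A"
  shows "linear w"
  using assms by induction (simp_all only: linear_id linear_compose linear_reflection)

lemma reflection_group_inner:
  assumes "w \<in> reflection_group A"
  shows "w x \<bullet> w y = x \<bullet> y"
  using assms by (induction arbitrary: x y) (auto simp: reflection_inner)

lemma reflection_group_reflection: "\<alpha> \<in> A \<Longrightarrow> reflection \<alpha> \<in> reflection_group A"
  using reflection_group.step[OF _ reflection_group.id] by fastforce

lemma reflection_group_comp:
  assumes "v \<in> reflection_group A" "w \<in> reflection_group A"
  shows "v \<circ> w \<in> reflection_group A"
  using assms by induction (simp_all add: comp_assoc reflection_group.step)

lemma reflection_group_mono: "A \<subseteq> B \<Longrightarrow> reflection_group A \<subseteq> reflection_group B"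
proof
  fix w assume "A \<subseteq> B" "w \<in> reflection_group A"
  from this(2,1) show "w \<in> reflection_group B"
    by induction (simp_all only: reflection_group.id reflection_group.step subsetD)
qed

lemma reflection_group_inverse:
  assumes "w \<in> reflection_group A"
  obtains v where "v \<in> reflection_group A" "v \<circ> w = id" "w \<circ> v = id"
proof -
  have "\<exists>v \<in> reflection_group A. v \<circ> w = id \<and> w \<circ> v = id"
    using assms
  proof induction
    case id
    show ?case by (intro bexI[of _ id] reflection_group.id) simp
  next
    case (step \<alpha> w)
    then obtain v where v: "v \<in> reflection_group A" "v \<circ> w = id" "w \<circ> v = id" by blast
    have "v \<circ> reflection \<alpha> \<in> reflection_group A"
      by (intro reflection_group_comp v reflection_group_reflection step)
    moreover have "(v \<circ> reflection \<alpha>) \<circ> (reflection \<alpha> \<circ> w) = id"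
      using v(2) by (simp add: fun_eq_iff reflection_involution)
    moreover have "(reflection \<alpha> \<circ> w) \<circ> (v \<circ> reflection \<alpha>) = id"
      using v(3) by (simp add: fun_eq_iff reflection_involution)
    ultimately show ?case by blast
  qed
  then show thesis using that by blast
qed

lemma reflection_group_bij:
  assumes "w \<in> reflection_group A"
  shows "bij w"
  using reflection_group_inverse[OF assms] by (metis o_bij)

lemma reflection_group_inv:
  assumes "w \<in> reflection_group A"
  shows "inv w \<in> reflection_group A"
  using reflection_group_inverse[OF assms] by (metis inv_unique_comp)

lemma reflection_group_inv_app:
  assumes "w \<in> reflection_group A"
  shows "inv w (w x) = x" "w (inv w x) = x"
  using reflection_group_bij[OF assms]
  by (auto simp: bij_is_inj bij_is_surj surj_f_inv_f)

lemma reflection_group_inner_inv: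
  assumes "w \<in> reflection_group A"
  shows "inv w x \<bullet> y = x \<bullet> w y" "w x \<bullet> y = x \<bullet> inv w y"
  using reflection_group_inner[OF assms, of "inv w x" y]
    reflection_group_inner[OF assms, of x "inv w y"]
  by (simp_all add: reflection_group_inv_app[OF assms])

lemma reflection_conj:
  assumes "w \<in> reflection_group A"
  shows "w \<circ> reflection \<alpha> \<circ> inv w = reflection (w \<alpha>)"
proof
  fix x
  interpret linear w by (rule reflection_group_linear[OF assms])
  show "(w \<circ> reflection \<alpha> \<circ> inv w) x = reflection (w \<alpha>) x"
    by (simp add: reflection_eq diff scaleR reflection_group_inv_app[OF assms]
        reflection_group_inner_inv[OF assms] reflection_group_inner[OF assms])
qed

lemma reflection_group_conj:
  assumes "w \<in> reflection_group A" "u \<in> reflection_group K"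
  shows "w \<circ> u \<circ> inv w \<in> reflection_group (w ` K)"
  using assms(2)
proof induction
  case id
  have "w \<circ> id \<circ> inv w = id"
    by (auto simp: fun_eq_iff reflection_group_inv_app[OF assms(1)])
  then show ?case by (simp only: reflection_group.id)
next
  case (step \<alpha> u)
  have "w \<circ> (reflection \<alpha> \<circ> u) \<circ> inv w = (w \<circ> reflection \<alpha> \<circ> inv w) \<circ> (w \<circ> u \<circ> inv w)"
    by (auto simp: fun_eq_iff reflection_group_inv_app[OF assms(1)])
  also have "\<dots> \<in> reflection_group (w ` K)"
    unfolding reflection_conj[OF assms(1)] using step by (intro reflection_group.step imageI)
  finally show ?case .
qed

lemma fixed_space_reflection_group:
  "fixed_space (reflection_group K) = {v. \<forall>\<alpha>\<in>K. \<alpha> \<bullet> v = 0}"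
proof (intro equalityI subsetI)
  fix v assume "v \<in> fixed_space (reflection_group K)"
  then show "v \<in> {v. \<forall>\<alpha>\<in>K. \<alpha> \<bullet> v = 0}"
    using reflection_group_reflection[of _ K] reflection_fixes_iff[of _ v]
    by (auto simp: fixed_space_def)
next
  fix v assume v: "v \<in> {v. \<forall>\<alpha>\<in>K. \<alpha> \<bullet> v = 0}"
  have "u v = v" if "u \<in> reflection_group K" for u
    using that by induction (use v reflection_fixes_iff[of _ v] in auto)
  then show "v \<in> fixed_space (reflection_group K)" by (auto simp: fixed_space_def)
qed

subsection \<open>Triangular matrices indexed by subsets\<close>

text \<open>Forward substitution: row \<open>J\<close> of the inverse is computed from the rows of
  the proper subsets of \<open>J\<close>. The nonzero diagonal of the result is recorded so that the
  lemma applies to the inverse again.\<close>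

lemma triangular_right_inverse:
  fixes A :: "'i set \<Rightarrow> 'i set \<Rightarrow> real"
  assumes fin: "finite D"
    and tri: "\<And>J K. J \<subseteq> D \<Longrightarrow> K \<subseteq> D \<Longrightarrow> \<not> K \<subseteq> J \<Longrightarrow> A J K = 0"
    and diag: "\<And>J. J \<subseteq> D \<Longrightarrow> A J J \<noteq> 0"
  shows "\<exists>B. (\<forall>J K. \<not> K \<subseteq> J \<longrightarrow> B J K = 0) \<and> (\<forall>J. J \<subseteq> D \<longrightarrow> B J J \<noteq> 0) \<and>
    (\<forall>J K. J \<subseteq> D \<longrightarrow> K \<subseteq> D \<longrightarrow> (\<Sum>L\<in>Pow D. A J L * B L K) = (if J = K then 1 else 0))"
proof -
  define F where "F = (\<lambda>B J K. ((if J = K then 1 else 0) -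
     (\<Sum>L | L \<subset> J. A J L * B L K)) / A J J :: real)"
  define B where "B = wfrec finite_psubset F"
  have adm: "adm_wf finite_psubset F"
    unfolding adm_wf_def
  proof (intro allI impI)
    fix f g :: "'i set \<Rightarrow> 'i set \<Rightarrow> real" and J :: "'i set"
    assume eq: "\<forall>z. (z, J) \<in> finite_psubset \<longrightarrow> f z = g z"
    show "F f J = F g J"
    proof (cases "finite J")
      case True
      then show ?thesis using eq unfolding F_def
        by (intro ext arg_cong2[where f="(/)"] arg_cong2[where f="(-)"] refl sum.cong)
           (auto simp: finite_psubset_def)
    next
      case False
      \<comment> \<open>For infinite \<open>J\<close> the sum in \<open>F\<close> ranges over an
        infinite set and is 0 by default, so \<open>F\<close> does not depend on its argument
        there.\<close>
      have "infinite {L. L \<subset> J}"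
      proof
        assume "finite {L. L \<subset> J}"
        moreover have "(\<lambda>x. J - {x}) ` J \<subseteq> {L. L \<subset> J}" by auto
        ultimately have "finite ((\<lambda>x. J - {x}) ` J)" by (rule finite_subset[rotated])
        moreover have "inj_on (\<lambda>x. J - {x}) J" by (auto simp: inj_on_def)
        ultimately show False using False finite_imageD by blast
      qed
      then show ?thesis unfolding F_def by simp
    qed
  qed
  have B_eq: "B J = F B J" for J
    unfolding B_def using wfrec_fixpoint[OF wf_finite_psubset adm] by (rule fun_cong)
  have B_tri: "B J K = 0" if "J \<subseteq> D" "K \<subseteq> D" "\<not> K \<subseteq> J" for J K
    using finite_subset[OF that(1) fin] that
  proof (induction J rule: finite_psubset_induct)
    case (psubset J)
    have "(\<Sum>L | L \<subset> J. A J L * B L K) = 0"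
      using psubset by (intro sum.neutral) auto
    then show ?case using psubset.prems by (subst B_eq) (auto simp: F_def)
  qed
  have B_diag: "B J J \<noteq> 0" if "J \<subseteq> D" for J
  proof -
    have "(\<Sum>L | L \<subset> J. A J L * B L J) = 0"
      using that B_tri by (intro sum.neutral) auto
    then show ?thesis using that diag by (subst B_eq) (auto simp: F_def)
  qed
  \<comment> \<open>Triangularity of \<open>B\<close> is known for subsets of \<open>D\<close>;
    truncation extends it to all index sets.\<close>
  define C where "C = (\<lambda>J K. if J \<subseteq> D \<and> K \<subseteq> D then B J K else 0)"
  have "(\<Sum>L\<in>Pow D. A J L * C L K) = (if J = K then 1 else 0)"
    if JK: "J \<subseteq> D" "K \<subseteq> D" for J K
  proof -
    have fin': "finite {L. L \<subset> J}"
      using finite_subset[OF JK(1) fin] by (rule_tac finite_subset[of _ "Pow J"]) auto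
    have "(\<Sum>L\<in>Pow D. A J L * C L K) = (\<Sum>L\<in>insert J {L. L \<subset> J}. A J L * B L K)"
    proof (intro sum.mono_neutral_cong_right ballI)
      fix L assume L: "L \<in> Pow D - insert J {L. L \<subset> J}"
      then have "\<not> L \<subseteq> J" by auto
      then show "A J L * C L K = 0" using tri[of J L] L JK by auto
    qed (use fin JK in \<open>auto simp: C_def\<close>)
    also have "\<dots> = A J J * B J K + (\<Sum>L | L \<subset> J. A J L * B L K)"
      using fin' by (subst sum.insert) auto
    also have "\<dots> = (if J = K then 1 else 0)"
      using diag[OF JK(1)] by (subst B_eq) (auto simp: F_def)
    finally show ?thesis .
  qed
  then show ?thesis using B_tri B_diag by (intro exI[of _ C]) (auto simp: C_def)
qed

lemma sum_delta_right:
  fixes f :: "'i \<Rightarrow> real"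
  assumes "finite S" "k \<in> S"
  shows "(\<Sum>l\<in>S. f l * (if l = k then 1 else 0)) = f k"
    "(\<Sum>l\<in>S. (if k = l then 1 else 0) * f l) = f k"
  using assms by (auto simp: if_distrib[of "\<lambda>x. _ * x"] if_distrib[of "\<lambda>x. x * _"] sum.delta sum.delta' cong: if_cong)

lemma matrix_product_assoc:
  fixes A B C :: "'i \<Rightarrow> 'i \<Rightarrow> real"
  shows "(\<Sum>l\<in>S. (\<Sum>k\<in>S. A i k * B k l) * C l j) = (\<Sum>k\<in>S. A i k * (\<Sum>l\<in>S. B k l * C l j))"
  by (simp add: sum_distrib_left sum_distrib_right mult.assoc) (rule sum.swap)

lemma left_inverse_eq_right_inverse:
  fixes A B C :: "'i \<Rightarrow> 'i \<Rightarrow> real"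
  assumes "finite S"
    and BA: "\<forall>i\<in>S. \<forall>j\<in>S. (\<Sum>l\<in>S. B i l * A l j) = (if i = j then 1 else 0)"
    and AC: "\<forall>i\<in>S. \<forall>j\<in>S. (\<Sum>l\<in>S. A i l * C l j) = (if i = j then 1 else 0)"
    and ij: "i \<in> S" "j \<in> S"
  shows "B i j = C i j"
proof -
  have "C i j = (\<Sum>l\<in>S. (\<Sum>k\<in>S. B i k * A k l) * C l j)"
    using BA ij sum_delta_right(2)[OF assms(1) ij(1), of "\<lambda>l. C l j"] by simp
  also have "\<dots> = (\<Sum>k\<in>S. B i k * (\<Sum>l\<in>S. A k l * C l j))"
    by (rule matrix_product_assoc)
  also have "\<dots> = B i j"
    using AC ij sum_delta_right(1)[OF assms(1) ij(2), of "\<lambda>l. B i l"] by simp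
  finally show ?thesis by simp
qed

text \<open>The right inverse \<open>C\<close> of \<open>A\<close> is again triangular with nonzero
  diagonal, so it has a right inverse \<open>E\<close> of its own. Then \<open>A\<close> and
  \<open>E\<close> are a left and a right inverse of \<open>C\<close>, hence equal, and
  \<open>C\<close> inverts \<open>A\<close> on both sides.\<close>

lemma matrix_inv_on_triangular:
  fixes A :: "'i set \<Rightarrow> 'i set \<Rightarrow> real"
  assumes fin: "finite D"
    and tri: "\<And>J K. J \<subseteq> D \<Longrightarrow> K \<subseteq> D \<Longrightarrow> \<not> K \<subseteq> J \<Longrightarrow> A J K = 0"
    and diag: "\<And>J. J \<subseteq> D \<Longrightarrow> A J J \<noteq> 0"
  defines "B \<equiv> matrix_inv_on (Pow D) A"
  shows "\<And>J K. \<not> K \<subseteq> J \<Longrightarrow> B J K = 0"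
    and "\<And>J K. J \<subseteq> D \<Longrightarrow> K \<subseteq> D \<Longrightarrow> (\<Sum>L\<in>Pow D. A J L * B L K) = (if J = K then 1 else 0)"
proof -
  have "\<exists>C. (\<forall>J K. \<not> K \<subseteq> J \<longrightarrow> C J K = 0) \<and> (\<forall>J. J \<subseteq> D \<longrightarrow> C J J \<noteq> 0) \<and>
    (\<forall>J K. J \<subseteq> D \<longrightarrow> K \<subseteq> D \<longrightarrow> (\<Sum>L\<in>Pow D. A J L * C L K) = (if J = K then 1 else 0))"
    by (rule triangular_right_inverse[OF fin]) (fact tri diag)+
  then obtain C where C: "\<forall>J K. \<not> K \<subseteq> J \<longrightarrow> C J K = 0" "\<forall>J. J \<subseteq> D \<longrightarrow> C J J \<noteq> 0"
    "\<forall>J K. J \<subseteq> D \<longrightarrow> K \<subseteq> D \<longrightarrow> (\<Sum>L\<in>Pow D. A J L * C L K) = (if J = K then 1 else 0)"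
    by (elim exE conjE)
  have "\<exists>E. (\<forall>J K. \<not> K \<subseteq> J \<longrightarrow> E J K = 0) \<and> (\<forall>J. J \<subseteq> D \<longrightarrow> E J J \<noteq> 0) \<and>
    (\<forall>J K. J \<subseteq> D \<longrightarrow> K \<subseteq> D \<longrightarrow> (\<Sum>L\<in>Pow D. C J L * E L K) = (if J = K then 1 else 0))"
    by (rule triangular_right_inverse[OF fin]) (simp_all add: C(1,2))
  then obtain E where E:
    "\<forall>J K. J \<subseteq> D \<longrightarrow> K \<subseteq> D \<longrightarrow> (\<Sum>L\<in>Pow D. C J L * E L K) = (if J = K then 1 else 0)"
    by (elim exE conjE)
  have finP: "finite (Pow D)" using fin by simp
  have AE: "A J K = E J K" if "J \<in> Pow D" "K \<in> Pow D" for J K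
    by (rule left_inverse_eq_right_inverse[OF finP, where A=C]) (use C E that in auto)
  \<comment> \<open>\<open>matrix_inv_on\<close> demands zeros outside the index set, which
    \<open>C\<close> need not have.\<close>
  define C' where "C' = (\<lambda>J K. if J \<subseteq> D \<and> K \<subseteq> D then C J K else 0)"
  have AC': "\<forall>J\<in>Pow D. \<forall>K\<in>Pow D. (\<Sum>L\<in>Pow D. A J L * C' L K) = (if J = K then 1 else 0)"
    using C(3) by (auto simp: C'_def)
  have CA': "\<forall>J\<in>Pow D. \<forall>K\<in>Pow D. (\<Sum>L\<in>Pow D. C' J L * A L K) = (if J = K then 1 else 0)"
  proof (intro ballI)
    fix J K assume JK: "J \<in> Pow D" "K \<in> Pow D"
    have "(\<Sum>L\<in>Pow D. C' J L * A L K) = (\<Sum>L\<in>Pow D. C J L * E L K)"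
      using JK AE by (intro sum.cong) (auto simp: C'_def)
    then show "(\<Sum>L\<in>Pow D. C' J L * A L K) = (if J = K then 1 else 0)" using E JK by auto
  qed
  have "B = C'"
    unfolding B_def matrix_inv_on_def
  proof (rule the_equality)
    fix M assume M: "(\<forall>i j. i \<notin> Pow D \<or> j \<notin> Pow D \<longrightarrow> M i j = 0) \<and>
     (\<forall>i\<in>Pow D. \<forall>j\<in>Pow D. (\<Sum>l\<in>Pow D. A i l * M l j) = (if i = j then 1 else 0)) \<and>
     (\<forall>i\<in>Pow D. \<forall>j\<in>Pow D. (\<Sum>l\<in>Pow D. M i l * A l j) = (if i = j then 1 else 0))"
    show "M = C'"
    proof (intro ext)
      fix i j
      show "M i j = C' i j"
        using left_inverse_eq_right_inverse[OF finP, of M A C' i j] M AC'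
        by (cases "i \<in> Pow D \<and> j \<in> Pow D") (auto simp: C'_def)
    qed
  qed (use AC' CA' in \<open>auto simp: C'_def\<close>)
  then show "\<And>J K. \<not> K \<subseteq> J \<Longrightarrow> B J K = 0"
    and "\<And>J K. J \<subseteq> D \<Longrightarrow> K \<subseteq> D \<Longrightarrow> (\<Sum>L\<in>Pow D. A J L * B L K) = (if J = K then 1 else 0)"
    using C(1) AC' by (auto simp: C'_def)
qed

subsection \<open>The Moebius function of a finite family of sets\<close>

text \<open>For fixed \<open>x\<close> the value at \<open>y\<close> is forced by the values at the
  sets strictly between \<open>y\<close> and \<open>x\<close> and at \<open>x\<close> itself.
  Existence is recursion along this dependency, uniqueness is induction along it.\<close>

lemma moebius_exists:
  assumes fin: "finite (P :: 'b set set)"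
  shows "\<exists>!f :: 'b set \<Rightarrow> 'b set \<Rightarrow> int.
     (\<forall>x y. \<not> (x \<in> P \<and> y \<in> P \<and> x \<supseteq> y) \<longrightarrow> f x y = 0) \<and>
     (\<forall>x\<in>P. f x x = 1) \<and>
     (\<forall>x\<in>P. \<forall>y\<in>P. x \<supseteq> y \<and> x \<noteq> y \<longrightarrow> (\<Sum>z | z \<in> P \<and> x \<supseteq> z \<and> z \<supseteq> y. f x z) = 0)"
proof (rule ex_ex1I)
  \<comment> \<open>The order is reverse inclusion, so the recursion goes from larger sets to
    smaller ones; it is well founded because \<open>P\<close> is finite.\<close>
  define R where "R = {(z, y). z \<in> P \<and> y \<in> P \<and> y \<subset> (z :: 'b set)}"
  have "finite R" using fin by (intro finite_subset[of R "P \<times> P"]) (auto simp: R_def)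
  moreover have "acyclic R"
  proof -
    have "R\<^sup>+ \<subseteq> {(z, y). y \<subset> z}"
    proof (intro subrelI)
      fix x y assume "(x, y) \<in> R\<^sup>+"
      then show "(x, y) \<in> {(z, y). y \<subset> z}" by induction (auto simp: R_def)
    qed
    then show ?thesis by (auto simp: acyclic_def)
  qed
  ultimately have wf: "wf R" by (rule finite_acyclic_wf)
  define F where "F = (\<lambda>x (f :: 'b set \<Rightarrow> int) y. if x \<in> P \<and> y \<in> P \<and> y \<subseteq> x then
     (if x = y then 1 else - (\<Sum>z | z \<in> P \<and> x \<supseteq> z \<and> y \<subset> z. f z)) else 0)"
  have adm: "adm_wf R (F x)" for x
    unfolding adm_wf_def F_def by (auto simp: R_def intro!: sum.cong)
  define f where "f = (\<lambda>x. wfrec R (F x))"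
  have f_eq: "f x y = F x (f x) y" for x y
    unfolding f_def using wfrec_fixpoint[OF wf adm] by (rule fun_cong)
  have "(\<Sum>z | z \<in> P \<and> x \<supseteq> z \<and> z \<supseteq> y. f x z) = 0" if "x \<in> P" "y \<in> P" "y \<subseteq> x" "x \<noteq> y" for x y
  proof -
    have "{z. z \<in> P \<and> x \<supseteq> z \<and> z \<supseteq> y} = insert y {z. z \<in> P \<and> x \<supseteq> z \<and> y \<subset> z}"
      using that by auto
    then have "(\<Sum>z | z \<in> P \<and> x \<supseteq> z \<and> z \<supseteq> y. f x z) =
        f x y + (\<Sum>z | z \<in> P \<and> x \<supseteq> z \<and> y \<subset> z. f x z)"
      using fin by (simp add: sum.insert)
    then show ?thesis using that by (subst (asm) (2) f_eq) (simp add: F_def)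
  qed
  moreover have "f x x = 1" if "x \<in> P" for x
    using that by (subst f_eq) (simp add: F_def)
  moreover have "f x y = 0" if "\<not> (x \<in> P \<and> y \<in> P \<and> x \<supseteq> y)" for x y
    using that by (subst f_eq) (auto simp: F_def)
  ultimately show "\<exists>f :: 'b set \<Rightarrow> 'b set \<Rightarrow> int.
     (\<forall>x y. \<not> (x \<in> P \<and> y \<in> P \<and> x \<supseteq> y) \<longrightarrow> f x y = 0) \<and>
     (\<forall>x\<in>P. f x x = 1) \<and>
     (\<forall>x\<in>P. \<forall>y\<in>P. x \<supseteq> y \<and> x \<noteq> y \<longrightarrow> (\<Sum>z | z \<in> P \<and> x \<supseteq> z \<and> z \<supseteq> y. f x z) = 0)"
    by (intro exI[of _ f] conjI allI ballI impI) auto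
  fix g h :: "'b set \<Rightarrow> 'b set \<Rightarrow> int"
  assume g: "(\<forall>x y. \<not> (x \<in> P \<and> y \<in> P \<and> x \<supseteq> y) \<longrightarrow> g x y = 0) \<and>
     (\<forall>x\<in>P. g x x = 1) \<and>
     (\<forall>x\<in>P. \<forall>y\<in>P. x \<supseteq> y \<and> x \<noteq> y \<longrightarrow> (\<Sum>z | z \<in> P \<and> x \<supseteq> z \<and> z \<supseteq> y. g x z) = 0)"
  assume h: "(\<forall>x y. \<not> (x \<in> P \<and> y \<in> P \<and> x \<supseteq> y) \<longrightarrow> h x y = 0) \<and>
     (\<forall>x\<in>P. h x x = 1) \<and>
     (\<forall>x\<in>P. \<forall>y\<in>P. x \<supseteq> y \<and> x \<noteq> y \<longrightarrow> (\<Sum>z | z \<in> P \<and> x \<supseteq> z \<and> z \<supseteq> y. h x z) = 0)"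
  have "g x y = h x y" for x y
  proof (induction y rule: wf_induct_rule[OF wf])
    case (1 y)
    show ?case
    proof (cases "x \<in> P \<and> y \<in> P \<and> y \<subseteq> x \<and> x \<noteq> y")
      case True
      have *: "{z. z \<in> P \<and> x \<supseteq> z \<and> z \<supseteq> y} = insert y {z. z \<in> P \<and> x \<supseteq> z \<and> y \<subset> z}"
        using True by auto
      have **: "(\<Sum>z | z \<in> P \<and> x \<supseteq> z \<and> z \<supseteq> y. f x z) =
        f x y + (\<Sum>z | z \<in> P \<and> x \<supseteq> z \<and> y \<subset> z. f x z)" for f :: "'b set \<Rightarrow> 'b set \<Rightarrow> int"
        unfolding * using fin by (simp add: sum.insert)
      have "(\<Sum>z | z \<in> P \<and> x \<supseteq> z \<and> y \<subset> z. g x z) = (\<Sum>z | z \<in> P \<and> x \<supseteq> z \<and> y \<subset> z. h x z)"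
        using 1 True by (intro sum.cong) (auto simp: R_def)
      moreover have "(\<Sum>z | z \<in> P \<and> x \<supseteq> z \<and> z \<supseteq> y. g x z) = 0"
        "(\<Sum>z | z \<in> P \<and> x \<supseteq> z \<and> z \<supseteq> y. h x z) = 0"
        using g h True by simp_all
      ultimately show ?thesis using **[of g] **[of h] by linarith
    next
      case False
      then show ?thesis using g h by (cases "x = y"; cases "y \<in> P") simp_all
    qed
  qed
  then show "g = h" by (intro ext)
qed

text \<open>After exchanging the sums, the weight of each \<open>g Z\<close> is the Moebius sum over
  the interval from \<open>X\<close> to \<open>Z\<close>, which vanishes unless
  \<open>Z = X\<close>.\<close>

lemma moebius_inversion:
  fixes g :: "'b set \<Rightarrow> real"
  assumes fin: "finite P" and X: "X \<in> P"
  shows "(\<Sum>Y | Y \<in> P \<and> Y \<subseteq> X. of_int (moebius P (\<supseteq>) X Y) * (\<Sum>Z | Z \<in> P \<and> Z \<subseteq> Y. g Z)) = g X"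
proof -
  define f where "f = moebius P (\<supseteq>)"
  have f: "\<forall>x\<in>P. f x x = 1"
     "\<forall>x\<in>P. \<forall>y\<in>P. x \<supseteq> y \<and> x \<noteq> y \<longrightarrow> (\<Sum>z | z \<in> P \<and> x \<supseteq> z \<and> z \<supseteq> y. f x z) = 0"
    using theI'[OF moebius_exists[OF fin], folded moebius_def f_def] by simp_all
  have "(\<Sum>Y | Y \<in> P \<and> Y \<subseteq> X. of_int (f X Y) * (\<Sum>Z | Z \<in> P \<and> Z \<subseteq> Y. g Z)) =
    (\<Sum>Y | Y \<in> P \<and> Y \<subseteq> X. \<Sum>Z | Z \<in> {Z \<in> P. Z \<subseteq> X} \<and> Z \<subseteq> Y. of_int (f X Y) * g Z)"
    unfolding sum_distrib_left by (intro sum.cong) auto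
  also have "\<dots> = (\<Sum>Z | Z \<in> P \<and> Z \<subseteq> X. \<Sum>Y | Y \<in> {Y \<in> P. Y \<subseteq> X} \<and> Z \<subseteq> Y. of_int (f X Y) * g Z)"
    using fin by (subst sum.swap_restrict) (auto intro!: sum.cong)
  also have "\<dots> = (\<Sum>Z | Z \<in> P \<and> Z \<subseteq> X. if Z = X then g X else 0)"
  proof (intro sum.cong refl)
    fix Z assume Z: "Z \<in> {Z \<in> P. Z \<subseteq> X}"
    have "(\<Sum>Y | Y \<in> {Y \<in> P. Y \<subseteq> X} \<and> Z \<subseteq> Y. of_int (f X Y) * g Z) =
      of_int (\<Sum>Y | Y \<in> P \<and> X \<supseteq> Y \<and> Y \<supseteq> Z. f X Y) * g Z"
      by (simp add: sum_distrib_right conj_assoc)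
    also have "(\<Sum>Y | Y \<in> P \<and> X \<supseteq> Y \<and> Y \<supseteq> Z. f X Y) = (if Z = X then 1 else 0)"
    proof (cases "Z = X")
      case True
      have "{Y. Y \<in> P \<and> X \<supseteq> Y \<and> Y \<supseteq> X} = {X}" using X by auto
      then show ?thesis using True f(1) X by simp
    qed (use f(2) X Z in auto)
    finally show "(\<Sum>Y | Y \<in> {Y \<in> P. Y \<subseteq> X} \<and> Z \<subseteq> Y. of_int (f X Y) * g Z) = (if Z = X then g X else 0)"
      by auto
  qed
  also have "\<dots> = g X" using fin X by simp
  finally show ?thesis unfolding f_def .
qed

subsection \<open>The root system of type C\<close>

locale type_C =
  fixes b :: "nat \<Rightarrow> 'a::euclidean_space" and n :: nat
  assumes n_eq: "n = DIM('a)"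
    and orthonormal: "\<And>i j. i \<in> {1..n} \<Longrightarrow> j \<in> {1..n} \<Longrightarrow>
      b i \<bullet> b j = (if i = j then 1 else 0)"
begin

abbreviation "\<Phi> \<equiv> C_roots b"
abbreviation "\<Delta> \<equiv> C_simple b"
abbreviation "W \<equiv> weyl_group \<Phi>"

text \<open>The signed basis vectors. \<open>W\<close> acts on them by signed permutations, and the
  roots are the sums of two of them that are not opposite; a vector added to itself gives a long
  root. This treats both root lengths at once.\<close>

definition B :: "'a set" where "B = b ` {1..n} \<union> (\<lambda>i. - b i) ` {1..n}"

lemma B_cases [consumes 1]:
  assumes "x \<in> B"
  obtains (pos) i where "1 \<le> i" "i \<le> n" "x = b i" | (neg) i where "1 \<le> i" "i \<le> n" "x = - b i"
  using assms unfolding B_def by auto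

lemma b_in_B [simp]: "1 \<le> i \<Longrightarrow> i \<le> n \<Longrightarrow> b i \<in> B" "1 \<le> i \<Longrightarrow> i \<le> n \<Longrightarrow> - b i \<in> B"
  by (auto simp: B_def)

lemma uminus_B: "x \<in> B \<Longrightarrow> - x \<in> B"
  by (auto simp: B_def)

lemma n_pos: "1 \<le> n"
  by (simp add: n_eq Suc_le_eq)

lemma finite_B: "finite B"
  by (simp add: B_def)

lemma inner_b [simp]: "1 \<le> i \<Longrightarrow> i \<le> n \<Longrightarrow> 1 \<le> j \<Longrightarrow> j \<le> n \<Longrightarrow> b i \<bullet> b j = (if i = j then 1 else 0)"
  using orthonormal by auto

lemma b_eq_iff [simp]: "1 \<le> i \<Longrightarrow> i \<le> n \<Longrightarrow> 1 \<le> j \<Longrightarrow> j \<le> n \<Longrightarrow> b i = b j \<longleftrightarrow> i = j"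
proof -
  assume *: "1 \<le> i" "i \<le> n" "1 \<le> j" "j \<le> n"
  have "i = j" if "b i = b j"
    using inner_b[OF *] inner_b[OF *(3,4,3,4)] unfolding that by (auto split: if_splits)
  then show ?thesis by auto
qed

lemma b_eq_minus [simp]: "1 \<le> i \<Longrightarrow> i \<le> n \<Longrightarrow> 1 \<le> j \<Longrightarrow> j \<le> n \<Longrightarrow> b i \<noteq> - b j"
proof
  assume "1 \<le> i" "i \<le> n" "1 \<le> j" "j \<le> n" "b i = - b j"
  then show False
    using inner_b[of i j] inner_b[of j j] by (simp split: if_splits)
qed

lemma b_nonzero [simp]: "1 \<le> i \<Longrightarrow> i \<le> n \<Longrightarrow> b i \<noteq> 0"
  using inner_b[of i i] by (metis inner_zero_left zero_neq_one)

lemma minus_b_eq [simp]: "1 \<le> i \<Longrightarrow> i \<le> n \<Longrightarrow> 1 \<le> j \<Longrightarrow> j \<le> n \<Longrightarrow> - b i \<noteq> b j"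
  using b_eq_minus[of j i] by metis

lemma inner_B: "x \<in> B \<Longrightarrow> y \<in> B \<Longrightarrow> x \<bullet> y = (if x = y then 1 else if x = - y then -1 else 0)"
  by (elim B_cases) (auto simp: inner_minus_left inner_minus_right dest: b_eq_minus)

lemma roots_eq: "\<Phi> = {x + y | x y. x \<in> B \<and> y \<in> B \<and> x + y \<noteq> 0}"
proof (intro equalityI subsetI)
  fix \<alpha> assume "\<alpha> \<in> \<Phi>"
  then consider (short) s t i j where "\<alpha> = s *\<^sub>R b i + t *\<^sub>R b j" "s \<in> {1, -1}" "t \<in> {1, -1::real}" "1 \<le> i" "i < j" "j \<le> n"
    | (long) s i where "\<alpha> = (2 * s) *\<^sub>R b i" "s \<in> {1, -1}" "1 \<le> i" "i \<le> n"
    unfolding C_roots_def n_eq[symmetric] by blast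
  then show "\<alpha> \<in> {x + y | x y. x \<in> B \<and> y \<in> B \<and> x + y \<noteq> 0}"
  proof cases
    case short
    have "s *\<^sub>R b i \<in> B" "t *\<^sub>R b j \<in> B" using short by auto
    moreover have "s *\<^sub>R b i + t *\<^sub>R b j \<noteq> 0"
    proof
      assume "s *\<^sub>R b i + t *\<^sub>R b j = 0"
      then have "(s *\<^sub>R b i + t *\<^sub>R b j) \<bullet> b i = 0" by simp
      then show False using short by (auto simp: inner_add_left)
    qed
    ultimately show ?thesis using short(1) by blast
  next
    case long
    have "s *\<^sub>R b i \<in> B" using long by auto
    moreover have "s *\<^sub>R b i + s *\<^sub>R b i \<noteq> 0"
    proof
      assume "s *\<^sub>R b i + s *\<^sub>R b i = 0"
      then have "(s *\<^sub>R b i + s *\<^sub>R b i) \<bullet> b i = 0" by simp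
      then show False using long by (auto simp: inner_add_left)
    qed
    moreover have "\<alpha> = s *\<^sub>R b i + s *\<^sub>R b i"
      using long by (simp add: scaleR_add_left[symmetric])
    ultimately show ?thesis by blast
  qed
next
  fix \<alpha> assume "\<alpha> \<in> {x + y | x y. x \<in> B \<and> y \<in> B \<and> x + y \<noteq> 0}"
  then obtain x y where xy: "\<alpha> = x + y" "x \<in> B" "y \<in> B" "x + y \<noteq> 0" by auto
  obtain s i where x: "x = s *\<^sub>R b i" "s \<in> {1,-1}" "1 \<le> i" "i \<le> n"
    using xy(2) by (cases rule: B_cases) (auto intro: that[of 1] that[of "-1"])
  obtain t j where y: "y = t *\<^sub>R b j" "t \<in> {1,-1}" "1 \<le> j" "j \<le> n"
    using xy(3) by (cases rule: B_cases) (auto intro: that[of 1] that[of "-1"])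
  consider "i < j" | "j < i" | "i = j" by linarith
  then show "\<alpha> \<in> \<Phi>"
  proof cases
    case 1
    then show ?thesis unfolding C_roots_def n_eq[symmetric] using x y xy(1) by blast
  next
    case 2
    have "\<alpha> = t *\<^sub>R b j + s *\<^sub>R b i" using xy(1) x y by simp
    then show ?thesis unfolding C_roots_def n_eq[symmetric] using x y 2 by blast
  next
    case 3
    then have "s = t" using xy(4) x y by auto
    then have "\<alpha> = (2 * s) *\<^sub>R b i" using xy(1) x y 3 by (simp add: scaleR_add_left[symmetric])
    then show ?thesis unfolding C_roots_def n_eq[symmetric] using x by blast
  qed
qed

lemma rootI: "x \<in> B \<Longrightarrow> y \<in> B \<Longrightarrow> x \<noteq> - y \<Longrightarrow> x + y \<in> \<Phi>"
  unfolding roots_eq using eq_neg_iff_add_eq_0 by blast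

lemma root_diffI: "x \<in> B \<Longrightarrow> y \<in> B \<Longrightarrow> x \<noteq> y \<Longrightarrow> x - y \<in> \<Phi>"
  using rootI[of x "- y"] uminus_B by simp

lemma root_cases:
  assumes "\<alpha> \<in> \<Phi>"
  obtains x y where "x \<in> B" "y \<in> B" "x \<noteq> - y" "\<alpha> = x + y"
  using assms unfolding roots_eq by (auto simp: eq_neg_iff_add_eq_0)

lemma finite_roots: "finite \<Phi>"
proof -
  have "\<Phi> \<subseteq> (\<lambda>(x, y). x + y) ` (B \<times> B)" unfolding roots_eq by auto
  then show ?thesis using finite_B by (meson finite_SigmaI finite_imageI finite_subset)
qed

lemma uminus_root: "\<alpha> \<in> \<Phi> \<Longrightarrow> - \<alpha> \<in> \<Phi>"
  by (elim root_cases) (metis add.inverse_inverse minus_add_distrib rootI uminus_B)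

text \<open>The reflection in 2 x negates x and fixes the rest of \<open>B\<close> up to sign of x;
  the reflection in x + y with x and y orthogonal exchanges x with - y and fixes the vectors of
  \<open>B\<close> orthogonal to both.\<close>

lemma reflection_B:
  assumes "\<alpha> \<in> \<Phi>" "z \<in> B"
  shows "reflection \<alpha> z \<in> B"
  using assms(1)
proof (rule root_cases)
  fix x y assume xy: "x \<in> B" "y \<in> B" "x \<noteq> - y" "\<alpha> = x + y"
  show ?thesis
  proof (cases "x = y")
    case True
    have "reflection \<alpha> z = z - (2 * (z \<bullet> x)) *\<^sub>R x"
      using xy(1) True inner_B[of x x] unfolding xy(4) True
      by (simp add: reflection_eq inner_add_left inner_add_right scaleR_2[symmetric])
    then show ?thesis using inner_B[OF assms(2) xy(1)] assms(2) xy(1)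
      by (auto simp: scaleR_2 uminus_B split: if_splits)
  next
    case False
    have xyi: "x \<bullet> y = 0" "y \<bullet> x = 0" "x \<bullet> x = 1" "y \<bullet> y = 1"
      using inner_B xy False by (auto simp: inner_commute)
    have "reflection \<alpha> z = z - (z \<bullet> x + z \<bullet> y) *\<^sub>R (x + y)"
      unfolding xy(4) reflection_eq by (simp add: inner_add_left inner_add_right xyi)
    moreover have "y \<noteq> - x" "x \<noteq> - x" "y \<noteq> - y"
      using xyi xy(3) inner_minus_left[of x x] inner_minus_left[of y y]
      by (metis add.inverse_inverse, metis one_neq_neg_one, metis one_neq_neg_one)
    ultimately show ?thesis
      using inner_B[OF assms(2) xy(1)] inner_B[OF assms(2) xy(2)] assms(2) xy(1,2,3) False xyi
      by (auto simp: uminus_B inner_minus_left split: if_splits)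
  qed
qed

lemma W_linear: "w \<in> W \<Longrightarrow> linear w"
  by (rule reflection_group_linear)

lemma W_B: "w \<in> W \<Longrightarrow> z \<in> B \<Longrightarrow> w z \<in> B"
  by (induction arbitrary: z rule: reflection_group.induct) (auto simp: reflection_B)

lemma W_root: "w \<in> W \<Longrightarrow> \<alpha> \<in> \<Phi> \<Longrightarrow> w \<alpha> \<in> \<Phi>"
proof -
  assume w: "w \<in> W" and "\<alpha> \<in> \<Phi>"
  then obtain x y where xy: "x \<in> B" "y \<in> B" "x \<noteq> - y" "\<alpha> = x + y" by (auto elim: root_cases)
  interpret linear w using w by (rule W_linear)
  have "w x \<noteq> - w y"
    using xy(3) bij_is_inj[OF reflection_group_bij[OF w]] by (auto simp: neg[symmetric] inj_eq)
  then show "w \<alpha> \<in> \<Phi>" using xy w by (auto simp: add intro: rootI W_B)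
qed

lemma W_inv: "w \<in> W \<Longrightarrow> inv w \<in> W"
  by (rule reflection_group_inv)

lemma W_comp: "v \<in> W \<Longrightarrow> w \<in> W \<Longrightarrow> v \<circ> w \<in> W"
  by (rule reflection_group_comp)

lemmas W_app = reflection_group_inv_app[where A = "C_roots b"]
lemmas W_inner_inv = reflection_group_inner_inv[where A = "C_roots b"]
lemmas W_inner = reflection_group_inner[where A = "C_roots b"]

lemma b_expansion: "x = (\<Sum>i\<in>{1..n}. (x \<bullet> b i) *\<^sub>R b i)"
proof -
  let ?E = "b ` {1..n}"
  have card: "card ?E = n"
    by (subst card_image) (auto simp: inj_on_def)
  have "independent ?E"
  proof (rule pairwise_orthogonal_independent)
    show "pairwise orthogonal ?E" by (auto simp: pairwise_def orthogonal_def)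
    show "0 \<notin> ?E"
    proof
      assume "0 \<in> ?E"
      then obtain i where "1 \<le> i" "i \<le> n" "b i = 0" by auto
      then show False using inner_b[of i i] by simp
    qed
  qed
  then have span: "span ?E = UNIV"
    using card_ge_dim_independent[of ?E UNIV] card by (auto simp: n_eq)
  define y where "y = x - (\<Sum>i\<in>{1..n}. (x \<bullet> b i) *\<^sub>R b i)"
  have "y \<bullet> b j = 0" if "j \<in> {1..n}" for j
  proof -
    have "(\<Sum>i\<in>{1..n}. (x \<bullet> b i) *\<^sub>R b i) \<bullet> b j = (\<Sum>i\<in>{1..n}. if i = j then x \<bullet> b i else 0)"
      unfolding inner_sum_left using that by (intro sum.cong) auto
    then show ?thesis using that by (simp add: y_def inner_diff_left)
  qed
  then have "orthogonal y e" if "e \<in> ?E" for e using that by (auto simp: orthogonal_def)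
  then have "orthogonal y y" using orthogonal_to_span[of y ?E y] span by simp
  then show ?thesis by (simp add: y_def orthogonal_def)
qed

lemma eqI_b: "(\<And>i. 1 \<le> i \<Longrightarrow> i \<le> n \<Longrightarrow> x \<bullet> b i = y \<bullet> b i) \<Longrightarrow> x = y"
  by (subst (1 2) b_expansion) (auto intro: sum.cong)

lemma linear_eq_on_b:
  fixes f g :: "'a \<Rightarrow> 'a"
  assumes "linear f" "linear g" "\<And>i. 1 \<le> i \<Longrightarrow> i \<le> n \<Longrightarrow> f (b i) = g (b i)"
  shows "f = g"
proof
  fix x
  have *: "f x = (\<Sum>i\<in>{1..n}. (x \<bullet> b i) *\<^sub>R f (b i))" if "linear f" for f :: "'a \<Rightarrow> 'a"
    by (subst b_expansion) (simp add: linear_sum[OF that] linear_cmul[OF that])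
  show "f x = g x" unfolding *[OF assms(1)] *[OF assms(2)]
    using assms(3) by (intro sum.cong) auto
qed

text \<open>A linear map is determined by its values on the basis, and for elements of
  \<open>W\<close> these lie in the finite set \<open>B\<close>.\<close>

lemma finite_W: "finite W"
proof -
  have "(\<lambda>w. restrict w (b ` {1..n})) ` W \<subseteq> PiE (b ` {1..n}) (\<lambda>_. B)"
    using W_B by auto
  then have "finite ((\<lambda>w. restrict w (b ` {1..n})) ` W)"
    using finite_PiE[of "b ` {1..n}" "\<lambda>_. B"] finite_B by (auto intro: finite_subset)
  moreover have "inj_on (\<lambda>w. restrict w (b ` {1..n})) W"
  proof (rule inj_onI)
    fix v w assume vw: "v \<in> W" "w \<in> W" "restrict v (b ` {1..n}) = restrict w (b ` {1..n})"
    have "v (b i) = w (b i)" if "1 \<le> i" "i \<le> n" for i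
      using fun_cong[OF vw(3), of "b i"] that by auto
    then show "v = w" using vw W_linear by (intro linear_eq_on_b) auto
  qed
  ultimately show ?thesis using finite_imageD by blast
qed

section \<open>Coordinates and the enumeration of the simple roots\<close>

text \<open>The value 0 outside 1, ..., n is deliberate: with coordinate n + 1 equal to 0, the long
  simple root 2 b_n also measures a drop between consecutive coordinates, up to the factor 2, and
  needs no separate treatment later.\<close>

definition coord :: "'a \<Rightarrow> nat \<Rightarrow> real" where
  "coord x i = (if 1 \<le> i \<and> i \<le> n then x \<bullet> b i else 0)"

definition nth_simple :: "nat \<Rightarrow> 'a" where
  "nth_simple i = (if i = n then 2 *\<^sub>R b n else b i - b (Suc i))"

lemma coord_linear: "coord (x + y) i = coord x i + coord y i" "coord (c *\<^sub>R x) i = c * coord x i"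
    "coord (x - y) i = coord x i - coord y i" "coord (- x) i = - coord x i" "coord 0 i = 0"
  by (auto simp: coord_def inner_add_left inner_diff_left)

lemma coord_outside [simp]: "coord x 0 = 0" "n < i \<Longrightarrow> coord x i = 0" "coord x (Suc n) = 0"
  by (auto simp: coord_def)

lemma eqI_coord: "(\<And>i. 1 \<le> i \<Longrightarrow> i \<le> n \<Longrightarrow> coord x i = coord y i) \<Longrightarrow> x = y"
  by (rule eqI_b) (auto simp: coord_def)

definition vec :: "(nat \<Rightarrow> real) \<Rightarrow> 'a" where
  "vec f = (\<Sum>i\<in>{1..n}. f i *\<^sub>R b i)"

lemma coord_vec [simp]: "1 \<le> j \<Longrightarrow> j \<le> n \<Longrightarrow> coord (vec f) j = f j"
proof -
  assume j: "1 \<le> j" "j \<le> n"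
  have "vec f \<bullet> b j = (\<Sum>i\<in>{1..n}. if i = j then f i else 0)"
    unfolding vec_def inner_sum_left using j by (intro sum.cong) auto
  then show ?thesis using j by (simp add: coord_def)
qed

lemma simple_eq: "\<Delta> = nth_simple ` {1..n}"
proof (intro equalityI subsetI)
  fix x assume "x \<in> \<Delta>"
  then consider "x = 2 *\<^sub>R b n" | i where "x = b i - b (i + 1)" "1 \<le> i" "i < n"
    unfolding C_simple_def n_eq[symmetric] by auto
  then show "x \<in> nth_simple ` {1..n}"
  proof cases
    case 1
    then show ?thesis using n_pos by (intro image_eqI[of _ _ n]) (auto simp: nth_simple_def)
  next
    case (2 i)
    then show ?thesis by (intro image_eqI[of _ _ i]) (auto simp: nth_simple_def)
  qed
next
  fix x assume "x \<in> nth_simple ` {1..n}"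
  then obtain i where "x = nth_simple i" "1 \<le> i" "i \<le> n" by auto
  then show "x \<in> \<Delta>" unfolding C_simple_def n_eq[symmetric] nth_simple_def by (cases "i = n") auto
qed

lemma nth_simple_inner: "1 \<le> i \<Longrightarrow> i \<le> n \<Longrightarrow> nth_simple i \<bullet> x = (if i = n then 2 else 1) * (coord x i - coord x (Suc i))"
  by (auto simp: nth_simple_def coord_def inner_diff_left inner_diff_right inner_commute[of x])

lemma inj_nth_simple: "inj_on nth_simple {1..n}"
proof (rule inj_onI)
  have *: "nth_simple i \<noteq> nth_simple j" if "i < j" "1 \<le> i" "j \<le> n" for i j
  proof
    assume "nth_simple i = nth_simple j"
    then have "nth_simple i \<bullet> b i = nth_simple j \<bullet> b i" by simp
    then show False using that by (auto simp: nth_simple_inner coord_def split: if_splits)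
  qed
  fix i j assume "i \<in> {1..n}" "j \<in> {1..n}" "nth_simple i = nth_simple j"
  then show "i = j" using *[of i j] *[of j i] by (metis atLeastAtMost_iff linorder_neqE_nat)
qed

lemma card_simple: "card \<Delta> = n"
  unfolding simple_eq by (subst card_image[OF inj_nth_simple]) simp

lemma finite_simple: "finite \<Delta>"
  unfolding simple_eq by simp

lemma simple_root: "\<alpha> \<in> \<Delta> \<Longrightarrow> \<alpha> \<in> \<Phi>"
  unfolding simple_eq by (auto simp: nth_simple_def scaleR_2 intro!: rootI root_diffI)

section \<open>The cone of the simple roots and positivity of roots by height\<close>

abbreviation "NN \<equiv> nonneg_combinations \<Delta>"

lemma nonneg_add: "x \<in> NN \<Longrightarrow> y \<in> NN \<Longrightarrow> x + y \<in> NN"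
proof -
  assume "x \<in> NN" "y \<in> NN"
  then obtain c d where "x = (\<Sum>\<alpha>\<in>\<Delta>. c \<alpha> *\<^sub>R \<alpha>)" "y = (\<Sum>\<alpha>\<in>\<Delta>. d \<alpha> *\<^sub>R \<alpha>)" "\<forall>\<alpha>\<in>\<Delta>. 0 \<le> c \<alpha>" "\<forall>\<alpha>\<in>\<Delta>. 0 \<le> d \<alpha>"
    unfolding nonneg_combinations_def by auto
  then have "x + y = (\<Sum>\<alpha>\<in>\<Delta>. (c \<alpha> + d \<alpha>) *\<^sub>R \<alpha>) \<and> (\<forall>\<alpha>\<in>\<Delta>. 0 \<le> c \<alpha> + d \<alpha>)"
    by (simp add: scaleR_add_left sum.distrib)
  then show ?thesis unfolding nonneg_combinations_def
    by (intro CollectI exI[of _ "\<lambda>\<alpha>. c \<alpha> + d \<alpha>"])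
qed

lemma nonneg_scale: "x \<in> NN \<Longrightarrow> 0 \<le> r \<Longrightarrow> r *\<^sub>R x \<in> NN"
proof -
  assume "x \<in> NN" and r: "0 \<le> r"
  then obtain c where "x = (\<Sum>\<alpha>\<in>\<Delta>. c \<alpha> *\<^sub>R \<alpha>)" "\<forall>\<alpha>\<in>\<Delta>. 0 \<le> c \<alpha>"
    unfolding nonneg_combinations_def by auto
  then have "r *\<^sub>R x = (\<Sum>\<alpha>\<in>\<Delta>. (r * c \<alpha>) *\<^sub>R \<alpha>) \<and> (\<forall>\<alpha>\<in>\<Delta>. 0 \<le> r * c \<alpha>)"
    using r by (simp add: scaleR_sum_right)
  then show ?thesis unfolding nonneg_combinations_def by (intro CollectI exI[of _ "\<lambda>\<alpha>. r * c \<alpha>"])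
qed

lemma nonneg_zero: "0 \<in> NN"
  unfolding nonneg_combinations_def by (intro CollectI exI[of _ "\<lambda>_. 0"]) auto

lemma nonneg_simple: "\<alpha> \<in> \<Delta> \<Longrightarrow> \<alpha> \<in> NN"
proof -
  assume "\<alpha> \<in> \<Delta>"
  then have "(\<Sum>\<beta>\<in>\<Delta>. (if \<beta> = \<alpha> then 1 else 0) *\<^sub>R \<beta>) = \<alpha>"
    using finite_simple by (simp add: if_distrib[of "\<lambda>c. c *\<^sub>R _"] cong: if_cong)
  then show ?thesis unfolding nonneg_combinations_def
    by (intro CollectI exI[of _ "\<lambda>\<beta>. if \<beta> = \<alpha> then 1 else 0"]) auto
qed

lemma nonneg_diff_b: "1 \<le> i \<Longrightarrow> i \<le> j \<Longrightarrow> j \<le> n \<Longrightarrow> b i - b j \<in> NN"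
proof (induction j)
  case (Suc j)
  show ?case
  proof (cases "i = Suc j")
    case False
    have "nth_simple j \<in> NN" using Suc False by (intro nonneg_simple) (auto simp: simple_eq)
    then have "(b i - b j) + (b j - b (Suc j)) \<in> NN"
      using Suc False by (intro nonneg_add) (auto simp: nth_simple_def)
    then show ?thesis by simp
  qed (simp add: nonneg_zero)
qed simp

lemma nonneg_b: "1 \<le> i \<Longrightarrow> i \<le> n \<Longrightarrow> b i \<in> NN"
proof -
  assume i: "1 \<le> i" "i \<le> n"
  have "nth_simple n \<in> NN" using i by (intro nonneg_simple) (auto simp: simple_eq)
  then have "(1/2) *\<^sub>R nth_simple n \<in> NN" by (rule nonneg_scale) simp
  then have "b n \<in> NN" by (simp add: nth_simple_def)
  then have "(b i - b n) + b n \<in> NN" using i by (intro nonneg_add nonneg_diff_b) auto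
  then show ?thesis by simp
qed

lemma span_simple: "span \<Delta> = UNIV"
proof -
  have "NN \<subseteq> span \<Delta>"
    unfolding nonneg_combinations_def by (auto intro: span_sum span_scale span_base)
  then have "b i \<in> span \<Delta>" if "1 \<le> i" "i \<le> n" for i using nonneg_b that by blast
  then have "x \<in> span \<Delta>" for x
    by (subst b_expansion) (intro span_sum span_scale, simp)
  then show ?thesis by auto
qed

lemma independent_simple: "independent \<Delta>"
  by (rule card_le_dim_spanning[of \<Delta> UNIV]) (auto simp: span_simple card_simple finite_simple n_eq)

text \<open>The sum of the fundamental coweights: its pairing with a root is the height of the root.\<close>

definition rho :: 'a where
  "rho = vec (\<lambda>i. real n - real i + 1 / 2)"

lemma b_rho: "1 \<le> i \<Longrightarrow> i \<le> n \<Longrightarrow> b i \<bullet> rho = real n - real i + 1 / 2"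
  using coord_vec[of i "\<lambda>i. real n - real i + 1 / 2"] by (simp add: coord_def rho_def inner_commute)

lemma simple_rho: "\<alpha> \<in> \<Delta> \<Longrightarrow> \<alpha> \<bullet> rho = 1"
  unfolding simple_eq by (auto simp: nth_simple_def inner_diff_left b_rho)

lemma positive_root_cases:
  assumes "\<beta> \<in> \<Phi>" "\<beta> \<bullet> rho \<ge> 0"
  obtains (diff) i j where "1 \<le> i" "i < j" "j \<le> n" "\<beta> = b i - b j"
    | (plus) i j where "1 \<le> i" "i \<le> j" "j \<le> n" "\<beta> = b i + b j"
proof -
  obtain x y where xy: "x \<in> B" "y \<in> B" "x \<noteq> - y" "\<beta> = x + y" using assms by (auto elim: root_cases)
  from xy(1) show thesis
  proof (cases rule: B_cases)
    case i: (pos i)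
    from xy(2) show thesis
    proof (cases rule: B_cases)
      case (pos j)
      then show ?thesis using i xy plus[of i j] plus[of j i] by (cases "i \<le> j") (auto simp: add.commute)
    next
      case (neg j)
      then have "i \<noteq> j" using i xy by auto
      moreover have "real i \<le> real j" using assms(2) i neg xy(4) by (simp add: inner_diff_left b_rho)
      ultimately show ?thesis using i neg xy diff[of i j] by auto
    qed
  next
    case i: (neg i)
    from xy(2) show thesis
    proof (cases rule: B_cases)
      case (pos j)
      then have "i \<noteq> j" using i xy by auto
      moreover have "real j \<le> real i" using assms(2) i pos xy(4) by (simp add: inner_diff_left b_rho)
      ultimately show ?thesis using i pos xy diff[of j i] by auto
    next
      case (neg j)
      then show ?thesis using assms(2) i xy(4) by (simp add: inner_diff_left b_rho)
    qed
  qed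
qed

text \<open>Heights of roots are nonzero integers, so a nonnegative height is at least 1. The gap
  matters in \<open>good_simple\<close>, where two positive roots add up to height at least
  2.\<close>

lemma root_rho_nonneg:
  assumes "\<beta> \<in> \<Phi>" "\<beta> \<bullet> rho \<ge> 0"
  shows "\<beta> \<bullet> rho \<ge> 1" "\<beta> \<in> NN"
proof -
  have "\<beta> \<bullet> rho \<ge> 1 \<and> \<beta> \<in> NN"
    using assms
  proof (cases rule: positive_root_cases)
    case (diff i j)
    then show ?thesis by (auto simp: inner_diff_left b_rho intro: nonneg_diff_b)
  next
    case (plus i j)
    then show ?thesis by (auto simp: inner_add_left b_rho intro!: nonneg_add nonneg_b)
  qed
  then show "\<beta> \<bullet> rho \<ge> 1" "\<beta> \<in> NN" by auto
qed

lemma root_rho_nonzero: "\<beta> \<in> \<Phi> \<Longrightarrow> \<beta> \<bullet> rho \<noteq> 0"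
  using root_rho_nonneg(1)[of \<beta>] by auto

text \<open>The splittings are explicit: b_i - b_j passes through b_(i+1), b_i + b_j = (b_i - b_j) +
  2 b_j, and 2 b_i = (b_i - b_n) + (b_i + b_n).\<close>

lemma positive_root_decompose:
  assumes "\<beta> \<in> \<Phi>" "\<beta> \<bullet> rho > 0" "\<beta> \<notin> \<Delta>"
  obtains \<beta>1 \<beta>2 where "\<beta>1 \<in> \<Phi>" "\<beta>2 \<in> \<Phi>" "\<beta>1 \<bullet> rho > 0" "\<beta>2 \<bullet> rho > 0" "\<beta> = \<beta>1 + \<beta>2"
proof -
  from assms(1) less_imp_le[OF assms(2)] show thesis
  proof (cases rule: positive_root_cases)
    case (diff i j)
    have "nth_simple i \<in> \<Delta>" "nth_simple i = b i - b (Suc i)" using diff by (auto simp: simple_eq nth_simple_def)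
    then have "j \<noteq> Suc i" using diff assms(3) by auto
    then have "Suc i < j" using diff by simp
    then show thesis using diff
      by (intro that[of "b i - b (Suc i)" "b (Suc i) - b j"]) (auto intro!: root_diffI simp: inner_diff_left b_rho)
  next
    case (plus i j)
    show thesis
    proof (cases "i = j")
      case False
      then have "b i - b j \<in> \<Phi>" "b j + b j \<in> \<Phi>" using plus by (auto intro!: root_diffI rootI)
      then show ?thesis using plus False
        by (intro that[of "b i - b j" "b j + b j"]) (auto simp: inner_diff_left inner_add_left b_rho)
    next
      case True
      have "i \<noteq> n" using plus True assms(3) by (auto simp: simple_eq nth_simple_def scaleR_2)
      then have "b i - b n \<in> \<Phi>" "b i + b n \<in> \<Phi>" using plus True by (auto intro!: root_diffI rootI)
      then show ?thesis using plus True \<open>i \<noteq> n\<close>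
        by (intro that[of "b i - b n" "b i + b n"]) (auto simp: inner_diff_left inner_add_left b_rho)
    qed
  qed
qed

text \<open>From here on the sign of a root is tested by its pairing with \<open>rho\<close> instead
  of by membership in a cone.\<close>

lemma pos_roots_eq: "pos_roots \<Phi> \<Delta> = {\<beta> \<in> \<Phi>. \<beta> \<bullet> rho > 0}"
proof (intro equalityI subsetI)
  fix \<beta> assume "\<beta> \<in> pos_roots \<Phi> \<Delta>"
  then obtain c where c: "\<beta> \<in> \<Phi>" "\<beta> = (\<Sum>\<alpha>\<in>\<Delta>. c \<alpha> *\<^sub>R \<alpha>)" "\<forall>\<alpha>\<in>\<Delta>. 0 \<le> c \<alpha>"
    unfolding pos_roots_def nonneg_combinations_def by auto
  have "\<beta> \<bullet> rho \<ge> 0" unfolding c(2) inner_sum_left using c(3) by (intro sum_nonneg) (auto simp: simple_rho)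
  then show "\<beta> \<in> {\<beta> \<in> \<Phi>. \<beta> \<bullet> rho > 0}" using c(1) root_rho_nonzero by force
next
  fix \<beta> assume "\<beta> \<in> {\<beta> \<in> \<Phi>. \<beta> \<bullet> rho > 0}"
  then show "\<beta> \<in> pos_roots \<Phi> \<Delta>" unfolding pos_roots_def using root_rho_nonneg by auto
qed

lemma neg_roots_eq: "neg_roots \<Phi> \<Delta> = {\<beta> \<in> \<Phi>. \<beta> \<bullet> rho < 0}"
  unfolding neg_roots_def pos_roots_eq
proof (intro equalityI subsetI)
  fix \<beta> assume "\<beta> \<in> {\<beta> \<in> \<Phi>. \<beta> \<bullet> rho < 0}"
  then show "\<beta> \<in> uminus ` {\<beta> \<in> \<Phi>. \<beta> \<bullet> rho > 0}"
    by (intro image_eqI[of _ _ "- \<beta>"]) (auto intro: uminus_root)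
qed (auto intro: uminus_root)

lemma Des_eq: "w \<in> W \<Longrightarrow> Des \<Phi> \<Delta> w = {\<alpha> \<in> \<Delta>. w \<alpha> \<bullet> rho < 0}"
  unfolding Des_def neg_roots_eq using W_root simple_root by auto

lemma not_Des_iff: "w \<in> W \<Longrightarrow> \<alpha> \<in> \<Delta> \<Longrightarrow> \<alpha> \<notin> Des \<Phi> \<Delta> w \<longleftrightarrow> w \<alpha> \<bullet> rho > 0"
  using root_rho_nonzero[OF W_root[OF _ simple_root], of w \<alpha>] by (auto simp: Des_eq)

subsection \<open>Dominant points and parabolic subgroups\<close>

definition dominant :: "'a \<Rightarrow> bool" where
  "dominant t \<longleftrightarrow> (\<forall>\<alpha>\<in>\<Delta>. 0 \<le> \<alpha> \<bullet> t)"

definition walls :: "'a \<Rightarrow> 'a set" where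
  "walls t = {\<alpha> \<in> \<Delta>. \<alpha> \<bullet> t = 0}"

abbreviation "FS K \<equiv> {v :: 'a. \<forall>\<alpha>\<in>K. \<alpha> \<bullet> v = 0}"

text \<open>Equivalently, \<open>v\<^sup>-\<^sup>1\<close> moves \<open>p + \<epsilon> rho\<close> into the open dominant chamber for all small \<open>\<epsilon> > 0\<close>.\<close>

definition good :: "('a \<Rightarrow> 'a) \<Rightarrow> 'a \<Rightarrow> bool" where
  "good v p \<longleftrightarrow> v \<in> W \<and> dominant (inv v p) \<and> (\<forall>\<alpha>\<in>walls (inv v p). 0 < v \<alpha> \<bullet> rho)"

definition strictly_dominant :: "'a \<Rightarrow> bool" where
  "strictly_dominant t \<longleftrightarrow> (\<forall>\<alpha>\<in>\<Delta>. 0 < \<alpha> \<bullet> t)"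

lemma W_inj: "w \<in> W \<Longrightarrow> w x = w y \<longleftrightarrow> x = y"
  using reflection_group_bij[of w] by (auto simp: bij_def inj_eq)

lemma W_imageI: "w \<in> W \<Longrightarrow> inv w y \<in> A \<Longrightarrow> y \<in> w ` A"
  using W_app(2)[of w y] by (intro image_eqI[of _ _ "inv w y"]) auto

lemma strictly_dominant_coord:
  assumes "strictly_dominant x" "1 \<le> i" "i < j" "j \<le> Suc n"
  shows "coord x j < coord x i"
  using assms(3,4)
proof (induction j)
  case (Suc j)
  have step: "coord x (Suc j) < coord x j" if "1 \<le> j" "j \<le> n"
  proof -
    have "0 < nth_simple j \<bullet> x" using assms(1) that by (auto simp: strictly_dominant_def simple_eq)
    then show ?thesis using that by (auto simp: nth_simple_inner split: if_splits)
  qed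
  show ?case
  proof (cases "i = j")
    case True
    then show ?thesis using step Suc.prems assms(2) by auto
  next
    case False
    then show ?thesis using step Suc assms(2) by fastforce
  qed
qed simp

text \<open>A strictly dominant point orders \<open>B\<close> as b_1 > ... > b_n > - b_n > ... > -
  b_1, so b_i is characterised by its rank.\<close>

lemma strictly_dominant_up:
  assumes "strictly_dominant x" "1 \<le> i" "i \<le> n"
  shows "{y \<in> B. b i \<bullet> x \<le> y \<bullet> x} = b ` {1..i}"
proof (intro equalityI subsetI)
  have pos: "b j \<bullet> x > 0" if "1 \<le> j" "j \<le> n" for j
    using strictly_dominant_coord[OF assms(1), of j "Suc n"] that by (simp add: coord_def inner_commute)
  fix y assume "y \<in> {y \<in> B. b i \<bullet> x \<le> y \<bullet> x}"
  then have y: "y \<in> B" "b i \<bullet> x \<le> y \<bullet> x" by auto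
  from y(1) show "y \<in> b ` {1..i}"
  proof (cases rule: B_cases)
    case (pos j)
    have "\<not> i < j"
      using strictly_dominant_coord[OF assms(1), of i j] assms pos y(2) by (auto simp: coord_def inner_commute)
    then show ?thesis using pos by auto
  next
    case (neg j)
    then show ?thesis using pos[of i] pos[of j] assms y(2) by auto
  qed
next
  fix y assume "y \<in> b ` {1..i}"
  then obtain j where "y = b j" "1 \<le> j" "j \<le> i" by auto
  then show "y \<in> {y \<in> B. b i \<bullet> x \<le> y \<bullet> x}"
    using strictly_dominant_coord[OF assms(1), of j i] assms
    by (cases "j = i") (auto simp: coord_def inner_commute)
qed

text \<open>Applying w preserves ranks: w b_i has the same rank at w x as b_i has at x. Both points
  induce the same order on \<open>B\<close>, hence w b_i = b_i. This is the freeness of the action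
  on chambers, obtained without a length function.\<close>

lemma strictly_dominant_unique:
  assumes w: "w \<in> W" and x: "strictly_dominant x" "strictly_dominant (w x)"
  shows "w = id"
proof (rule linear_eq_on_b)
  fix i assume i: "1 \<le> i" "i \<le> n"
  have card_b: "card (b ` {1..j}) = j" if "j \<le> n" for j
    using that by (subst card_image) (auto simp: inj_on_def)
  have pos: "b j \<bullet> y > 0" if "1 \<le> j" "j \<le> n" "strictly_dominant y" for j y
    using strictly_dominant_coord[OF that(3), of j "Suc n"] that by (simp add: coord_def inner_commute)
  have img: "w ` {y \<in> B. b i \<bullet> x \<le> y \<bullet> x} = {y \<in> B. w (b i) \<bullet> w x \<le> y \<bullet> w x}"
  proof (intro equalityI subsetI)
    fix y assume "y \<in> {y \<in> B. w (b i) \<bullet> w x \<le> y \<bullet> w x}"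
    then have "inv w y \<in> {y \<in> B. b i \<bullet> x \<le> y \<bullet> x}"
      using W_B[OF W_inv[OF w]] by (auto simp: W_inner[OF w] W_inner_inv(1)[OF w])
    then show "y \<in> w ` {y \<in> B. b i \<bullet> x \<le> y \<bullet> x}"
      by (rule W_imageI[OF w])
  qed (use W_B[OF w] W_inner[OF w] in auto)
  have "inj_on w A" for A by (simp add: inj_on_def W_inj[OF w])
  then have "card {y \<in> B. w (b i) \<bullet> w x \<le> y \<bullet> w x} = card (b ` {1..i})"
    unfolding strictly_dominant_up[OF x(1) i, symmetric] img[symmetric] by (rule card_image)
  then have card: "card {y \<in> B. w (b i) \<bullet> w x \<le> y \<bullet> w x} = i" using card_b i by simp
  have "w (b i) \<in> B" using W_B[OF w] i by simp
  then show "w (b i) = id (b i)"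
  proof (cases rule: B_cases)
    case (pos j)
    then have "j = i" using strictly_dominant_up[OF x(2) pos(1,2)] card card_b by simp
    then show ?thesis using pos by simp
  next
    case (neg j)
    have "0 < w (b i) \<bullet> w x" using pos[OF i x(1)] W_inner[OF w] by simp
    then show ?thesis using neg pos[OF _ _ x(2), of j] by simp
  qed
qed (auto intro: W_linear w linear_id)

section \<open>Moving a perturbed point into the dominant chamber\<close>

text \<open>Roots positive at \<open>t\<close> stay positive under small perturbation; on the walls
  the direction \<open>y\<close> decides.\<close>

lemma eventually_strictly_dominant:
  assumes "dominant t" "\<And>\<alpha>. \<alpha> \<in> walls t \<Longrightarrow> 0 < \<alpha> \<bullet> y"
  shows "eventually (\<lambda>\<epsilon>. strictly_dominant (t + \<epsilon> *\<^sub>R y)) (at_right 0)"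
  unfolding strictly_dominant_def
proof (intro eventually_ball_finite finite_simple ballI)
  fix \<alpha> assume \<alpha>: "\<alpha> \<in> \<Delta>"
  show "eventually (\<lambda>\<epsilon>. 0 < \<alpha> \<bullet> (t + \<epsilon> *\<^sub>R y)) (at_right 0)"
  proof (cases "\<alpha> \<bullet> t = 0")
    case True
    then have "0 < \<alpha> \<bullet> y" using assms(2) \<alpha> by (auto simp: walls_def)
    then show ?thesis using True
      by (intro eventually_mono[OF eventually_at_right_less[of 0]]) (auto simp: inner_add_right)
  next
    case False
    then have "0 < \<alpha> \<bullet> t" using assms(1) \<alpha> by (auto simp: dominant_def order_less_le)
    moreover have "((\<lambda>\<epsilon>. \<alpha> \<bullet> (t + \<epsilon> *\<^sub>R y)) \<longlongrightarrow> \<alpha> \<bullet> (t + 0 *\<^sub>R y)) (at_right 0)"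
      by (intro tendsto_intros)
    ultimately show ?thesis by (intro order_tendstoD(1)) auto
  qed
qed

lemma obtain_at_right:
  assumes "eventually P (at_right (0::real))"
  obtains \<epsilon> where "0 < \<epsilon>" "P \<epsilon>"
proof -
  have "eventually (\<lambda>\<epsilon>. 0 < \<epsilon> \<and> P \<epsilon>) (at_right 0)"
    using assms eventually_at_right_less[of 0] by eventually_elim auto
  then show thesis using that eventually_happens[of _ "at_right (0::real)"] by (auto simp: trivial_limit_at_right_real)
qed

lemma parabolic_subset: "K \<subseteq> \<Delta> \<Longrightarrow> reflection_group K \<subseteq> W"
  by (rule reflection_group_mono) (auto intro: simple_root)

text \<open>Among the images of x under the finite group choose one with maximal pairing with
  \<open>rho\<close>. If some \<alpha> in \<open>K\<close> were negative there, reflecting in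
  \<alpha> would raise the pairing, since \<alpha> has height 1.\<close>

lemma parabolic_nonneg:
  assumes "K \<subseteq> \<Delta>"
  obtains u where "u \<in> reflection_group K" "\<And>\<alpha>. \<alpha> \<in> K \<Longrightarrow> 0 \<le> \<alpha> \<bullet> u x"
proof -
  let ?G = "reflection_group K"
  have fin: "finite ((\<lambda>u. u x \<bullet> rho) ` ?G)"
    using finite_subset[OF parabolic_subset[OF assms] finite_W] by simp
  have "Max ((\<lambda>u. u x \<bullet> rho) ` ?G) \<in> (\<lambda>u. u x \<bullet> rho) ` ?G"
    using fin reflection_group.id[of K] by (intro Max_in) auto
  then obtain u where u: "u \<in> ?G" "Max ((\<lambda>u. u x \<bullet> rho) ` ?G) = u x \<bullet> rho" by auto
  have "0 \<le> \<alpha> \<bullet> u x" if \<alpha>: "\<alpha> \<in> K" for \<alpha>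
  proof -
    have "reflection \<alpha> \<circ> u \<in> ?G" using \<alpha> u by (intro reflection_group.step)
    then have "(reflection \<alpha> \<circ> u) x \<bullet> rho \<le> Max ((\<lambda>u. u x \<bullet> rho) ` ?G)"
      using fin by (intro Max_ge) (blast intro: imageI)+
    then have "reflection \<alpha> (u x) \<bullet> rho \<le> u x \<bullet> rho" by (simp add: u(2))
    then have "0 \<le> (2 * (u x \<bullet> \<alpha>) / (\<alpha> \<bullet> \<alpha>)) * (\<alpha> \<bullet> rho)"
      by (simp add: reflection_eq inner_diff_left)
    moreover have rho: "\<alpha> \<bullet> rho = 1" using simple_rho \<alpha> assms by auto
    moreover have "0 < \<alpha> \<bullet> \<alpha>" using rho by auto
    ultimately show ?thesis by (simp add: zero_le_divide_iff inner_commute)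
  qed
  then show thesis using that u by blast
qed

text \<open>Perturb p by \<epsilon> \<open>rho\<close> so little that roots positive at p stay
  positive, and let u move the result into the closed chamber. Then u p is dominant, and on its
  walls the sign is decided by \<open>rho\<close>, strictly because no root is orthogonal to
  \<open>rho\<close>.\<close>

lemma good_exists: obtains v where "good v p"
proof -
  have "eventually (\<lambda>\<epsilon>. \<forall>\<beta>\<in>\<Phi>. 0 < \<beta> \<bullet> p \<longrightarrow> 0 < \<beta> \<bullet> (p + \<epsilon> *\<^sub>R rho)) (at_right 0)"
  proof (intro eventually_ball_finite finite_roots ballI)
    fix \<beta> assume "\<beta> \<in> \<Phi>"
    have "((\<lambda>\<epsilon>. \<beta> \<bullet> (p + \<epsilon> *\<^sub>R rho)) \<longlongrightarrow> \<beta> \<bullet> (p + 0 *\<^sub>R rho)) (at_right 0)"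
      by (intro tendsto_intros)
    then show "eventually (\<lambda>\<epsilon>. 0 < \<beta> \<bullet> p \<longrightarrow> 0 < \<beta> \<bullet> (p + \<epsilon> *\<^sub>R rho)) (at_right 0)"
      by (cases "0 < \<beta> \<bullet> p") (auto dest: order_tendstoD(1))
  qed
  then obtain \<epsilon> where \<epsilon>: "0 < \<epsilon>" "\<And>\<beta>. \<beta> \<in> \<Phi> \<Longrightarrow> 0 < \<beta> \<bullet> p \<Longrightarrow> 0 < \<beta> \<bullet> (p + \<epsilon> *\<^sub>R rho)"
    by (rule obtain_at_right) blast
  obtain u where u: "u \<in> reflection_group \<Delta>" "\<And>\<alpha>. \<alpha> \<in> \<Delta> \<Longrightarrow> 0 \<le> \<alpha> \<bullet> u (p + \<epsilon> *\<^sub>R rho)"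
    using parabolic_nonneg[of \<Delta> "p + \<epsilon> *\<^sub>R rho"] by blast
  have uW: "u \<in> W" using u(1) parabolic_subset by blast
  have inv_inv: "inv (inv u) = u" using reflection_group_bij[OF uW] by (rule inv_inv_eq)
  have root: "inv u \<alpha> \<in> \<Phi>" if "\<alpha> \<in> \<Delta>" for \<alpha> using W_root[OF W_inv[OF uW]] simple_root that by blast
  have nonneg: "0 \<le> inv u \<alpha> \<bullet> (p + \<epsilon> *\<^sub>R rho)" if "\<alpha> \<in> \<Delta>" for \<alpha>
    using u(2)[OF that] by (simp add: W_inner_inv[OF uW])
  have "good (inv u) p"
    unfolding good_def inv_inv
  proof (intro conjI W_inv uW ballI)
    show "dominant (u p)" unfolding dominant_def
    proof
      fix \<alpha> assume \<alpha>: "\<alpha> \<in> \<Delta>"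
      have "\<not> 0 < (- inv u \<alpha>) \<bullet> p"
        using \<epsilon>(2)[OF uminus_root[OF root[OF \<alpha>]]] nonneg[OF \<alpha>] by fastforce
      then show "0 \<le> \<alpha> \<bullet> u p" by (simp add: W_inner_inv[OF uW])
    qed
    fix \<alpha> assume "\<alpha> \<in> walls (u p)"
    then have \<alpha>: "\<alpha> \<in> \<Delta>" "inv u \<alpha> \<bullet> p = 0" by (auto simp: walls_def W_inner_inv[OF uW])
    then have "0 \<le> inv u \<alpha> \<bullet> rho" using nonneg[OF \<alpha>(1)] \<epsilon>(1)
      by (simp add: inner_add_right zero_le_mult_iff)
    then show "0 < inv u \<alpha> \<bullet> rho" using root_rho_nonzero[OF root[OF \<alpha>(1)]] by simp
  qed
  then show thesis using that by blast
qed

lemma inv_eq_imp_eq: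
  assumes "v \<in> W" "w \<in> W" "inv w \<circ> v = id"
  shows "v = w"
proof
  fix x
  have "w (inv w (v x)) = w x" using fun_cong[OF assms(3), of x] by simp
  then show "v x = w x" by (simp add: W_app[OF assms(2)])
qed

text \<open>Both inverses carry p + \<epsilon> \<open>rho\<close> into the open chamber for small
  \<epsilon>, so \<open>strictly_dominant_unique\<close> identifies them.\<close>

lemma good_unique:
  assumes "good v p" "good w p"
  shows "v = w"
proof -
  have vw: "v \<in> W" "w \<in> W" using assms by (auto simp: good_def)
  have ev: "eventually (\<lambda>\<epsilon>. strictly_dominant (inv v (p + \<epsilon> *\<^sub>R rho))) (at_right 0)" if "good v p" for v
  proof -
    have v: "v \<in> W" using that by (simp add: good_def)
    interpret linear "inv v" by (rule W_linear[OF W_inv[OF v]])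
    show ?thesis unfolding add scaleR
      by (rule eventually_strictly_dominant)
        (use that in \<open>auto simp: good_def W_inner_inv[OF v, symmetric] inner_commute\<close>)
  qed
  obtain \<epsilon> where \<epsilon>: "strictly_dominant (inv v (p + \<epsilon> *\<^sub>R rho))" "strictly_dominant (inv w (p + \<epsilon> *\<^sub>R rho))"
    using obtain_at_right[OF eventually_conj[OF ev[OF assms(1)] ev[OF assms(2)]]] by blast
  have "inv w \<circ> v = id"
    by (rule strictly_dominant_unique[OF _ \<epsilon>(1)])
      (use vw \<epsilon>(2) in \<open>auto simp: W_app intro: W_comp W_inv\<close>)
  then show ?thesis using inv_eq_imp_eq vw by blast
qed

section \<open>Roots vanishing at a dominant point\<close>

text \<open>The pairing with \<open>t\<close> is a sum of nonnegative terms equal to 0, so every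
  coefficient off the walls vanishes.\<close>

lemma nonneg_orthogonal_dominant:
  assumes "dominant t" "\<gamma> \<in> NN" "\<gamma> \<bullet> t = 0"
  obtains c where "\<And>\<alpha>. \<alpha> \<in> walls t \<Longrightarrow> 0 \<le> c \<alpha>" "\<gamma> = (\<Sum>\<alpha>\<in>walls t. c \<alpha> *\<^sub>R \<alpha>)"
proof -
  obtain c where c: "\<gamma> = (\<Sum>\<alpha>\<in>\<Delta>. c \<alpha> *\<^sub>R \<alpha>)" "\<forall>\<alpha>\<in>\<Delta>. 0 \<le> c \<alpha>"
    using assms(2) unfolding nonneg_combinations_def by auto
  have "(\<Sum>\<alpha>\<in>\<Delta>. c \<alpha> * (\<alpha> \<bullet> t)) = 0"
    using assms(3) by (simp add: c(1) inner_sum_left)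
  then have "\<forall>\<alpha>\<in>\<Delta>. c \<alpha> * (\<alpha> \<bullet> t) = 0"
    using assms(1) c(2) by (subst (asm) sum_nonneg_eq_0_iff) (auto simp: finite_simple dominant_def)
  then have "(\<Sum>\<alpha>\<in>\<Delta>. c \<alpha> *\<^sub>R \<alpha>) = (\<Sum>\<alpha>\<in>walls t. c \<alpha> *\<^sub>R \<alpha>)"
    by (intro sum.mono_neutral_right finite_simple) (auto simp: walls_def)
  then show thesis using that[of c] c by (auto simp: walls_def)
qed

lemma positive_on_walls:
  assumes "dominant t" "w \<in> W" "\<And>\<alpha>. \<alpha> \<in> walls t \<Longrightarrow> 0 < w \<alpha> \<bullet> rho"
    and \<gamma>: "\<gamma> \<in> \<Phi>" "0 < \<gamma> \<bullet> rho" "\<gamma> \<bullet> t = 0"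
  shows "0 < w \<gamma> \<bullet> rho"
proof -
  have "\<gamma> \<in> NN" using root_rho_nonneg(2) \<gamma> by simp
  then obtain c where c: "\<And>\<alpha>. \<alpha> \<in> walls t \<Longrightarrow> 0 \<le> c \<alpha>" "\<gamma> = (\<Sum>\<alpha>\<in>walls t. c \<alpha> *\<^sub>R \<alpha>)"
    using nonneg_orthogonal_dominant assms(1) \<gamma>(3) by metis
  interpret linear w by (rule W_linear[OF assms(2)])
  have "w \<gamma> \<bullet> rho = (\<Sum>\<alpha>\<in>walls t. c \<alpha> * (w \<alpha> \<bullet> rho))"
    unfolding c(2) by (simp add: sum scaleR inner_sum_left)
  also have "\<dots> \<ge> 0" using c(1) assms(3) by (intro sum_nonneg mult_nonneg_nonneg) (auto intro: less_imp_le)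
  finally show ?thesis using root_rho_nonzero[OF W_root[OF assms(2) \<gamma>(1)]] by simp
qed

text \<open>The pulled back root \<gamma> = v^-1 \<beta> vanishes at the dominant point v^-1 p,
  where v preserves positivity. So \<gamma> is positive, and if it were a sum of two positive roots,
  both would vanish there too and be sent by v to roots of height at least 1, contradicting the
  height 1 of \<beta>. This lemma is what makes subsets of simple roots go to subsets of simple
  roots.\<close>

lemma good_simple:
  assumes "good v p" "\<beta> \<in> \<Delta>" "\<beta> \<bullet> p = 0"
  shows "inv v \<beta> \<in> walls (inv v p)"
proof -
  define t where "t = inv v p"
  define \<gamma> where "\<gamma> = inv v \<beta>"
  have v: "v \<in> W" and t: "dominant t" "\<And>\<alpha>. \<alpha> \<in> walls t \<Longrightarrow> 0 < v \<alpha> \<bullet> rho"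
    using assms(1) by (auto simp: good_def t_def)
  have \<gamma>: "\<gamma> \<in> \<Phi>" "\<gamma> \<bullet> t = 0" "v \<gamma> = \<beta>"
    using W_root[OF W_inv[OF v]] simple_root[OF assms(2)] assms(3) W_inner[OF W_inv[OF v]]
    by (auto simp: \<gamma>_def t_def W_app[OF v])
  interpret linear v by (rule W_linear[OF v])
  have pos: "0 < \<gamma> \<bullet> rho"
  proof (rule ccontr)
    assume "\<not> 0 < \<gamma> \<bullet> rho"
    then have "0 < (- \<gamma>) \<bullet> rho" using root_rho_nonzero[OF \<gamma>(1)] by simp
    then have "0 < v (- \<gamma>) \<bullet> rho"
      using positive_on_walls[OF t(1) v t(2) uminus_root[OF \<gamma>(1)]] \<gamma>(2) by simp
    then show False using simple_rho[OF assms(2)] by (simp add: neg \<gamma>(3))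
  qed
  have "\<gamma> \<in> \<Delta>"
  proof (rule ccontr)
    assume "\<gamma> \<notin> \<Delta>"
    then obtain \<gamma>1 \<gamma>2 where d: "\<gamma>1 \<in> \<Phi>" "\<gamma>2 \<in> \<Phi>" "\<gamma>1 \<bullet> rho > 0" "\<gamma>2 \<bullet> rho > 0" "\<gamma> = \<gamma>1 + \<gamma>2"
      using positive_root_decompose[OF \<gamma>(1) pos] by blast
    have nn: "0 \<le> \<delta> \<bullet> t" if \<delta>: "\<delta> \<in> \<Phi>" "\<delta> \<bullet> rho > 0" for \<delta>
    proof -
      have "\<delta> \<in> NN" using root_rho_nonneg(2) \<delta> by simp
      then show ?thesis using t(1) unfolding nonneg_combinations_def dominant_def
        by (auto simp: inner_sum_left intro!: sum_nonneg)
    qed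
    have "\<gamma>1 \<bullet> t = 0" "\<gamma>2 \<bullet> t = 0"
      using nn[OF d(1,3)] nn[OF d(2,4)] \<gamma>(2) by (auto simp: d(5) inner_add_left)
    then have "0 < v \<gamma>1 \<bullet> rho" "0 < v \<gamma>2 \<bullet> rho"
      using positive_on_walls[OF t(1) v t(2)] d by auto
    then have "1 \<le> v \<gamma>1 \<bullet> rho" "1 \<le> v \<gamma>2 \<bullet> rho"
      using root_rho_nonneg(1) W_root[OF v] d by (simp_all add: less_imp_le)
    then have "2 \<le> v \<gamma> \<bullet> rho" by (simp add: d(5) add inner_add_left)
    then show False using simple_rho[OF assms(2)] by (simp add: \<gamma>(3))
  qed
  then show ?thesis using \<gamma>(2) by (simp add: walls_def \<gamma>_def t_def)
qed

text \<open>Up to sign such a root is a combination of the wall roots of \<open>t\<close>.\<close>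

lemma root_zero_on_FS:
  assumes "dominant t" "\<gamma> \<in> \<Phi>" "\<gamma> \<bullet> t = 0" "y \<in> FS (walls t)"
  shows "\<gamma> \<bullet> y = 0"
proof -
  have *: "\<gamma> \<bullet> y = 0" if \<gamma>: "\<gamma> \<in> NN" "\<gamma> \<bullet> t = 0" for \<gamma>
  proof -
    obtain c where "\<gamma> = (\<Sum>\<alpha>\<in>walls t. c \<alpha> *\<^sub>R \<alpha>)"
      using nonneg_orthogonal_dominant[OF assms(1) \<gamma>] by blast
    then show ?thesis using assms(4) by (simp add: inner_sum_left)
  qed
  show ?thesis
  proof (cases "0 \<le> \<gamma> \<bullet> rho")
    case True
    then show ?thesis using * root_rho_nonneg(2) assms by blast
  next
    case False
    then have "- \<gamma> \<in> NN" using root_rho_nonneg(2)[OF uminus_root[OF assms(2)]] by simp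
    then show ?thesis using *[of "- \<gamma>"] assms(3) by simp
  qed
qed

text \<open>The smallest integral point in the open face of \<open>K\<close>: each coordinate counts
  the drops still to come on the way down to 0, and every drop is 1.\<close>

definition face_vec :: "'a set \<Rightarrow> 'a" where
  "face_vec K = vec (\<lambda>i. real (card {j \<in> {i..n}. nth_simple j \<notin> K}))"

lemma coord_face_vec: "1 \<le> i \<Longrightarrow> coord (face_vec K) i = real (card {j \<in> {i..n}. nth_simple j \<notin> K})"
  by (cases "i \<le> n") (auto simp: face_vec_def)

lemma face_vec_inner: "1 \<le> i \<Longrightarrow> i \<le> n \<Longrightarrow> nth_simple i \<bullet> face_vec K = (if nth_simple i \<in> K then 0 else if i = n then 2 else 1)"
proof -
  assume i: "1 \<le> i" "i \<le> n"
  have "{j \<in> {i..n}. nth_simple j \<notin> K} = (if nth_simple i \<in> K then {} else {i}) \<union> {j \<in> {Suc i..n}. nth_simple j \<notin> K}"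
    using i by (auto simp: le_eq_less_or_eq Suc_le_eq)
  then have "card {j \<in> {i..n}. nth_simple j \<notin> K} = (if nth_simple i \<in> K then 0 else 1) + card {j \<in> {Suc i..n}. nth_simple j \<notin> K}"
    by (auto simp: card_insert_if)
  then show ?thesis using i by (simp add: nth_simple_inner coord_face_vec)
qed

lemma dominant_face_vec: "dominant (face_vec K)"
  by (auto simp: dominant_def simple_eq face_vec_inner)

lemma walls_face_vec: "K \<subseteq> \<Delta> \<Longrightarrow> walls (face_vec K) = K"
  unfolding walls_def simple_eq by (auto simp: face_vec_inner split: if_splits)

lemma face_vec_FS: "K \<subseteq> \<Delta> \<Longrightarrow> face_vec K \<in> FS K"
  using walls_face_vec[of K] by (auto simp: walls_def)

text \<open>The witness against any further simple root is \<open>face_vec K\<close>, which is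
  positive on all of them.\<close>

lemma simple_in_iff_FS:
  assumes "K \<subseteq> \<Delta>" "\<alpha> \<in> \<Delta>"
  shows "\<alpha> \<in> K \<longleftrightarrow> (\<forall>y\<in>FS K. \<alpha> \<bullet> y = 0)"
proof
  assume "\<forall>y\<in>FS K. \<alpha> \<bullet> y = 0"
  then have "\<alpha> \<bullet> face_vec K = 0" using face_vec_FS[OF assms(1)] by blast
  then show "\<alpha> \<in> K" using assms(2) walls_face_vec[OF assms(1)] by (auto simp: walls_def)
qed auto

lemma parabolic_fixes: "u \<in> reflection_group K \<Longrightarrow> y \<in> FS K \<Longrightarrow> u y = y"
  using fixed_space_reflection_group[of K] by (auto simp: fixed_space_def)

text \<open>As u fixes \<open>face_vec K\<close>, adding a small multiple of y, respectively u y, to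
  it gives strictly dominant points exchanged by u, and uniqueness for the whole group
  applies.\<close>

lemma parabolic_unique:
  assumes K: "K \<subseteq> \<Delta>" and u: "u \<in> reflection_group K"
    and y: "\<And>\<alpha>. \<alpha> \<in> K \<Longrightarrow> 0 < \<alpha> \<bullet> y" "\<And>\<alpha>. \<alpha> \<in> K \<Longrightarrow> 0 < \<alpha> \<bullet> u y"
  shows "u = id"
proof -
  have uW: "u \<in> W" using u parabolic_subset[OF K] by blast
  interpret linear u by (rule W_linear[OF uW])
  have ev: "eventually (\<lambda>\<epsilon>. strictly_dominant (face_vec K + \<epsilon> *\<^sub>R z)) (at_right 0)"
    if "\<And>\<alpha>. \<alpha> \<in> K \<Longrightarrow> 0 < \<alpha> \<bullet> z" for z
    by (rule eventually_strictly_dominant) (use that in \<open>simp_all add: dominant_face_vec walls_face_vec[OF K]\<close>)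
  obtain \<epsilon> where "strictly_dominant (face_vec K + \<epsilon> *\<^sub>R y)" "strictly_dominant (face_vec K + \<epsilon> *\<^sub>R u y)"
    using obtain_at_right[OF eventually_conj[OF ev[of y, OF y(1)] ev[of "u y", OF y(2)]]] by blast
  then show ?thesis
    using strictly_dominant_unique[OF uW, of "face_vec K + \<epsilon> *\<^sub>R y"] parabolic_fixes[OF u face_vec_FS[OF K]]
    by (simp add: add scaleR)
qed

section \<open>Normalizers of parabolic subgroups and conjugacy classes of subsets\<close>

text \<open>Conjugation is an injective self-map of a finite group, so inclusion already gives
  equality.\<close>

lemma normalizer_conj:
  assumes K: "K \<subseteq> \<Delta>" and w: "w \<in> W"
    and conj: "\<And>u. u \<in> reflection_group K \<Longrightarrow> w \<circ> u \<circ> inv w \<in> reflection_group K"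
  shows "w \<in> normalizer_in W (reflection_group K)"
proof -
  have "inj_on (\<lambda>u. w \<circ> u \<circ> inv w) (reflection_group K)"
  proof (rule inj_onI)
    fix u u' assume "w \<circ> u \<circ> inv w = w \<circ> u' \<circ> inv w"
    then have "w (u (inv w (w x))) = w (u' (inv w (w x)))" for x by (metis comp_apply)
    then show "u = u'" by (auto simp: fun_eq_iff W_app[OF w] W_inj[OF w])
  qed
  moreover have "finite (reflection_group K)"
    using finite_subset[OF parabolic_subset[OF K] finite_W] .
  ultimately have "(\<lambda>u. w \<circ> u \<circ> inv w) ` reflection_group K = reflection_group K"
    using conj by (intro endo_inj_surj) auto
  then show ?thesis using w by (simp add: normalizer_in_def)
qed

lemma W_inv_comp: "v \<in> W \<Longrightarrow> w \<in> W \<Longrightarrow> inv (v \<circ> w) = inv w \<circ> inv v"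
  by (rule o_inv_distrib) (auto intro: reflection_group_bij)

text \<open>Every element of the normalizer factors uniquely as u z with u in W_K and z permuting
  \<open>K\<close>. Uniqueness holds because z \<open>rho\<close> is positive on \<open>K\<close>
  for every such z, so only the identity of W_K can carry one such point to another.\<close>

lemma normalizer_card:
  assumes K: "K \<subseteq> \<Delta>"
  shows "card (normalizer_in W (reflection_group K)) = card (reflection_group K) * card {z \<in> W. z ` K = K}"
proof -
  let ?G = "reflection_group K" and ?Z = "{z \<in> W. z ` K = K}"
  have GW: "u \<in> ?G \<Longrightarrow> u \<in> W" for u using parabolic_subset[OF K] by blast
  have Gcomp: "u \<in> ?G \<Longrightarrow> v \<in> ?G \<Longrightarrow> u \<circ> v \<in> ?G" for u v by (rule reflection_group_comp)
  have Ginv: "u \<in> ?G \<Longrightarrow> inv u \<in> ?G" for u by (rule reflection_group_inv)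
  have Zpos: "0 < \<alpha> \<bullet> z rho" if zZ: "z \<in> ?Z" "\<alpha> \<in> K" for z \<alpha>
  proof -
    obtain \<beta> where \<beta>: "\<beta> \<in> K" "\<alpha> = z \<beta>" using zZ by auto
    then show ?thesis using zZ(1) simple_rho[of \<beta>] K by (auto simp: W_inner)
  qed
  have N_conj: "w \<circ> u \<circ> inv w \<in> ?G" if "w \<in> normalizer_in W ?G" "u \<in> ?G" for w u
    using that unfolding normalizer_in_def by blast
  have inj: "inj_on (\<lambda>(u, z). u \<circ> z) (?G \<times> ?Z)"
  proof (rule inj_onI, clarify)
    fix u z u' z' assume u: "u \<in> ?G" "u' \<in> ?G" and z: "z \<in> W" "z ` K = K" "z' \<in> W" "z' ` K = K"
      and eq: "u \<circ> z = u' \<circ> z'"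
    have *: "(inv u' \<circ> u) (z x) = z' x" for x
      using fun_cong[OF eq, of x] by (simp add: W_app[OF GW[OF u(2)]])
    have "inv u' \<circ> u = id"
      by (rule parabolic_unique[OF K Gcomp[OF Ginv[OF u(2)] u(1)], of "z rho"])
        (use * Zpos[of z] Zpos[of z'] z in auto)
    then have "u = u'" using inv_eq_imp_eq GW u by blast
    moreover have "z = z'"
      using * \<open>inv u' \<circ> u = id\<close> by (auto simp: fun_eq_iff)
    ultimately show "u = u' \<and> z = z'" by simp
  qed
  have "(\<lambda>(u, z). u \<circ> z) ` (?G \<times> ?Z) = normalizer_in W ?G"
  proof (intro equalityI subsetI)
    fix w assume "w \<in> (\<lambda>(u, z). u \<circ> z) ` (?G \<times> ?Z)"
    then obtain u z where uz: "u \<in> ?G" "z \<in> W" "z ` K = K" "w = u \<circ> z" by auto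
    show "w \<in> normalizer_in W ?G"
    proof (rule normalizer_conj[OF K])
      show "w \<in> W" using uz GW by (auto intro: W_comp)
      fix y assume y: "y \<in> ?G"
      have "z \<circ> y \<circ> inv z \<in> ?G" using reflection_group_conj[OF uz(2) y] uz(3) by simp
      then have "u \<circ> (z \<circ> y \<circ> inv z) \<circ> inv u \<in> ?G" by (rule Gcomp[OF Gcomp[OF uz(1)] Ginv[OF uz(1)]])
      moreover have "u \<circ> (z \<circ> y \<circ> inv z) \<circ> inv u = w \<circ> y \<circ> inv w"
        unfolding uz(4) W_inv_comp[OF GW[OF uz(1)] uz(2)] by (simp add: comp_assoc)
      ultimately show "w \<circ> y \<circ> inv w \<in> ?G" by simp
    qed
  next
    fix w assume wN: "w \<in> normalizer_in W ?G"
    then have w: "w \<in> W" by (simp add: normalizer_in_def)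
    \<comment> \<open>This u corrects w so that z = u w has z^-1 \<open>K\<close> positive; it
      remains to see that z permutes \<open>K\<close>.\<close>
    obtain u where u: "u \<in> ?G" "\<And>\<alpha>. \<alpha> \<in> K \<Longrightarrow> 0 \<le> \<alpha> \<bullet> u (w rho)"
      using parabolic_nonneg[OF K] by metis
    define z where "z = u \<circ> w"
    have z: "z \<in> W" unfolding z_def using u w GW by (auto intro: W_comp)
    have inv_inv: "inv (inv z) = z" using reflection_group_bij[OF z] by (rule inv_inv_eq)
    have zpos: "0 < inv z \<alpha> \<bullet> rho" if "\<alpha> \<in> K" for \<alpha>
    proof -
      have "inv z \<alpha> \<in> \<Phi>" using W_root[OF W_inv[OF z]] simple_root that K by blast
      moreover have "0 \<le> inv z \<alpha> \<bullet> rho"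
        unfolding W_inner_inv(1)[OF z] using u(2)[OF that] by (simp add: z_def)
      ultimately show ?thesis using root_rho_nonzero by fastforce
    qed
    \<comment> \<open>The walls of \<open>face_vec K\<close> are exactly \<open>K\<close>, so
      positivity of z^-1 on \<open>K\<close> is all that \<open>good\<close> requires.\<close>
    have good: "good (inv z) (inv z (face_vec K))"
      unfolding good_def inv_inv W_app[OF z] using zpos
      by (auto simp: dominant_face_vec walls_face_vec[OF K] intro: W_inv z)
    have "z \<beta> \<in> K" if \<beta>: "\<beta> \<in> K" for \<beta>
    proof -
      have "w \<circ> reflection \<beta> \<circ> inv w \<in> ?G" using \<beta> by (intro N_conj wN reflection_group_reflection)
      then have "u \<circ> (w \<circ> reflection \<beta> \<circ> inv w) \<circ> inv u \<in> ?G" by (rule Gcomp[OF Gcomp[OF u(1)] Ginv[OF u(1)]])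
      moreover have "u \<circ> (w \<circ> reflection \<beta> \<circ> inv w) \<circ> inv u = z \<circ> reflection \<beta> \<circ> inv z"
        unfolding z_def W_inv_comp[OF GW[OF u(1)] w] by (simp add: comp_assoc)
      ultimately have "reflection (z \<beta>) \<in> ?G" by (simp add: reflection_conj[OF z])
      \<comment> \<open>Being in W_K, the reflection in z \<beta> fixes the face of \<open>K\<close>
        pointwise; hence \<beta> vanishes at z^-1 \<open>face_vec K\<close>, and
        \<open>good_simple\<close> places z \<beta> among the walls.\<close>
      then have "reflection (z \<beta>) (face_vec K) = face_vec K"
        using parabolic_fixes face_vec_FS[OF K] by blast
      then have "\<beta> \<bullet> inv z (face_vec K) = 0"
        by (simp add: reflection_fixes_iff W_inner_inv(2)[OF z])
      then have "inv (inv z) \<beta> \<in> walls (inv (inv z) (inv z (face_vec K)))"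
        using good_simple[OF good] \<beta> K by blast
      then show ?thesis by (simp add: inv_inv W_app[OF z] walls_face_vec[OF K])
    qed
    then have "z ` K = K"
      using finite_subset[OF K finite_simple] W_inj[OF z] by (intro endo_inj_surj) (auto simp: inj_on_def)
    moreover have "w = inv u \<circ> z" unfolding z_def by (auto simp: fun_eq_iff W_app[OF GW[OF u(1)]])
    ultimately show "w \<in> (\<lambda>(u, z). u \<circ> z) ` (?G \<times> ?Z)"
      using z Ginv[OF u(1)] by (auto intro!: image_eqI[of _ _ "(inv u, z)"])
  qed
  then have "card (normalizer_in W ?G) = card (?G \<times> ?Z)" using card_image[OF inj] by simp
  then show ?thesis by (simp add: card_cartesian_product)
qed

lemma subset_class_eq: "K \<subseteq> \<Delta> \<Longrightarrow> subset_class \<Phi> \<Delta> K = {J. J \<subseteq> \<Delta> \<and> (\<exists>w\<in>W. w ` K = J)}"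
  by (auto simp: subset_class_def subset_conj_def)

lemma finite_subset_class: "K \<subseteq> \<Delta> \<Longrightarrow> finite (subset_class \<Phi> \<Delta> K)"
  by (rule finite_subset[of _ "Pow \<Delta>"]) (auto simp: subset_class_eq finite_simple)

lemma W_image_card: "w \<in> W \<Longrightarrow> card (w ` K) = card K"
  by (rule card_image) (auto simp: inj_on_def W_inj)

text \<open>The elements with a prescribed image J of \<open>K\<close> form a left coset of the
  stabilizer of \<open>K\<close>.\<close>

lemma subset_class_card:
  assumes K: "K \<subseteq> \<Delta>"
  shows "card {w \<in> W. w ` K \<subseteq> \<Delta>} = card (subset_class \<Phi> \<Delta> K) * card {z \<in> W. z ` K = K}"
proof -
  have "{w \<in> W. w ` K \<subseteq> \<Delta>} = (\<Union>J\<in>subset_class \<Phi> \<Delta> K. {w \<in> W. w ` K = J})"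
    by (auto simp: subset_class_eq[OF K])
  then have "card {w \<in> W. w ` K \<subseteq> \<Delta>} = (\<Sum>J\<in>subset_class \<Phi> \<Delta> K. card {w \<in> W. w ` K = J})"
    using finite_subset_class[OF K] finite_W by (simp only:) (rule card_UN_disjoint, auto)
  also have "\<dots> = (\<Sum>J\<in>subset_class \<Phi> \<Delta> K. card {z \<in> W. z ` K = K})"
  proof (rule sum.cong[OF refl])
    fix J assume "J \<in> subset_class \<Phi> \<Delta> K"
    then obtain w where w: "w \<in> W" "w ` K = J" by (auto simp: subset_class_eq[OF K])
    have "bij_betw (\<lambda>z. w \<circ> z) {z \<in> W. z ` K = K} {w \<in> W. w ` K = J}"
    proof (rule bij_betw_byWitness[where f' = "\<lambda>v. inv w \<circ> v"])
      show "(\<lambda>z. w \<circ> z) ` {z \<in> W. z ` K = K} \<subseteq> {w \<in> W. w ` K = J}"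
      proof clarify
        fix z assume "z \<in> W" "z ` K = K"
        then show "w \<circ> z \<in> W \<and> (w \<circ> z) ` K = J"
          using w W_comp by (simp only: image_comp[symmetric])
      qed
      show "(\<lambda>v. inv w \<circ> v) ` {w \<in> W. w ` K = J} \<subseteq> {z \<in> W. z ` K = K}"
      proof (rule image_subsetI)
        fix v assume "v \<in> {w \<in> W. w ` K = J}"
        then have v: "v \<in> W" "v ` K = J" by auto
        have "(inv w \<circ> v) ` K = inv w ` w ` K" by (simp only: image_comp[symmetric] v(2) w(2))
        also have "\<dots> = K" by (simp add: image_image W_app[OF w(1)])
        finally show "inv w \<circ> v \<in> {z \<in> W. z ` K = K}"
          using W_comp[OF W_inv[OF w(1)] v(1)] by blast
      qed
    qed (auto simp: fun_eq_iff W_app[OF w(1)])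
    then show "card {w \<in> W. w ` K = J} = card {z \<in> W. z ` K = K}" by (rule bij_betw_same_card[symmetric])
  qed
  finally show ?thesis by simp
qed

subsection \<open>Lattice points\<close>

definition cube :: "nat \<Rightarrow> 'a set" where
  "cube m = {p. \<forall>i\<in>{1..n}. coord p i \<in> real_of_int ` {- int m..int m}}"

lemma cube_coord: "p \<in> cube m \<Longrightarrow> coord p i \<in> real_of_int ` {- int m..int m}"
  by (cases "i \<in> {1..n}") (auto simp: cube_def coord_def)

text \<open>w permutes the coordinates up to sign, and the range of a coordinate is
  symmetric.\<close>

lemma W_cube:
  assumes w: "w \<in> W" and p: "p \<in> cube m"
  shows "w p \<in> cube m"
  unfolding cube_def
proof (intro CollectI ballI)
  fix i assume i: "i \<in> {1..n}"
  have eq: "coord (w p) i = p \<bullet> inv w (b i)" using i by (simp add: coord_def W_inner_inv(2)[OF w])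
  have "inv w (b i) \<in> B" using W_B[OF W_inv[OF w]] i by simp
  then show "coord (w p) i \<in> real_of_int ` {- int m..int m}"
  proof (cases rule: B_cases)
    case (pos j)
    then have "coord (w p) i = coord p j" using eq by (simp add: coord_def)
    then show ?thesis using cube_coord[OF p] by simp
  next
    case (neg j)
    then have "coord (w p) i = - coord p j" using eq by (simp add: coord_def)
    moreover obtain x where "coord p j = real_of_int x" "x \<in> {- int m..int m}" using cube_coord[OF p, of j] by auto
    ultimately show ?thesis by (intro image_eqI[of _ _ "- x"]) auto
  qed
qed

lemma W_cube_image: "w \<in> W \<Longrightarrow> w ` (Y \<inter> cube m) = w ` Y \<inter> cube m"
proof -
  assume w: "w \<in> W"
  have "w p \<in> cube m \<longleftrightarrow> p \<in> cube m" for p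
    using W_cube[OF W_inv[OF w], of "w p" m] W_cube[OF w, of p m] W_app(1)[OF w, of p] by metis
  then show ?thesis by blast
qed

section \<open>Standard flats in coordinates\<close>

text \<open>The places where a point of \<open>FS K\<close> may change from coordinate i to i + 1,
  with a break at n meaning a change to 0. Such a point is constant on the blocks that end at breaks
  and 0 after the last one.\<close>

definition breaks :: "'a set \<Rightarrow> nat set" where
  "breaks K = {i \<in> {1..n}. nth_simple i \<notin> K}"

lemma finite_breaks: "finite (breaks K)"
  by (simp add: breaks_def)

lemma breaks_bounds: "i \<in> breaks K \<Longrightarrow> 1 \<le> i \<and> i \<le> n"
  by (simp add: breaks_def)

lemma card_breaks: "K \<subseteq> \<Delta> \<Longrightarrow> card (breaks K) = n - card K"
proof -
  assume K: "K \<subseteq> \<Delta>"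
  have "nth_simple ` breaks K = \<Delta> - K" unfolding breaks_def simple_eq by auto
  moreover have "inj_on nth_simple (breaks K)" by (rule inj_on_subset[OF inj_nth_simple]) (auto simp: breaks_def)
  ultimately have "card (breaks K) = card (\<Delta> - K)" using card_image by fastforce
  then show ?thesis using K finite_simple by (simp add: card_Diff_subset finite_subset card_simple)
qed

lemma card_subset_simple: "K \<subseteq> \<Delta> \<Longrightarrow> card K \<le> n"
  using card_mono[OF finite_simple] card_simple by auto

lemma nth_simple_inner_zero_iff: "1 \<le> i \<Longrightarrow> i \<le> n \<Longrightarrow> nth_simple i \<bullet> x = 0 \<longleftrightarrow> coord x i = coord x (Suc i)"
  by (simp add: nth_simple_inner)

lemma nth_simple_inner_pos_iff: "1 \<le> i \<Longrightarrow> i \<le> n \<Longrightarrow> 0 < nth_simple i \<bullet> x \<longleftrightarrow> coord x (Suc i) < coord x i"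
  by (simp add: nth_simple_inner)

lemma nth_simple_inner_nonneg_iff: "1 \<le> i \<Longrightarrow> i \<le> n \<Longrightarrow> 0 \<le> nth_simple i \<bullet> x \<longleftrightarrow> coord x (Suc i) \<le> coord x i"
  by (simp add: nth_simple_inner)

lemma FS_iff_coord:
  assumes "K \<subseteq> \<Delta>"
  shows "p \<in> FS K \<longleftrightarrow> (\<forall>i\<in>{1..n} - breaks K. coord p i = coord p (Suc i))"
proof -
  have "K = nth_simple ` ({1..n} - breaks K)" using assms unfolding simple_eq breaks_def by auto
  then have "p \<in> FS K \<longleftrightarrow> (\<forall>\<alpha>\<in>nth_simple ` ({1..n} - breaks K). \<alpha> \<bullet> p = 0)" by simp
  also have "\<dots> \<longleftrightarrow> (\<forall>i\<in>{1..n} - breaks K. nth_simple i \<bullet> p = 0)" by blast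
  finally have "p \<in> FS K \<longleftrightarrow> (\<forall>i\<in>{1..n} - breaks K. nth_simple i \<bullet> p = 0)" .
  then show ?thesis by (auto simp: nth_simple_inner_zero_iff)
qed

text \<open>The right end of the block of i. The value n + 1 stands for the zero block, in agreement
  with \<open>coord\<close> being 0 at n + 1.\<close>

definition next_break :: "'a set \<Rightarrow> nat \<Rightarrow> nat" where
  "next_break K i = (if \<exists>j\<in>breaks K. i \<le> j then Min {j \<in> breaks K. i \<le> j} else Suc n)"

lemma next_break_cases: "next_break K i = Suc n \<or> next_break K i \<in> breaks K \<and> i \<le> next_break K i"
proof (cases "\<exists>j\<in>breaks K. i \<le> j")
  case True
  then have "Min {j \<in> breaks K. i \<le> j} \<in> {j \<in> breaks K. i \<le> j}"
    using finite_breaks by (intro Min_in) auto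
  then show ?thesis using True by (auto simp: next_break_def)
qed (auto simp: next_break_def)

lemma next_break_breaks: "i \<in> breaks K \<Longrightarrow> next_break K i = i"
  unfolding next_break_def using finite_breaks[of K] by (auto intro!: Min_eqI)

lemma next_break_Suc: "i \<notin> breaks K \<Longrightarrow> next_break K i = next_break K (Suc i)"
proof -
  assume "i \<notin> breaks K"
  then have "{j \<in> breaks K. i \<le> j} = {j \<in> breaks K. Suc i \<le> j}" by (auto simp: Suc_le_eq le_less)
  then show ?thesis unfolding next_break_def by auto
qed

lemma next_break_Suc_n: "n < i \<Longrightarrow> next_break K i = Suc n"
  unfolding next_break_def using breaks_bounds by fastforce

lemma coord_next_break:
  assumes K: "K \<subseteq> \<Delta>" and p: "p \<in> FS K" and i: "1 \<le> i" "i \<le> Suc n"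
  shows "coord p i = coord p (next_break K i)"
  using i(2,1)
proof (induction i rule: inc_induct)
  case base
  then show ?case by (simp add: next_break_Suc_n)
next
  case (step i)
  then show ?case
    using p FS_iff_coord[OF K, of p] by (cases "i \<in> breaks K") (auto simp: next_break_breaks next_break_Suc)
qed

lemma FS_eqI:
  assumes "K \<subseteq> \<Delta>" "p \<in> FS K" "q \<in> FS K" "\<And>i. i \<in> breaks K \<Longrightarrow> coord p i = coord q i"
  shows "p = q"
proof (rule eqI_coord)
  fix i assume "1 \<le> i" "i \<le> n"
  then show "coord p i = coord q i"
    using coord_next_break[OF assms(1,2), of i] coord_next_break[OF assms(1,3), of i] next_break_cases[of K i] assms(4) by auto
qed

text \<open>The point of \<open>FS K\<close> with prescribed block values; it inverts restriction of
  the coordinates to the breaks.\<close>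

definition ext :: "'a set \<Rightarrow> (nat \<Rightarrow> real) \<Rightarrow> 'a" where
  "ext K f = vec (\<lambda>i. if next_break K i = Suc n then 0 else f (next_break K i))"

lemma coord_ext: "1 \<le> i \<Longrightarrow> i \<le> Suc n \<Longrightarrow> coord (ext K f) i = (if next_break K i = Suc n then 0 else f (next_break K i))"
  by (cases "i = Suc n") (auto simp: ext_def next_break_Suc_n)

lemma coord_ext_breaks: "i \<in> breaks K \<Longrightarrow> coord (ext K f) i = f i"
  using breaks_bounds[of i K] by (simp add: coord_ext next_break_breaks)

lemma ext_FS: "K \<subseteq> \<Delta> \<Longrightarrow> ext K f \<in> FS K"
  by (subst FS_iff_coord) (auto simp: coord_ext next_break_Suc)

text \<open>The coordinates at the breaks can be chosen freely and independently, and they determine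
  the point.\<close>

lemma FS_cube_card:
  assumes K: "K \<subseteq> \<Delta>"
  shows "card (FS K \<inter> cube m) = (2 * m + 1) ^ card (breaks K)"
proof -
  let ?S = "real_of_int ` {- int m..int m}"
  have "bij_betw (\<lambda>p. restrict (coord p) (breaks K)) (FS K \<inter> cube m) (PiE (breaks K) (\<lambda>_. ?S))"
  proof (rule bij_betwI')
    fix p q assume p: "p \<in> FS K \<inter> cube m" and q: "q \<in> FS K \<inter> cube m"
    show "(restrict (coord p) (breaks K) = restrict (coord q) (breaks K)) = (p = q)"
    proof
      assume eq: "restrict (coord p) (breaks K) = restrict (coord q) (breaks K)"
      show "p = q"
      proof (rule FS_eqI[OF K IntD1[OF p] IntD1[OF q]])
        fix i assume "i \<in> breaks K"
        then show "coord p i = coord q i" using fun_cong[OF eq, of i] by simp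
      qed
    qed simp
  next
    fix p assume "p \<in> FS K \<inter> cube m"
    then show "restrict (coord p) (breaks K) \<in> PiE (breaks K) (\<lambda>_. ?S)" using cube_coord by auto
  next
    fix f assume f: "f \<in> PiE (breaks K) (\<lambda>_. ?S)"
    have z: "0 \<in> ?S" by (auto simp: image_iff intro!: bexI[of _ 0])
    have "ext K f \<in> cube m"
      unfolding cube_def
    proof (intro CollectI ballI)
      fix i assume i: "i \<in> {1..n}"
      have "f (next_break K i) \<in> ?S" if "next_break K i \<noteq> Suc n"
        using that next_break_cases[of K i] f by (auto simp: PiE_iff)
      then show "coord (ext K f) i \<in> ?S" using i z by (simp add: coord_ext)
    qed
    moreover have "restrict (coord (ext K f)) (breaks K) = f"
      using f by (auto simp: coord_ext_breaks PiE_iff extensional_def restrict_def fun_eq_iff)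
    ultimately show "\<exists>p\<in>FS K \<inter> cube m. f = restrict (coord p) (breaks K)"
      using ext_FS[OF K] by (intro bexI[of _ "ext K f"]) auto
  qed
  then have "card (FS K \<inter> cube m) = card (PiE (breaks K) (\<lambda>_. ?S))" by (rule bij_betw_same_card)
  also have "\<dots> = card ?S ^ card (breaks K)" by (simp add: card_PiE finite_breaks)
  also have "card ?S = 2 * m + 1" by (subst card_image) (auto simp: inj_on_def)
  finally show ?thesis .
qed

text \<open>With \<open>K\<close> empty the count above is positive, and an infinite set has
  cardinality 0.\<close>

lemma finite_cube: "finite (cube m)"
proof -
  have "FS {} \<inter> cube m = cube m" by auto
  then have "0 < card (cube m)" using FS_cube_card[of "{}" m] by simp
  then show ?thesis by (rule card_ge_0_finite)
qed

lemma FS_subspace: "subspace (FS S)"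
  by (auto simp: subspace_def inner_add_right)

lemma dim_FS:
  assumes K: "K \<subseteq> \<Delta>"
  shows "dim (FS K) = card (breaks K)"
proof -
  have "{y \<in> UNIV. \<forall>x\<in>span K. orthogonal x y} = FS K"
  proof (intro equalityI subsetI)
    fix y assume "y \<in> FS K"
    then have "orthogonal x y" if "x \<in> span K" for x
      using orthogonal_to_span[OF that, of y] by (auto simp: orthogonal_def inner_commute)
    then show "y \<in> {y \<in> UNIV. \<forall>x\<in>span K. orthogonal x y}" by auto
  qed (auto simp: orthogonal_def intro: span_base)
  moreover have "dim (span K) = card K"
    using independent_mono[OF independent_simple K] by (simp add: dim_eq_card_independent)
  ultimately have "dim (FS K) + card K = n"
    using dim_subspace_orthogonal_to_vectors[of "span K" UNIV] by (simp add: n_eq)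
  then show ?thesis using card_breaks[OF K] by simp
qed

section \<open>Integral points of open faces\<close>

definition face_points :: "'a set \<Rightarrow> nat \<Rightarrow> 'a set" where
  "face_points K m = {t \<in> cube m. dominant t \<and> walls t = K}"

lemma face_points_iff:
  assumes "K \<subseteq> \<Delta>"
  shows "dominant t \<and> walls t = K \<longleftrightarrow>
    (\<forall>i\<in>{1..n}. if i \<in> breaks K then coord t (Suc i) < coord t i else coord t i = coord t (Suc i))"
proof -
  have "dominant t \<and> walls t = K \<longleftrightarrow> (\<forall>i\<in>{1..n}. 0 \<le> nth_simple i \<bullet> t \<and> (nth_simple i \<bullet> t = 0 \<longleftrightarrow> nth_simple i \<in> K))"
    using assms unfolding dominant_def walls_def simple_eq by auto
  also have "\<dots> \<longleftrightarrow> (\<forall>i\<in>{1..n}. if i \<in> breaks K then coord t (Suc i) < coord t i else coord t i = coord t (Suc i))"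
    by (intro ball_cong refl) (auto simp: breaks_def nth_simple_inner_zero_iff nth_simple_inner_nonneg_iff)
  finally show ?thesis .
qed

lemma dominant_coord_antimono:
  assumes "dominant t" "1 \<le> i" "i \<le> j" "j \<le> Suc n"
  shows "coord t j \<le> coord t i"
  using assms(3,4)
proof (induction j rule: dec_induct)
  case (step j)
  have "0 \<le> nth_simple j \<bullet> t" using assms(1,2) step by (auto simp: dominant_def simple_eq)
  then have "coord t (Suc j) \<le> coord t j" using nth_simple_inner_nonneg_iff[of j] assms(2) step by auto
  then show ?case using step by simp
qed simp

lemma dominant_coord_strict:
  assumes "dominant t" "i \<in> breaks (walls t)" "i < j" "j \<le> Suc n"
  shows "coord t j < coord t i"
proof -
  have i: "1 \<le> i" "i \<le> n" using breaks_bounds[OF assms(2)] by auto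
  have "nth_simple i \<in> \<Delta>" using i by (auto simp: simple_eq)
  then have "0 < nth_simple i \<bullet> t" using assms(1,2) by (auto simp: dominant_def walls_def breaks_def order_less_le)
  then have "coord t (Suc i) < coord t i" using nth_simple_inner_pos_iff i by blast
  then show ?thesis using dominant_coord_antimono[OF assms(1), of "Suc i" j] assms by auto
qed

lemma dominant_coord_inj:
  assumes "dominant t"
  shows "inj_on (coord t) (breaks (walls t))"
proof (rule linorder_inj_onI')
  fix i j assume "i \<in> breaks (walls t)" "j \<in> breaks (walls t)" "i < j"
  then show "coord t i \<noteq> coord t j"
    using dominant_coord_strict[OF assms, of i j] breaks_bounds[of j "walls t"] by auto
qed

lemma face_points_FS: "t \<in> face_points K m \<Longrightarrow> t \<in> FS K"
  by (auto simp: face_points_def walls_def)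

lemma face_points_rank:
  assumes t: "dominant t" "walls t = K" and i: "i \<in> breaks K"
  shows "card {x \<in> coord t ` breaks K. x \<le> coord t i} = card {j \<in> breaks K. i \<le> j}"
proof -
  have "{x \<in> coord t ` breaks K. x \<le> coord t i} = coord t ` {j \<in> breaks K. i \<le> j}"
  proof (intro equalityI subsetI)
    fix x assume "x \<in> {x \<in> coord t ` breaks K. x \<le> coord t i}"
    then obtain j where j: "j \<in> breaks K" "x = coord t j" "coord t j \<le> coord t i" by auto
    then have "\<not> j < i" using dominant_coord_strict[OF t(1), of j i] t(2) breaks_bounds[OF i] by auto
    then show "x \<in> coord t ` {j \<in> breaks K. i \<le> j}" using j by auto
  next
    fix x assume "x \<in> coord t ` {j \<in> breaks K. i \<le> j}"
    then show "x \<in> {x \<in> coord t ` breaks K. x \<le> coord t i}"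
      using dominant_coord_antimono[OF t(1), of i] breaks_bounds[of _ K] i by fastforce
  qed
  moreover have "inj_on (coord t) (breaks K)" using dominant_coord_inj[OF t(1)] t(2) by simp
  ultimately show ?thesis by (simp add: card_image inj_on_subset)
qed

text \<open>Along the breaks the coordinates are positive and strictly decreasing, so the set of
  values determines the point and any set of the right size occurs. The bijection is kept, not just
  the count, because the residue conditions used later depend only on the set of values.\<close>

lemma face_points_values_bij:
  assumes K: "K \<subseteq> \<Delta>"
  shows "bij_betw (\<lambda>t. coord t ` breaks K) (face_points K m) {T. T \<subseteq> real ` {1..m} \<and> card T = card (breaks K)}"
proof (rule bij_betwI')
  fix p q assume p: "p \<in> face_points K m" and q: "q \<in> face_points K m"
  show "(coord p ` breaks K = coord q ` breaks K) = (p = q)"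
  proof
    assume eq: "coord p ` breaks K = coord q ` breaks K"
    define T where "T = coord p ` breaks K"
    have T: "finite T" "T = coord q ` breaks K" using finite_breaks eq by (auto simp: T_def)
    show "p = q"
    proof (rule FS_eqI[OF K face_points_FS[OF p] face_points_FS[OF q]])
      fix i assume i: "i \<in> breaks K"
      \<comment> \<open>The rank of a coordinate within the set of values is dictated by the
        position of its break, hence is the same for both points.\<close>
      have rank: "card {x \<in> T. x \<le> coord p i} = card {x \<in> T. x \<le> coord q i}"
        using face_points_rank[of p K i] face_points_rank[of q K i] p q i T by (simp add: face_points_def T_def)
      have less: "card {x \<in> T. x \<le> a} < card {x \<in> T. x \<le> c}" if "a < c" "c \<in> T" for a c
      proof (rule psubset_card_mono)
        have "c \<in> {x \<in> T. x \<le> c}" "c \<notin> {x \<in> T. x \<le> a}" using that by auto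
        then show "{x \<in> T. x \<le> a} \<subset> {x \<in> T. x \<le> c}" using that(1) by force
      qed (use T(1) in simp)
      have "coord p i \<in> T" "coord q i \<in> T" using i T by (auto simp: T_def)
      then show "coord p i = coord q i"
        using rank less[of "coord p i" "coord q i"] less[of "coord q i" "coord p i"]
        by (cases "coord p i" "coord q i" rule: linorder_cases) auto
    qed
  qed simp
next
  fix t assume t: "t \<in> face_points K m"
  then have t': "dominant t" "walls t = K" "t \<in> cube m" by (auto simp: face_points_def)
  have "coord t i \<in> real ` {1..m}" if i: "i \<in> breaks K" for i
  proof -
    obtain x where x: "coord t i = real_of_int x" "x \<in> {- int m..int m}" using cube_coord[OF t'(3), of i] by auto
    have "0 < coord t i" using dominant_coord_strict[OF t'(1), of i "Suc n"] t'(2) i breaks_bounds[OF i] by auto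
    then show ?thesis using x by (intro image_eqI[of _ _ "nat x"]) auto
  qed
  moreover have "inj_on (coord t) (breaks K)" using dominant_coord_inj[OF t'(1)] t'(2) by simp
  ultimately show "coord t ` breaks K \<in> {T. T \<subseteq> real ` {1..m} \<and> card T = card (breaks K)}"
    by (auto simp: card_image)
next
  fix T assume T: "T \<in> {T. T \<subseteq> real ` {1..m} \<and> card T = card (breaks K)}"
  then obtain N where N: "N \<subseteq> {1..m}" "T = real ` N" by (auto simp: subset_image_iff)
  have finN: "finite N" using N(1) finite_subset by blast
  have cardN: "card N = card (breaks K)" using T N(2) by (auto simp: card_image)
  obtain h where h: "bij_betw h {..<card N} N" "strict_mono_on {..<card N} h"
    using ex_bij_betw_strict_mono_card[OF finN] by blast
  \<comment> \<open>Blocks are numbered from the bottom: \<open>r i\<close> is 0 on the zero block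
    and grows by 1 at each break going left. \<open>E\<close> lists \<open>N\<close> in increasing
    order, preceded by the value 0 for the zero block.\<close>
  define r where "r = (\<lambda>i. card {j \<in> breaks K. i \<le> j})"
  define E where "E = (\<lambda>k. if k = 0 then 0 else h (k - 1))"
  define t where "t = vec (\<lambda>i. real (E (r i)))"
  have r_le: "r i \<le> card N" for i unfolding r_def cardN by (rule card_mono) (auto simp: finite_breaks)
  have r_out: "r (Suc n) = 0" unfolding r_def by (auto simp: breaks_def)
  have r_step: "r i = (if i \<in> breaks K then Suc (r (Suc i)) else r (Suc i))" for i
  proof -
    have "{j \<in> breaks K. i \<le> j} = (if i \<in> breaks K then {i} else {}) \<union> {j \<in> breaks K. Suc i \<le> j}"
      by (auto simp: Suc_le_eq le_less)
    then show ?thesis unfolding r_def using finite_breaks by auto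
  qed
  have E_in: "E k \<in> N" if "1 \<le> k" "k \<le> card N" for k
    using bij_betwE[OF h(1)] that by (auto simp: E_def)
  have E_mono: "E k < E (Suc k)" if "Suc k \<le> card N" for k
  proof (cases "k = 0")
    case True
    then show ?thesis using E_in[of 1] that N(1) by (auto simp: E_def)
  next
    case False
    then show ?thesis using that h(2) by (auto simp: E_def strict_mono_on_def)
  qed
  have co_t: "coord t i = real (E (r i))" if "1 \<le> i" "i \<le> Suc n" for i
    using that r_out by (cases "i = Suc n") (auto simp: t_def E_def)
  have "dominant t \<and> walls t = K"
    unfolding face_points_iff[OF K]
  proof
    fix i assume i: "i \<in> {1..n}"
    show "if i \<in> breaks K then coord t (Suc i) < coord t i else coord t i = coord t (Suc i)"
      using i co_t[of i] co_t[of "Suc i"] r_step[of i] E_mono[of "r (Suc i)"] r_le[of i] by auto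
  qed
  moreover have "t \<in> cube m"
    unfolding cube_def
  proof (intro CollectI ballI)
    fix i assume i: "i \<in> {1..n}"
    have "E (r i) \<le> m" using E_in[of "r i"] r_le[of i] N(1) by (cases "r i = 0") (auto simp: E_def)
    then show "coord t i \<in> real_of_int ` {- int m..int m}"
      using co_t[of i] i by (intro image_eqI[of _ _ "int (E (r i))"]) auto
  qed
  ultimately have t: "t \<in> face_points K m" by (simp add: face_points_def)
  have "coord t ` breaks K = T"
  proof (rule card_subset_eq)
    show "finite T" using finN N by simp
    show "coord t ` breaks K \<subseteq> T"
    proof
      fix x assume "x \<in> coord t ` breaks K"
      then obtain i where i: "i \<in> breaks K" "x = coord t i" by auto
      then have "x = real (E (r i))" using co_t breaks_bounds[OF i(1)] by auto
      moreover have "1 \<le> r i" using r_step[of i] i by simp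
      ultimately show "x \<in> T" using E_in r_le N(2) by auto
    qed
    have "inj_on (coord t) (breaks K)" using dominant_coord_inj[of t] t by (auto simp: face_points_def)
    then show "card (coord t ` breaks K) = card T" using T by (simp add: card_image)
  qed
  then show "\<exists>t\<in>face_points K m. T = coord t ` breaks K" using t by auto
qed

lemma face_points_card: "K \<subseteq> \<Delta> \<Longrightarrow> card (face_points K m) = m choose card (breaks K)"
proof -
  assume "K \<subseteq> \<Delta>"
  then have "card (face_points K m) = card {T. T \<subseteq> real ` {1..m} \<and> card T = card (breaks K)}"
    using bij_betw_same_card[OF face_points_values_bij] by blast
  also have "\<dots> = card (real ` {1..m}) choose card (breaks K)" by (rule n_subsets) simp
  also have "card (real ` {1..m}) = m" by (subst card_image) auto
  finally show ?thesis .
qed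

section \<open>Generic points of standard flats\<close>

text \<open>The points of the cube lying in Fix W_K but in no smaller flat.\<close>

definition generic_points :: "'a set \<Rightarrow> nat \<Rightarrow> 'a set" where
  "generic_points K m = {p \<in> cube m. p \<in> FS K \<and> (\<forall>\<alpha>\<in>\<Phi>. \<alpha> \<bullet> p = 0 \<longrightarrow> (\<forall>y\<in>FS K. \<alpha> \<bullet> y = 0))}"

abbreviation "emb K \<equiv> {w \<in> W. w ` K \<subseteq> \<Delta>}"

text \<open>A point p is sent back to w = v^-1 and t = v^-1 p for the unique v with
  \<open>good v p\<close>. That w maps \<open>K\<close> to simple roots is
  \<open>good_simple\<close>; that \<open>t\<close> has no walls beyond w \<open>K\<close> is
  genericity of p.\<close>

lemma generic_points_bij:
  assumes K: "K \<subseteq> \<Delta>"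
  shows "bij_betw (\<lambda>(w, t). inv w t) (SIGMA w:emb K. face_points (w ` K) m) (generic_points K m)"
proof -
  \<comment> \<open>The walls of \<open>t\<close> are w \<open>K\<close>, and w^-1 carries them back
    to simple roots, so the positivity condition holds.\<close>
  have good: "good (inv w) (inv w t)" if w: "w \<in> W" and t: "t \<in> face_points (w ` K) m" for w t
  proof -
    have "inv (inv w) = w" using reflection_group_bij[OF w] by (rule inv_inv_eq)
    then show ?thesis using t simple_rho K by (auto simp: good_def face_points_def W_app[OF w] intro: W_inv w)
  qed
  have "inj_on (\<lambda>(w, t). inv w t) (SIGMA w:emb K. face_points (w ` K) m)"
  proof (rule inj_onI, clarify)
    fix w t w' t' assume *: "w \<in> W" "t \<in> face_points (w ` K) m" "w' \<in> W" "t' \<in> face_points (w' ` K) m" "inv w t = inv w' t'"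
    have "inv w = inv w'"
      using good_unique[OF good[OF *(1,2)]] good[OF *(3,4)] *(5) by simp
    then have "inv (inv w) = inv (inv w')" by (rule arg_cong)
    then have "w = w'"
      unfolding inv_inv_eq[OF reflection_group_bij[OF *(1)]] inv_inv_eq[OF reflection_group_bij[OF *(3)]] .
    moreover have "t = t'"
      using *(5) \<open>w = w'\<close> W_inj[OF W_inv[OF *(3)]] by simp
    ultimately show "w = w' \<and> t = t'" by simp
  qed
  moreover have "(\<lambda>(w, t). inv w t) ` (SIGMA w:emb K. face_points (w ` K) m) = generic_points K m"
  proof (intro equalityI subsetI)
    fix p assume "p \<in> (\<lambda>(w, t). inv w t) ` (SIGMA w:emb K. face_points (w ` K) m)"
    then obtain w t where w: "w \<in> W" "w ` K \<subseteq> \<Delta>" and t: "t \<in> face_points (w ` K) m" and p: "p = inv w t" by auto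
    have t': "dominant t" "walls t = w ` K" "t \<in> cube m" using t by (auto simp: face_points_def)
    have "p \<in> FS K"
      using t'(2) by (auto simp: p W_inner_inv(2)[OF w(1), symmetric] walls_def)
    moreover have "\<alpha> \<bullet> y = 0" if "\<alpha> \<in> \<Phi>" "\<alpha> \<bullet> p = 0" "y \<in> FS K" for \<alpha> y
    proof -
      have "w \<alpha> \<bullet> t = 0" using that(2) by (simp add: p W_inner_inv(2)[OF w(1)])
      moreover have "w y \<in> FS (walls t)" using that(3) t'(2) by (auto simp: W_inner[OF w(1)])
      ultimately have "w \<alpha> \<bullet> w y = 0"
        using root_zero_on_FS[OF t'(1) W_root[OF w(1) that(1)]] by blast
      then show ?thesis by (simp add: W_inner[OF w(1)])
    qed
    moreover have "p \<in> cube m" unfolding p by (rule W_cube[OF W_inv[OF w(1)] t'(3)])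
    ultimately show "p \<in> generic_points K m" by (auto simp: generic_points_def)
  next
    fix p assume p: "p \<in> generic_points K m"
    obtain v where v: "good v p" by (rule good_exists)
    then have vW: "v \<in> W" by (simp add: good_def)
    define t where "t = inv v p"
    have t: "dominant t" using v by (simp add: good_def t_def)
    have sub: "inv v ` K \<subseteq> walls t"
      using good_simple[OF v] p K by (auto simp: generic_points_def t_def)
    then have emb: "inv v ` K \<subseteq> \<Delta>" by (auto simp: walls_def)
    have "\<alpha> \<in> inv v ` K" if "\<alpha> \<in> walls t" for \<alpha>
    proof -
      have \<alpha>: "\<alpha> \<in> \<Delta>" "v \<alpha> \<bullet> p = 0" using that by (auto simp: walls_def t_def W_inner_inv(2)[OF vW])
      have "\<alpha> \<bullet> y = 0" if "y \<in> FS (inv v ` K)" for y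
      proof -
        have "v y \<in> FS K" using that by (auto simp: W_inner_inv(1)[OF vW])
        then have "v \<alpha> \<bullet> v y = 0"
          using p \<alpha> W_root[OF vW simple_root[OF \<alpha>(1)]] by (auto simp: generic_points_def)
        then show ?thesis by (simp add: W_inner[OF vW])
      qed
      then show ?thesis using simple_in_iff_FS[OF emb \<alpha>(1)] by blast
    qed
    then have "walls t = inv v ` K" using sub by blast
    moreover have "t \<in> cube m" using p W_cube[OF W_inv[OF vW], of p m] by (simp add: t_def generic_points_def)
    ultimately have "(inv v, t) \<in> (SIGMA w:emb K. face_points (w ` K) m)"
      using t emb W_inv[OF vW] by (auto simp: face_points_def)
    moreover have "p = inv (inv v) t"
      using inv_inv_eq[OF reflection_group_bij[OF vW]] by (simp add: t_def W_app[OF vW])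
    ultimately show "p \<in> (\<lambda>(w, t). inv w t) ` (SIGMA w:emb K. face_points (w ` K) m)"
      by (intro image_eqI[of _ _ "(inv v, t)"]) simp_all
  qed
  ultimately show ?thesis by (simp add: bij_betw_def)
qed

lemma card_breaks_image: "K \<subseteq> \<Delta> \<Longrightarrow> w \<in> emb K \<Longrightarrow> card (breaks (w ` K)) = card (breaks K)"
  using W_image_card by (auto simp: card_breaks)

lemma generic_points_card:
  assumes K: "K \<subseteq> \<Delta>"
  shows "card (generic_points K m) = card (emb K) * (m choose card (breaks K))"
proof -
  have "card (generic_points K m) = card (SIGMA w:emb K. face_points (w ` K) m)"
    using bij_betw_same_card[OF generic_points_bij[OF K]] by simp
  also have "\<dots> = (\<Sum>w\<in>emb K. card (face_points (w ` K) m))"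
    using finite_W finite_cube by (intro card_SigmaI) (auto simp: face_points_def)
  also have "\<dots> = (\<Sum>w\<in>emb K. m choose card (breaks K))"
  proof (rule sum.cong[OF refl])
    fix w assume w: "w \<in> emb K"
    then show "card (face_points (w ` K) m) = m choose card (breaks K)"
      using face_points_card[of "w ` K" m] card_breaks_image[OF K w] by simp
  qed
  finally show ?thesis by simp
qed

section \<open>Flats and the characteristic polynomial\<close>

definition zeros :: "'a \<Rightarrow> 'a set" where
  "zeros p = {\<alpha> \<in> \<Phi>. \<alpha> \<bullet> p = 0}"

abbreviation "L \<equiv> intersection_lattice \<Phi>"

lemma L_eq: "L = FS ` Pow \<Phi>"
  unfolding intersection_lattice_def by auto

lemma finite_L: "finite L"
  unfolding L_eq using finite_roots by simp

text \<open>\<open>FS (zeros p)\<close> is the smallest flat through p; sorting points by it is what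
  Moebius inversion acts on.\<close>

lemma FS_zeros_subset: "S \<subseteq> \<Phi> \<Longrightarrow> p \<in> FS S \<longleftrightarrow> FS (zeros p) \<subseteq> FS S"
  by (auto simp: zeros_def)

text \<open>Take p in \<open>Y\<close> with the fewest vanishing roots. If one of them did not
  vanish at some y in \<open>Y\<close>, a small step from p in direction y would lose it and acquire
  no new one.\<close>

lemma flat_generic:
  assumes "Y \<in> L"
  obtains p where "FS (zeros p) = Y"
proof -
  obtain S where S: "S \<subseteq> \<Phi>" "Y = FS S" using assms unfolding L_eq by auto
  have "0 \<in> Y" using S by simp
  then obtain p where p: "p \<in> Y" "\<And>q. q \<in> Y \<Longrightarrow> card (zeros p) \<le> card (zeros q)"
    using ex_has_least_nat[of "\<lambda>p. p \<in> Y" 0 "\<lambda>p. card (zeros p)"] by blast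
  have "\<alpha> \<bullet> y = 0" if \<alpha>: "\<alpha> \<in> \<Phi>" "\<alpha> \<bullet> p = 0" and y: "y \<in> Y" for \<alpha> y
  proof (rule ccontr)
    assume ne: "\<alpha> \<bullet> y \<noteq> 0"
    have "eventually (\<lambda>\<epsilon>. \<forall>\<beta>\<in>\<Phi>. \<beta> \<bullet> p \<noteq> 0 \<longrightarrow> \<beta> \<bullet> (p + \<epsilon> *\<^sub>R y) \<noteq> 0) (at_right 0)"
    proof (intro eventually_ball_finite finite_roots ballI)
      fix \<beta>
      have "((\<lambda>\<epsilon>. \<beta> \<bullet> (p + \<epsilon> *\<^sub>R y)) \<longlongrightarrow> \<beta> \<bullet> (p + 0 *\<^sub>R y)) (at_right 0)"
        by (intro tendsto_intros)
      then show "eventually (\<lambda>\<epsilon>. \<beta> \<bullet> p \<noteq> 0 \<longrightarrow> \<beta> \<bullet> (p + \<epsilon> *\<^sub>R y) \<noteq> 0) (at_right 0)"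
        by (cases "\<beta> \<bullet> p = 0") (auto dest: tendsto_imp_eventually_ne)
    qed
    then obtain \<epsilon> where \<epsilon>: "0 < \<epsilon>" "\<And>\<beta>. \<beta> \<in> \<Phi> \<Longrightarrow> \<beta> \<bullet> p \<noteq> 0 \<Longrightarrow> \<beta> \<bullet> (p + \<epsilon> *\<^sub>R y) \<noteq> 0"
      by (rule obtain_at_right) blast
    have "zeros (p + \<epsilon> *\<^sub>R y) \<subset> zeros p"
    proof
      show "zeros (p + \<epsilon> *\<^sub>R y) \<subseteq> zeros p" using \<epsilon>(2) by (auto simp: zeros_def)
      have "\<alpha> \<in> zeros p" "\<alpha> \<notin> zeros (p + \<epsilon> *\<^sub>R y)"
        using \<alpha> ne \<epsilon>(1) by (auto simp: zeros_def inner_add_right)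
      then show "zeros (p + \<epsilon> *\<^sub>R y) \<noteq> zeros p" by blast
    qed
    then have "card (zeros (p + \<epsilon> *\<^sub>R y)) < card (zeros p)"
      using finite_roots by (intro psubset_card_mono) (auto simp: zeros_def)
    moreover have "p + \<epsilon> *\<^sub>R y \<in> Y"
      using p(1) y FS_subspace[of S] unfolding S(2) by (intro subspace_add subspace_scale)
    ultimately show False using p(2) by fastforce
  qed
  then have "Y \<subseteq> FS (zeros p)" by (auto simp: zeros_def)
  moreover have "FS (zeros p) \<subseteq> Y" using FS_zeros_subset[OF S(1)] p(1) S(2) by blast
  ultimately show thesis using that by blast
qed

lemma FS_W_image: "w \<in> W \<Longrightarrow> FS (w ` S) = w ` FS S"
proof (intro equalityI subsetI)
  fix y assume w: "w \<in> W" and "y \<in> FS (w ` S)"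
  then have "inv w y \<in> FS S" by (auto simp: W_inner_inv(2)[OF w, symmetric])
  then show "y \<in> w ` FS S" by (intro W_imageI[OF w])
qed (auto simp: W_inner)

text \<open>Move a generic point of the flat to a dominant point t. The flat then becomes the
  smallest flat through t, which is cut out by the walls of t alone.\<close>

lemma flat_standard:
  assumes "Y \<in> L"
  obtains w J where "w \<in> W" "J \<subseteq> \<Delta>" "w ` Y = FS J"
proof -
  obtain p where p: "FS (zeros p) = Y" using flat_generic assms by blast
  obtain v where v: "good v p" by (rule good_exists)
  then have vW: "v \<in> W" by (simp add: good_def)
  define t where "t = inv v p"
  have t: "dominant t" using v by (simp add: good_def t_def)
  have "zeros t = inv v ` zeros p"
  proof (intro equalityI subsetI)
    fix \<alpha> assume "\<alpha> \<in> zeros t"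
    then have "v \<alpha> \<in> zeros p" using W_root[OF vW] by (auto simp: zeros_def t_def W_inner_inv(2)[OF vW])
    then show "\<alpha> \<in> inv v ` zeros p"
      by (intro image_eqI[of _ _ "v \<alpha>"]) (auto simp: W_app[OF vW])
  qed (use W_root[OF W_inv[OF vW]] in \<open>auto simp: zeros_def t_def W_inner[OF W_inv[OF vW]]\<close>)
  then have "inv v ` Y = FS (zeros t)" unfolding p[symmetric] by (simp only: FS_W_image[OF W_inv[OF vW]])
  also have "\<dots> = FS (walls t)"
    using root_zero_on_FS[OF t] by (auto simp: zeros_def walls_def simple_root)
  finally show thesis using that[OF W_inv[OF vW], of "walls t"] by (auto simp: walls_def)
qed

text \<open>Both sides are invariant under \<open>W\<close>, so the flat may be taken in standard
  form.\<close>

lemma flat_cube_card: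
  assumes "Y \<in> L"
  shows "card (Y \<inter> cube m) = (2 * m + 1) ^ dim Y"
proof -
  obtain w J where w: "w \<in> W" "J \<subseteq> \<Delta>" "w ` Y = FS J" using flat_standard[OF assms] by blast
  have inj: "inj_on w A" for A using W_inj[OF w(1)] by (auto simp: inj_on_def)
  have "dim Y = dim (FS J)"
    using dim_image_eq[OF W_linear[OF w(1)] inj, of Y] w(3) by simp
  moreover have "card (Y \<inter> cube m) = card (FS J \<inter> cube m)"
    using card_image[OF inj, of "Y \<inter> cube m"] W_cube_image[OF w(1)] w(3) by simp
  ultimately show ?thesis using FS_cube_card[OF w(2)] dim_FS[OF w(2)] by simp
qed

text \<open>The power of \<open>k\<close> attached to a flat counts its cube points, which are
  sorted by their smallest flat; inversion isolates those whose smallest flat is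
  \<open>FS K\<close>.\<close>

lemma char_poly_FS:
  assumes K: "K \<subseteq> \<Delta>"
  shows "char_poly_above \<Phi> (FS K) (real (2 * m + 1)) = real (card (generic_points K m))"
proof -
  define g where "g = (\<lambda>Z. real (card {p \<in> cube m. FS (zeros p) = Z}))"
  have sum: "real (2 * m + 1) ^ dim Y = (\<Sum>Z | Z \<in> L \<and> Z \<subseteq> Y. g Z)" if Y: "Y \<in> L" for Y
  proof -
    obtain S where S: "S \<subseteq> \<Phi>" "Y = FS S" using Y unfolding L_eq by auto
    have "Y \<inter> cube m = (\<Union>Z\<in>{Z \<in> L. Z \<subseteq> Y}. {p \<in> cube m. FS (zeros p) = Z})"
    proof (intro equalityI subsetI)
      fix p assume "p \<in> Y \<inter> cube m"
      moreover from this have "FS (zeros p) \<subseteq> Y" using FS_zeros_subset[OF S(1)] S(2) by blast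
      moreover have "FS (zeros p) \<in> L" unfolding L_eq by (intro imageI) (auto simp: zeros_def)
      ultimately show "p \<in> (\<Union>Z\<in>{Z \<in> L. Z \<subseteq> Y}. {p \<in> cube m. FS (zeros p) = Z})" by blast
    next
      fix p assume "p \<in> (\<Union>Z\<in>{Z \<in> L. Z \<subseteq> Y}. {p \<in> cube m. FS (zeros p) = Z})"
      then have "p \<in> cube m" "FS (zeros p) \<subseteq> Y" by auto
      then show "p \<in> Y \<inter> cube m" using FS_zeros_subset[OF S(1)] S(2) by blast
    qed
    then have "card (Y \<inter> cube m) = (\<Sum>Z | Z \<in> L \<and> Z \<subseteq> Y. card {p \<in> cube m. FS (zeros p) = Z})"
      using finite_L finite_cube by (simp only:) (rule card_UN_disjoint, auto)
    then have "real (card (Y \<inter> cube m)) = (\<Sum>Z | Z \<in> L \<and> Z \<subseteq> Y. g Z)" by (simp add: g_def)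
    then show ?thesis unfolding flat_cube_card[OF Y, of m] of_nat_power .
  qed
  have FS_L: "FS K \<in> L" unfolding L_eq using K simple_root by auto
  have "char_poly_above \<Phi> (FS K) (real (2 * m + 1)) =
    (\<Sum>Y | Y \<in> L \<and> Y \<subseteq> FS K. of_int (moebius L (\<supseteq>) (FS K) Y) * (\<Sum>Z | Z \<in> L \<and> Z \<subseteq> Y. g Z))"
    unfolding char_poly_above_def using sum by (intro sum.cong) auto
  also have "\<dots> = g (FS K)" by (rule moebius_inversion[OF finite_L FS_L])
  also have "{p \<in> cube m. FS (zeros p) = FS K} = generic_points K m"
  proof (intro equalityI subsetI)
    fix p assume p: "p \<in> {p \<in> cube m. FS (zeros p) = FS K}"
    moreover have "p \<in> FS (zeros p)" by (auto simp: zeros_def)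
    moreover have "\<alpha> \<bullet> y = 0" if "\<alpha> \<in> \<Phi>" "\<alpha> \<bullet> p = 0" "y \<in> FS K" for \<alpha> y
    proof -
      have "y \<in> FS (zeros p)" using p that by simp
      then show ?thesis using that by (auto simp: zeros_def)
    qed
    ultimately show "p \<in> generic_points K m" unfolding generic_points_def by simp
  next
    fix p assume p: "p \<in> generic_points K m"
    have "FS (zeros p) \<subseteq> FS K"
      using p K simple_root by (auto simp: generic_points_def zeros_def)
    moreover have "FS K \<subseteq> FS (zeros p)" using p unfolding generic_points_def zeros_def by blast
    ultimately show "p \<in> {p \<in> cube m. FS (zeros p) = FS K}" using p by (auto simp: generic_points_def)
  qed
  then have "g (FS K) = real (card (generic_points K m))" unfolding g_def by simp
  finally show ?thesis .
qed

lemma H_elem_eq: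
  "H_elem \<Phi> \<Delta> (real (2 * m + 1)) w =
    (\<Sum>K\<in>Pow (\<Delta> - Des \<Phi> \<Delta> w). real (m choose card (breaks K)) / real (2 * m + 1) ^ n)"
  unfolding H_elem_def
proof (rule sum.cong[OF refl])
  fix K assume "K \<in> Pow (\<Delta> - Des \<Phi> \<Delta> w)"
  then have K: "K \<subseteq> \<Delta>" by auto
  let ?G = "reflection_group K" and ?Z = "{z \<in> W. z ` K = K}"
  have id: "id \<in> W" by (rule reflection_group.id)
  have "K \<in> subset_class \<Phi> \<Delta> K"
    unfolding subset_class_eq[OF K] using K by (intro CollectI conjI bexI[of _ id] id) simp_all
  then have l: "0 < card (subset_class \<Phi> \<Delta> K)"
    using finite_subset_class[OF K] by (subst card_gt_0_iff) blast
  have "finite ?G" using finite_subset[OF parabolic_subset[OF K] finite_W] .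
  then have G: "0 < card ?G" using reflection_group.id[of K] by (auto simp: card_gt_0_iff)
  have Z: "0 < card ?Z" using finite_W id by (auto simp: card_gt_0_iff)
  have cancel: "g * (l * z * c) / (k * (g * z) * l) = c / k"
    if "g \<noteq> 0" "z \<noteq> 0" "l \<noteq> 0" for g z l c k :: real
    using that by simp
  have chi: "char_poly_above \<Phi> (fixed_space ?G) (real (2 * m + 1)) =
      real (card (subset_class \<Phi> \<Delta> K)) * real (card ?Z) * real (m choose card (breaks K))"
    unfolding fixed_space_reflection_group char_poly_FS[OF K]
    unfolding generic_points_card[OF K] subset_class_card[OF K] of_nat_mult ..
  show "real (card ?G) * char_poly_above \<Phi> (fixed_space ?G) (real (2 * m + 1)) /
     (real (2 * m + 1) ^ card \<Delta> * real (card (normalizer_in W ?G)) * real (card (subset_class \<Phi> \<Delta> K))) =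
     real (m choose card (breaks K)) / real (2 * m + 1) ^ n"
    unfolding chi normalizer_card[OF K] card_simple of_nat_mult
    by (rule cancel) (simp_all only: of_nat_eq_0_iff G Z l not_less_zero neq0_conv not_False_eq_True)
qed

subsection \<open>Coefficients of Cellini's element\<close>

lemma nonneg_antisym:
  assumes "x \<in> NN" "- x \<in> NN"
  shows "x = 0"
proof -
  obtain c where c: "x = (\<Sum>\<alpha>\<in>\<Delta>. c \<alpha> *\<^sub>R \<alpha>)" "\<forall>\<alpha>\<in>\<Delta>. 0 \<le> c \<alpha>"
    using assms(1) unfolding nonneg_combinations_def by auto
  obtain d where d: "- x = (\<Sum>\<alpha>\<in>\<Delta>. d \<alpha> *\<^sub>R \<alpha>)" "\<forall>\<alpha>\<in>\<Delta>. 0 \<le> d \<alpha>"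
    using assms(2) unfolding nonneg_combinations_def by auto
  have "x \<bullet> rho = sum c \<Delta>" unfolding c(1) inner_sum_left by (intro sum.cong) (auto simp: simple_rho)
  moreover have "(- x) \<bullet> rho = sum d \<Delta>" unfolding d(1) inner_sum_left by (intro sum.cong) (auto simp: simple_rho)
  moreover have "0 \<le> sum d \<Delta>" "0 \<le> sum c \<Delta>" using c d by (auto intro: sum_nonneg)
  ultimately have "sum c \<Delta> = 0" by simp
  then have "\<forall>\<alpha>\<in>\<Delta>. c \<alpha> = 0" using c(2) finite_simple by (simp add: sum_nonneg_eq_0_iff)
  then show ?thesis by (simp add: c(1))
qed

text \<open>For every signed basis vector x the difference b_1 - x lies in the cone, and a root is
  the sum of two such vectors.\<close>

lemma highest_root_eq: "highest_root \<Phi> \<Delta> = b 1 + b 1"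
  unfolding highest_root_def
proof (rule the_equality)
  have 1: "b 1 - x \<in> NN" if "x \<in> B" for x
    using that
  proof (cases rule: B_cases)
    case (pos i)
    then show ?thesis using nonneg_diff_b[of 1 i] by simp
  next
    case (neg i)
    then show ?thesis using nonneg_add[OF nonneg_b nonneg_b, of 1 i] n_pos by simp
  qed
  have top: "b 1 + b 1 - \<beta> \<in> NN" if "\<beta> \<in> \<Phi>" for \<beta>
  proof -
    obtain x y where xy: "x \<in> B" "y \<in> B" "\<beta> = x + y" using \<open>\<beta> \<in> \<Phi>\<close> by (rule root_cases)
    have "(b 1 - x) + (b 1 - y) \<in> NN" using xy by (intro nonneg_add 1)
    then show ?thesis by (simp add: xy(3) algebra_simps)
  qed
  have root: "b 1 + b 1 \<in> \<Phi>" using n_pos by (intro rootI) auto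
  show "b 1 + b 1 \<in> \<Phi> \<and> (\<forall>\<beta>\<in>\<Phi>. b 1 + b 1 - \<beta> \<in> NN)" using top root by blast
  fix \<theta> assume "\<theta> \<in> \<Phi> \<and> (\<forall>\<beta>\<in>\<Phi>. \<theta> - \<beta> \<in> NN)"
  then have "\<theta> - (b 1 + b 1) \<in> NN" "- (\<theta> - (b 1 + b 1)) \<in> NN"
    using root top[of \<theta>] by auto
  then show "\<theta> = b 1 + b 1" using nonneg_antisym by fastforce
qed

lemma highest_root_inner: "highest_root \<Phi> \<Delta> \<bullet> t = 2 * coord t 1"
  using n_pos by (simp add: highest_root_eq inner_add_left coord_def inner_commute[of t])

lemma minus_highest_root_not_simple: "- highest_root \<Phi> \<Delta> \<notin> \<Delta>"
  using simple_rho[of "- highest_root \<Phi> \<Delta>"] n_pos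
  by (auto simp: highest_root_inner coord_def inner_commute[of rho] b_rho)

lemma coroot_long: "1 \<le> i \<Longrightarrow> i \<le> n \<Longrightarrow> coroot (b i + b i) = b i"
  by (simp add: coroot_def inner_add_left inner_add_right flip: scaleR_2)

lemma coroot_Ints:
  assumes "\<alpha> \<in> \<Phi>"
  shows "coord (coroot \<alpha>) i \<in> \<int>"
proof -
  have B_Ints: "coord x i \<in> \<int>" if "x \<in> B" for x
    using that by (cases rule: B_cases) (auto simp: coord_def)
  obtain x y where xy: "x \<in> B" "y \<in> B" "x \<noteq> - y" "\<alpha> = x + y" using assms by (rule root_cases)
  have xx: "x \<bullet> x = 1" "y \<bullet> y = 1" using xy inner_B by auto
  show ?thesis
  proof (cases "x = y")
    case True
    have "coroot \<alpha> = x"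
      using xx by (simp add: coroot_def xy(4) True inner_add_left inner_add_right flip: scaleR_2)
    then show ?thesis using B_Ints xy by simp
  next
    case False
    then have "x \<bullet> y = 0" using inner_B[OF xy(1,2)] xy(3) by simp
    then have "coroot \<alpha> = \<alpha>"
      using xx by (simp add: coroot_def xy(4) inner_add_left inner_add_right inner_commute)
    then show ?thesis using B_Ints xy by (simp add: coord_linear)
  qed
qed

lemma coord_sum: "finite A \<Longrightarrow> coord (\<Sum>a\<in>A. f a) i = (\<Sum>a\<in>A. coord (f a) i)"
  by (auto simp: coord_def inner_sum_left)

text \<open>The coroots of the long roots 2 b_i are the b_i, which already generate all integral
  vectors; every other coroot is integral.\<close>

lemma coroot_lattice_eq: "coroot_lattice \<Phi> = {t. \<forall>i\<in>{1..n}. coord t i \<in> \<int>}"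
proof (intro equalityI subsetI)
  fix t assume "t \<in> coroot_lattice \<Phi>"
  then obtain c where "t = (\<Sum>\<alpha>\<in>\<Phi>. of_int (c \<alpha>) *\<^sub>R coroot \<alpha>)" unfolding coroot_lattice_def by auto
  then show "t \<in> {t. \<forall>i\<in>{1..n}. coord t i \<in> \<int>}"
    using coroot_Ints by (auto simp: coord_sum[OF finite_roots] coord_linear intro!: Ints_sum Ints_mult)
next
  fix t assume t: "t \<in> {t. \<forall>i\<in>{1..n}. coord t i \<in> \<int>}"
  \<comment> \<open>Coefficients supported on the long positive roots.\<close>
  define c where "c = (\<lambda>\<alpha>. \<Sum>i\<in>{1..n}. if \<alpha> = b i + b i then \<lfloor>coord t i\<rfloor> else 0)"
  have "(\<Sum>\<alpha>\<in>\<Phi>. of_int (c \<alpha>) *\<^sub>R coroot \<alpha>) =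
      (\<Sum>\<alpha>\<in>\<Phi>. \<Sum>i\<in>{1..n}. if \<alpha> = b i + b i then of_int \<lfloor>coord t i\<rfloor> *\<^sub>R coroot \<alpha> else 0)"
    unfolding c_def of_int_sum scaleR_sum_left by (intro sum.cong refl) auto
  also have "\<dots> = (\<Sum>i\<in>{1..n}. \<Sum>\<alpha>\<in>\<Phi>. if \<alpha> = b i + b i then of_int \<lfloor>coord t i\<rfloor> *\<^sub>R coroot \<alpha> else 0)"
    by (rule sum.swap)
  also have "\<dots> = (\<Sum>i\<in>{1..n}. (t \<bullet> b i) *\<^sub>R b i)"
  proof (rule sum.cong[OF refl])
    fix i assume i: "i \<in> {1..n}"
    then have "b i + b i \<in> \<Phi>" by (intro rootI) auto
    then have "(\<Sum>\<alpha>\<in>\<Phi>. if \<alpha> = b i + b i then of_int \<lfloor>coord t i\<rfloor> *\<^sub>R coroot \<alpha> else 0) = of_int \<lfloor>coord t i\<rfloor> *\<^sub>R b i"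
      using finite_roots coroot_long[of i] i by simp
    moreover have "of_int \<lfloor>coord t i\<rfloor> = t \<bullet> b i"
      using t i by (auto simp: coord_def elim!: Ints_cases)
    ultimately show "(\<Sum>\<alpha>\<in>\<Phi>. if \<alpha> = b i + b i then of_int \<lfloor>coord t i\<rfloor> *\<^sub>R coroot \<alpha> else 0) = (t \<bullet> b i) *\<^sub>R b i"
      by (simp only:)
  qed
  also have "\<dots> = t" by (rule b_expansion[symmetric])
  finally show "t \<in> coroot_lattice \<Phi>" unfolding coroot_lattice_def by blast
qed

text \<open>For integral t the condition 2 t_1 < 2 m + 1 says t_1 <= m, and dominance keeps the
  other coordinates between 0 and t_1. So the points counted are those of the open face of
  \<open>I\<close> in the cube.\<close>

lemma cellini_a_simple:
  assumes I: "I \<subseteq> \<Delta>"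
  shows "cellini_a \<Phi> \<Delta> (2 * m + 1) I = m choose card (breaks I)"
proof -
  have notin: "- highest_root \<Phi> \<Delta> \<notin> I" using I minus_highest_root_not_simple by blast
  have "t \<in> coroot_lattice \<Phi> \<and> (\<forall>\<alpha>\<in>I \<inter> \<Delta>. \<alpha> \<bullet> t = 0) \<and> (\<forall>\<alpha>\<in>\<Delta> - I. \<alpha> \<bullet> t > 0) \<and>
      highest_root \<Phi> \<Delta> \<bullet> t < real (2 * m + 1) \<longleftrightarrow> t \<in> face_points I m" (is "?lhs \<longleftrightarrow> ?rhs") for t
  proof
    assume l: ?lhs
    then have d: "dominant t" "walls t = I" using I by (auto simp: dominant_def walls_def order_less_le)
    have "t \<in> cube m"
      unfolding cube_def
    proof (intro CollectI ballI)
      fix i assume i: "i \<in> {1..n}"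
      then have "coord t i \<in> \<int>" using l by (simp add: coroot_lattice_eq)
      then obtain z where z: "coord t i = of_int z" by (rule Ints_cases)
      have "0 \<le> coord t i" using dominant_coord_antimono[OF d(1), of i "Suc n"] i by simp
      moreover have "coord t i \<le> coord t 1" using dominant_coord_antimono[OF d(1), of 1 i] i by simp
      ultimately show "coord t i \<in> real_of_int ` {- int m..int m}"
        using l z by (intro image_eqI[of _ _ z]) (auto simp: highest_root_inner)
    qed
    then show ?rhs using d by (simp add: face_points_def)
  next
    assume r: ?rhs
    then have d: "dominant t" "walls t = I" "t \<in> cube m" by (auto simp: face_points_def)
    have "coord t 1 \<le> real m" using cube_coord[OF d(3), of 1] by auto
    moreover have "t \<in> coroot_lattice \<Phi>" using d(3) by (auto simp: coroot_lattice_eq cube_def)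
    moreover have "\<forall>\<alpha>\<in>I \<inter> \<Delta>. \<alpha> \<bullet> t = 0" "\<forall>\<alpha>\<in>\<Delta> - I. \<alpha> \<bullet> t > 0"
      using d(1,2) by (auto simp: dominant_def walls_def order_less_le)
    ultimately show ?lhs by (simp add: highest_root_inner)
  qed
  then have "cellini_a \<Phi> \<Delta> (2 * m + 1) I = card (face_points I m)"
    unfolding cellini_a_def using notin by simp
  then show ?thesis by (simp add: face_points_card[OF I])
qed

lemma cellini_a_affine:
  assumes "- highest_root \<Phi> \<Delta> \<in> I"
  shows "cellini_a \<Phi> \<Delta> (2 * m + 1) I = 0"
proof -
  have "highest_root \<Phi> \<Delta> \<bullet> t \<noteq> real (2 * m + 1)" if "t \<in> coroot_lattice \<Phi>" for t
  proof
    assume eq: "highest_root \<Phi> \<Delta> \<bullet> t = real (2 * m + 1)"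
    have "coord t 1 \<in> \<int>" using that n_pos by (simp add: coroot_lattice_eq)
    then obtain z where "coord t 1 = of_int z" by (rule Ints_cases)
    then have "real_of_int (2 * z) = real_of_int (2 * int m + 1)" using eq by (simp add: highest_root_inner)
    then have "2 * z = 2 * int m + 1" by (simp only: of_int_eq_iff)
    then show False by presburger
  qed
  then have "{t \<in> coroot_lattice \<Phi>. (\<forall>\<alpha>\<in>I \<inter> \<Delta>. \<alpha> \<bullet> t = 0) \<and> (\<forall>\<alpha>\<in>\<Delta> - I. \<alpha> \<bullet> t > 0) \<and>
      highest_root \<Phi> \<Delta> \<bullet> t = real (2 * m + 1)} = {}"
    by blast
  then show ?thesis unfolding cellini_a_def using assms by (simp only: if_True card.empty)
qed

lemma cellini_x_eq:
  "cellini_x \<Phi> \<Delta> (2 * m + 1) w =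
    (\<Sum>K\<in>Pow (\<Delta> - Des \<Phi> \<Delta> w). real (m choose card (breaks K)) / real (2 * m + 1) ^ n)"
proof -
  let ?S = "Pow (affine_simple \<Phi> \<Delta> - Cdes \<Phi> \<Delta> w)"
  have sub: "Pow (\<Delta> - Des \<Phi> \<Delta> w) \<subseteq> ?S" by (auto simp: affine_simple_def Des_def Cdes_def)
  have fin: "finite ?S" by (simp add: affine_simple_def finite_simple)
  have "(\<Sum>I\<in>?S. real (cellini_a \<Phi> \<Delta> (2 * m + 1) I)) =
    (\<Sum>K\<in>Pow (\<Delta> - Des \<Phi> \<Delta> w). real (cellini_a \<Phi> \<Delta> (2 * m + 1) K))"
  proof (rule sum.mono_neutral_right[OF fin sub], intro ballI)
    fix I assume "I \<in> ?S - Pow (\<Delta> - Des \<Phi> \<Delta> w)"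
    then have "- highest_root \<Phi> \<Delta> \<in> I" by (auto simp: affine_simple_def Des_def Cdes_def)
    then show "real (cellini_a \<Phi> \<Delta> (2 * m + 1) I) = 0" by (simp only: cellini_a_affine of_nat_0)
  qed
  also have "\<dots> = (\<Sum>K\<in>Pow (\<Delta> - Des \<Phi> \<Delta> w). real (m choose card (breaks K)))"
    by (intro sum.cong refl) (subst cellini_a_simple, auto)
  finally show ?thesis
    unfolding cellini_x_def card_simple by (simp add: sum_divide_distrib)
qed

subsection \<open>Descents and generic points\<close>

text \<open>At radius d the number of face points is d choose d. This fixes the choice of radius: a
  group element can be recovered from a single lattice point.\<close>

lemma face_points_singleton:
  assumes K: "K \<subseteq> \<Delta>"
  shows "face_points K (card (breaks K)) = {face_vec K}"
proof -
  have "face_vec K \<in> cube (card (breaks K))"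
    unfolding cube_def
  proof (intro CollectI ballI)
    fix i assume i: "i \<in> {1..n}"
    have "card {j \<in> {i..n}. nth_simple j \<notin> K} \<le> card (breaks K)"
      using i by (intro card_mono finite_breaks) (auto simp: breaks_def)
    then show "coord (face_vec K) i \<in> real_of_int ` {- int (card (breaks K))..int (card (breaks K))}"
      using i by (intro image_eqI[of _ _ "int (card {j \<in> {i..n}. nth_simple j \<notin> K})"]) (auto simp: coord_face_vec)
  qed
  then have mem: "face_vec K \<in> face_points K (card (breaks K))" by (simp add: face_points_def dominant_face_vec walls_face_vec[OF K])
  have "card (face_points K (card (breaks K))) = 1" by (simp add: face_points_card[OF K])
  then obtain x where "face_points K (card (breaks K)) = {x}" by (auto simp: card_1_singleton_iff)
  then show ?thesis using mem by simp
qed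

text \<open>At this radius the fibre over each w in \<open>generic_points_bij\<close> is a single
  point.\<close>

lemma emb_generic_bij:
  assumes K: "K \<subseteq> \<Delta>"
  shows "bij_betw (\<lambda>w. inv w (face_vec (w ` K))) (emb K) (generic_points K (card (breaks K)))"
proof -
  have "bij_betw (\<lambda>w. (w, face_vec (w ` K))) (emb K) (SIGMA w:emb K. face_points (w ` K) (card (breaks K)))"
  proof (rule bij_betw_imageI)
    show "inj_on (\<lambda>w. (w, face_vec (w ` K))) (emb K)" by (auto simp: inj_on_def)
    have "face_points (w ` K) (card (breaks K)) = {face_vec (w ` K)}" if w: "w \<in> emb K" for w
      using face_points_singleton[of "w ` K"] w card_breaks_image[OF K w] by simp
    then show "(\<lambda>w. (w, face_vec (w ` K))) ` emb K = (SIGMA w:emb K. face_points (w ` K) (card (breaks K)))"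
      by (auto simp: image_iff Sigma_def)
  qed
  from bij_betw_trans[OF this generic_points_bij[OF K]] show ?thesis by (simp add: comp_def)
qed

text \<open>Moving w across the pairing gives the value of w \<alpha> at a dominant point. It is
  nonzero because \<alpha> does not vanish on \<open>FS K\<close> and the point is generic, and a
  root that is nonzero at a dominant point has there its own sign.\<close>

lemma Des_iff_generic:
  assumes K: "K \<subseteq> \<Delta>" and w: "w \<in> emb K" and \<alpha>: "\<alpha> \<in> \<Delta> - K"
  shows "\<alpha> \<notin> Des \<Phi> \<Delta> w \<longleftrightarrow> 0 < \<alpha> \<bullet> inv w (face_vec (w ` K))"
proof -
  have wW: "w \<in> W" using w by simp
  let ?t = "face_vec (w ` K)"
  have eq: "\<alpha> \<bullet> inv w ?t = w \<alpha> \<bullet> ?t" by (simp add: W_inner_inv(2)[OF wW])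
  have "inv w ?t \<in> generic_points K (card (breaks K))" using bij_betwE[OF emb_generic_bij[OF K]] w by blast
  then have "\<alpha> \<bullet> inv w ?t \<noteq> 0"
    using simple_in_iff_FS[OF K, of \<alpha>] \<alpha> simple_root[of \<alpha>] unfolding generic_points_def by blast
  then have ne: "w \<alpha> \<bullet> ?t \<noteq> 0" by (simp add: eq)
  have nn: "0 \<le> \<gamma> \<bullet> ?t" if "\<gamma> \<in> NN" for \<gamma>
    using that dominant_face_vec[of "w ` K"] unfolding nonneg_combinations_def dominant_def
    by (auto simp: inner_sum_left intro!: sum_nonneg)
  have root: "w \<alpha> \<in> \<Phi>" using W_root[OF wW simple_root] \<alpha> by blast
  have "0 < w \<alpha> \<bullet> rho \<longleftrightarrow> 0 < w \<alpha> \<bullet> ?t"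
  proof
    assume "0 < w \<alpha> \<bullet> rho"
    then have "w \<alpha> \<in> NN" using root_rho_nonneg(2)[OF root] by simp
    then show "0 < w \<alpha> \<bullet> ?t" using nn ne by (simp add: order_less_le)
  next
    assume pos: "0 < w \<alpha> \<bullet> ?t"
    show "0 < w \<alpha> \<bullet> rho"
    proof (rule ccontr)
      assume "\<not> 0 < w \<alpha> \<bullet> rho"
      then have "- w \<alpha> \<in> NN" using root_rho_nonneg(2)[OF uminus_root[OF root]] by simp
      then show False using nn[of "- w \<alpha>"] pos by simp
    qed
  qed
  then show ?thesis using not_Des_iff[OF wW, of \<alpha>] \<alpha> eq by simp
qed

text \<open>No root of \<open>K\<close> is a descent, as w maps it to a simple root; for the roots
  of \<open>J - K\<close> descents are signs at the generic point that encodes w.\<close>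

lemma X_set_card:
  assumes J: "K \<subseteq> J" "J \<subseteq> \<Delta>"
  shows "card {w \<in> X_set \<Phi> \<Delta> J. w ` K \<subseteq> \<Delta>} =
    card {q \<in> generic_points K (card (breaks K)). \<forall>\<alpha>\<in>J - K. 0 < \<alpha> \<bullet> q}"
proof -
  let ?f = "\<lambda>w. inv w (face_vec (w ` K))"
  have K: "K \<subseteq> \<Delta>" using J by simp
  have X: "{w \<in> X_set \<Phi> \<Delta> J. w ` K \<subseteq> \<Delta>} = {w \<in> emb K. \<forall>\<alpha>\<in>J - K. 0 < \<alpha> \<bullet> ?f w}"
  proof (intro equalityI subsetI)
    fix w assume "w \<in> {w \<in> X_set \<Phi> \<Delta> J. w ` K \<subseteq> \<Delta>}"
    then have w: "w \<in> emb K" "Des \<Phi> \<Delta> w \<inter> J = {}" by (auto simp: X_set_def)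
    have "0 < \<alpha> \<bullet> ?f w" if "\<alpha> \<in> J - K" for \<alpha>
      using Des_iff_generic[OF K w(1), of \<alpha>] that w(2) J by blast
    then show "w \<in> {w \<in> emb K. \<forall>\<alpha>\<in>J - K. 0 < \<alpha> \<bullet> ?f w}" using w by blast
  next
    fix w assume "w \<in> {w \<in> emb K. \<forall>\<alpha>\<in>J - K. 0 < \<alpha> \<bullet> ?f w}"
    then have w: "w \<in> emb K" "\<And>\<alpha>. \<alpha> \<in> J - K \<Longrightarrow> 0 < \<alpha> \<bullet> ?f w" by auto
    have "\<alpha> \<notin> Des \<Phi> \<Delta> w" if "\<alpha> \<in> J" for \<alpha>
    proof (cases "\<alpha> \<in> K")
      case True
      then have "w \<alpha> \<bullet> rho = 1" using w(1) simple_rho by auto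
      then show ?thesis using not_Des_iff[of w \<alpha>] w(1) True K by auto
    next
      case False
      then show ?thesis using Des_iff_generic[OF K w(1), of \<alpha>] that w(2)[of \<alpha>] J by blast
    qed
    then show "w \<in> {w \<in> X_set \<Phi> \<Delta> J. w ` K \<subseteq> \<Delta>}" using w(1) by (auto simp: X_set_def)
  qed
  have bij: "bij_betw ?f (emb K) (generic_points K (card (breaks K)))" by (rule emb_generic_bij[OF K])
  have "?f ` {w \<in> emb K. \<forall>\<alpha>\<in>J - K. 0 < \<alpha> \<bullet> ?f w} = {q \<in> ?f ` emb K. \<forall>\<alpha>\<in>J - K. 0 < \<alpha> \<bullet> q}"
    by auto
  also have "?f ` emb K = generic_points K (card (breaks K))" using bij by (rule bij_betw_imp_surj_on)
  finally have "?f ` {w \<in> emb K. \<forall>\<alpha>\<in>J - K. 0 < \<alpha> \<bullet> ?f w} =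
      {q \<in> generic_points K (card (breaks K)). \<forall>\<alpha>\<in>J - K. 0 < \<alpha> \<bullet> q}" .
  moreover have "inj_on ?f {w \<in> emb K. \<forall>\<alpha>\<in>J - K. 0 < \<alpha> \<bullet> ?f w}"
    by (rule inj_on_subset[OF bij_betw_imp_inj_on[OF bij]]) auto
  ultimately show ?thesis unfolding X using card_image by fastforce
qed

lemma root_coordinates:
  assumes "\<alpha> \<in> \<Phi>"
  obtains s t :: real and i j where "s \<in> {1, -1}" "t \<in> {1, -1}" "i \<in> {1..n}" "j \<in> {1..n}"
    "\<And>z. \<alpha> \<bullet> z = s * coord z i + t * coord z j"
proof -
  have B: "\<exists>s\<in>{1, -1}. \<exists>i\<in>{1..n}. \<forall>z. x \<bullet> z = s * coord z i" if "x \<in> B" for x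
    using that
  proof (cases rule: B_cases)
    case (pos i)
    then show ?thesis by (intro bexI[of _ 1] bexI[of _ i]) (auto simp: coord_def inner_commute)
  next
    case (neg i)
    then show ?thesis by (intro bexI[of _ "-1"] bexI[of _ i]) (auto simp: coord_def inner_commute)
  qed
  obtain x y where xy: "x \<in> B" "y \<in> B" "\<alpha> = x + y" using assms by (rule root_cases)
  obtain s i where s: "s \<in> {1, -1}" "i \<in> {1..n}" "\<And>z. x \<bullet> z = s * coord z i" using B[OF xy(1)] by blast
  obtain t j where t: "t \<in> {1, -1}" "j \<in> {1..n}" "\<And>z. y \<bullet> z = t * coord z j" using B[OF xy(2)] by blast
  show thesis
    by (rule that[OF s(1) t(1) s(2) t(2)]) (simp add: xy(3) inner_add_left s(3) t(3))
qed

text \<open>On \<open>FS K\<close> every root is a signed sum of two block values, one of which may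
  belong to the zero block. Hence genericity means that the block values are nonzero with distinct
  absolute values.\<close>

lemma generic_points_iff:
  assumes K: "K \<subseteq> \<Delta>" and q: "q \<in> FS K" "q \<in> cube m"
  shows "q \<in> generic_points K m \<longleftrightarrow> inj_on (\<lambda>i. \<bar>coord q i\<bar>) (breaks K) \<and> (\<forall>i\<in>breaks K. coord q i \<noteq> 0)"
proof
  assume "q \<in> generic_points K m"
  then have vanish: "\<alpha> \<bullet> y = 0" if "\<alpha> \<in> \<Phi>" "\<alpha> \<bullet> q = 0" "y \<in> FS K" for \<alpha> y
    using that by (auto simp: generic_points_def)
  have b_inner: "b i \<bullet> z = coord z i" if "i \<in> breaks K" for i z
    using breaks_bounds[OF that] by (simp add: coord_def inner_commute)
  \<comment> \<open>Test vectors with value 1 on a single block and 0 on all others.\<close>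
  have unit: "coord (ext K (\<lambda>j. if j = i then 1 else 0)) j = (if j = i then 1 else 0)" if "j \<in> breaks K" for i j
    using coord_ext_breaks[OF that] by simp
  have "coord q i \<noteq> 0" if i: "i \<in> breaks K" for i
  proof
    assume "coord q i = 0"
    moreover have "b i + b i \<in> \<Phi>" using breaks_bounds[OF i] by (intro rootI) auto
    ultimately have "(b i + b i) \<bullet> ext K (\<lambda>j. if j = i then 1 else 0) = 0"
      by (intro vanish[OF _ _ ext_FS[OF K]]) (simp_all add: inner_add_left b_inner i)
    then show False by (simp add: inner_add_left b_inner i unit)
  qed
  moreover have "inj_on (\<lambda>i. \<bar>coord q i\<bar>) (breaks K)"
  proof (rule inj_onI, rule ccontr)
    fix i j assume i: "i \<in> breaks K" and j: "j \<in> breaks K" and eq: "\<bar>coord q i\<bar> = \<bar>coord q j\<bar>" and ne: "i \<noteq> j"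
    have roots: "b i - b j \<in> \<Phi>" "b i + b j \<in> \<Phi>"
      using breaks_bounds[OF i] breaks_bounds[OF j] ne by (auto intro!: rootI root_diffI)
    let ?y = "ext K (\<lambda>j. if j = i then 1 else 0)"
    have "(b i - b j) \<bullet> q = 0 \<or> (b i + b j) \<bullet> q = 0"
      using eq by (auto simp: inner_add_left inner_diff_left b_inner i j abs_eq_iff)
    then have "(b i - b j) \<bullet> ?y = 0 \<or> (b i + b j) \<bullet> ?y = 0"
      using vanish roots ext_FS[OF K] by blast
    then show False using ne by (auto simp: inner_add_left inner_diff_left b_inner i j unit)
  qed
  ultimately show "inj_on (\<lambda>i. \<bar>coord q i\<bar>) (breaks K) \<and> (\<forall>i\<in>breaks K. coord q i \<noteq> 0)" by blast
next
  assume inj: "inj_on (\<lambda>i. \<bar>coord q i\<bar>) (breaks K) \<and> (\<forall>i\<in>breaks K. coord q i \<noteq> 0)"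
  have "\<alpha> \<bullet> y = 0" if \<alpha>: "\<alpha> \<in> \<Phi>" "\<alpha> \<bullet> q = 0" and y: "y \<in> FS K" for \<alpha> y
  proof -
    obtain s t :: real and i j where st: "s \<in> {1, -1}" "t \<in> {1, -1}" "i \<in> {1..n}" "j \<in> {1..n}"
      and in_eq: "\<And>z. \<alpha> \<bullet> z = s * coord z i + t * coord z j"
      using root_coordinates[OF \<alpha>(1)] by metis
    have nx: "coord z i = coord z (next_break K i)" "coord z j = coord z (next_break K j)" if "z \<in> FS K" for z
      using coord_next_break[OF K that] st(3,4) by auto
    have abs: "\<bar>coord q (next_break K i)\<bar> = \<bar>coord q (next_break K j)\<bar>"
      using \<alpha>(2) in_eq[of q] st(1,2) nx[OF q(1)] by auto
    \<comment> \<open>Distinct nonzero blocks have distinct absolute values, and only the zero block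
      has value 0.\<close>
    have "next_break K i = next_break K j"
    proof (cases "next_break K i \<in> breaks K \<and> next_break K j \<in> breaks K")
      case True
      then show ?thesis using inj abs by (auto simp: inj_on_def)
    next
      case False
      then show ?thesis using next_break_cases[of K i] next_break_cases[of K j] inj abs by auto
    qed
    \<comment> \<open>Both indices lie in the same block. Either it is the zero block, or its value
      at q is nonzero and the coefficient s + t must vanish.\<close>
    then have eq: "\<alpha> \<bullet> z = (s + t) * coord z (next_break K i)" if "z \<in> FS K" for z
      using in_eq[of z] nx[OF that] by (simp add: algebra_simps)
    show ?thesis
    proof (cases "next_break K i \<in> breaks K")
      case True
      then have "s + t = 0" using eq[OF q(1)] \<alpha>(2) inj by auto
      then show ?thesis using eq[OF y] by simp
    next
      case False
      then show ?thesis using eq[OF y] next_break_cases[of K i] by auto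
    qed
  qed
  then show "q \<in> generic_points K m" using q by (auto simp: generic_points_def)
qed

end

subsection \<open>Balanced residues\<close>

text \<open>A set T of the right size with injective f-values in \<open>I\<close> meets each fibre
  over \<open>I\<close> exactly once, so it amounts to a choice of one element per fibre.\<close>

lemma card_transversals:
  assumes "finite A" "finite I"
  shows "card {T. T \<subseteq> A \<and> card T = card I \<and> inj_on f T \<and> f ` T \<subseteq> I} = (\<Prod>i\<in>I. card {x \<in> A. f x = i})"
proof -
  let ?C = "\<lambda>i. {x \<in> A. f x = i}"
  let ?S = "{T. T \<subseteq> A \<and> card T = card I \<and> inj_on f T \<and> f ` T \<subseteq> I}"
  have inj: "inj_on g I" if "g \<in> PiE I ?C" for g
  proof (rule inj_onI)
    fix i j assume "i \<in> I" "j \<in> I" "g i = g j"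
    moreover have "f (g i) = i" if "i \<in> I" for i using \<open>g \<in> PiE I ?C\<close> that by auto
    ultimately show "i = j" by metis
  qed
  have "bij_betw (\<lambda>g. g ` I) (PiE I ?C) ?S"
  proof (rule bij_betwI')
    fix g h assume g: "g \<in> PiE I ?C" and h: "h \<in> PiE I ?C"
    show "(g ` I = h ` I) = (g = h)"
    proof
      assume eq: "g ` I = h ` I"
      show "g = h"
      proof (rule PiE_ext[OF g h])
        fix i assume i: "i \<in> I"
        then obtain j where j: "j \<in> I" "g i = h j" using eq by blast
        have "f (g i) = i" "f (h j) = j" using g h i j(1) by auto
        then show "g i = h i" using j by simp
      qed
    qed simp
  next
    fix g assume g: "g \<in> PiE I ?C"
    have fg: "f (g i) = i" "g i \<in> A" if "i \<in> I" for i using g that by auto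
    have "inj_on f (g ` I)" by (rule inj_onI) (auto simp: fg)
    then show "g ` I \<in> ?S" using card_image[OF inj[OF g]] fg by auto
  next
    fix T assume T: "T \<in> ?S"
    have img: "f ` T = I"
      using T assms(2) by (intro card_subset_eq) (auto simp: card_image)
    define g where "g = restrict (inv_into T f) I"
    have "g ` I = inv_into T f ` f ` T" by (simp add: g_def img)
    also have "\<dots> = T" using T by (simp add: inv_into_image_cancel)
    finally have "g ` I = T" .
    moreover have "g \<in> PiE I ?C"
      using T img inv_into_into[of _ f T] f_inv_into_f[of _ f T] by (auto simp: g_def)
    ultimately show "\<exists>g\<in>PiE I ?C. T = g ` I" by blast
  qed
  then have "card ?S = card (PiE I ?C)" by (rule bij_betw_same_card[symmetric])
  also have "\<dots> = (\<Prod>i\<in>I. card (?C i))" by (rule card_PiE[OF assms(2)])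
  finally show ?thesis .
qed

text \<open>Rounding of x / (2 d + 1) to the nearest integer; the shift by d centres the remainders
  in [-d, d].\<close>

definition bal_quo :: "nat \<Rightarrow> int \<Rightarrow> int" where
  "bal_quo d x = (x + int d) div (2 * int d + 1)"

definition bal_rem :: "nat \<Rightarrow> int \<Rightarrow> int" where
  "bal_rem d x = (x + int d) mod (2 * int d + 1) - int d"

lemma bal_decomp: "x = (2 * int d + 1) * bal_quo d x + bal_rem d x"
proof -
  have "(2 * int d + 1) * bal_quo d x + (bal_rem d x + int d) = x + int d"
    unfolding bal_quo_def bal_rem_def using mult_div_mod_eq[of "2 * int d + 1" "x + int d"] by simp
  then show ?thesis by simp
qed

lemma bal_rem_bound: "\<bar>bal_rem d x\<bar> \<le> int d"
proof -
  have "0 \<le> (x + int d) mod (2 * int d + 1)" "(x + int d) mod (2 * int d + 1) < 2 * int d + 1"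
    using pos_mod_bound[of "2 * int d + 1" "x + int d"] by auto
  then show ?thesis unfolding bal_rem_def by linarith
qed

lemma bal_unique:
  assumes "\<bar>r\<bar> \<le> int d"
  shows "bal_quo d ((2 * int d + 1) * a + r) = a" "bal_rem d ((2 * int d + 1) * a + r) = r"
proof -
  have r: "0 \<le> r + int d" "r + int d < 2 * int d + 1" using assms by auto
  have eq: "(2 * int d + 1) * a + r + int d = (r + int d) + (2 * int d + 1) * a" by simp
  show "bal_quo d ((2 * int d + 1) * a + r) = a"
    unfolding bal_quo_def eq using r by (subst div_mult_self2) (auto simp: div_pos_pos_trivial)
  show "bal_rem d ((2 * int d + 1) * a + r) = r"
    unfolding bal_rem_def eq using r by (subst mod_mult_self2) (auto simp: mod_pos_pos_trivial)
qed

lemma bal_zero [simp]: "bal_quo d 0 = 0" "bal_rem d 0 = 0"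
  using bal_unique[of 0 d 0] by auto

lemma bal_quo_mono: "x \<le> y \<Longrightarrow> bal_quo d x \<le> bal_quo d y"
  unfolding bal_quo_def by (rule zdiv_mono1) auto

text \<open>The remainder l occurs with the quotients 0, ..., m and the remainder - l with 1, ...,
  m, giving 2 m + 1 numbers.\<close>

lemma card_residue_class:
  assumes l: "1 \<le> l" "l \<le> int d"
  shows "card {x \<in> {1..int ((2 * d + 1) * m + d)}. \<bar>bal_rem d x\<bar> = l} = 2 * m + 1"
proof -
  let ?N = "2 * int d + 1"
  let ?M = "int ((2 * d + 1) * m + d)"
  have M: "?M = ?N * int m + int d" by (simp add: algebra_simps)
  \<comment> \<open>The sign of a records the sign of the remainder and |a| the quotient; 0 belongs
    to the remainder l, since - l itself is not positive.\<close>
  define e where "e = (\<lambda>a. if 0 \<le> a then ?N * a + l else ?N * (- a) + (- l))"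
  have quo: "bal_quo d (e a) = \<bar>a\<bar>" and rem: "bal_rem d (e a) = (if 0 \<le> a then l else - l)" for a
    using l bal_unique[of l d a] bal_unique[of "- l" d "- a"] by (auto simp: e_def)
  have "bij_betw e {- int m..int m} {x \<in> {1..?M}. \<bar>bal_rem d x\<bar> = l}"
  proof (rule bij_betwI')
    fix a a' assume "a \<in> {- int m..int m}" "a' \<in> {- int m..int m}"
    show "(e a = e a') = (a = a')"
    proof
      assume eq: "e a = e a'"
      have "\<bar>a\<bar> = \<bar>a'\<bar>" using quo[of a] quo[of a'] eq by simp
      moreover have "(0 \<le> a) = (0 \<le> a')" using rem[of a] rem[of a'] eq l by (auto split: if_splits)
      ultimately show "a = a'" by auto
    qed simp
  next
    fix a assume a: "a \<in> {- int m..int m}"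
    have hi: "?N * \<bar>a\<bar> \<le> ?N * int m" using a by (intro mult_left_mono) auto
    have "1 \<le> e a \<and> e a \<le> ?M"
    proof (cases "0 \<le> a")
      case True
      then have "e a = ?N * \<bar>a\<bar> + l" "0 \<le> ?N * \<bar>a\<bar>" by (simp_all add: e_def)
      then show ?thesis using hi l unfolding M by linarith
    next
      case False
      then have "e a = ?N * (- a) - l" "?N * (- a) \<le> ?N * int m" using hi by (simp_all add: e_def)
      moreover have "?N * 1 \<le> ?N * (- a)" using False by (intro mult_left_mono) auto
      then have "2 * int d + 1 \<le> ?N * (- a)" by simp
      ultimately show ?thesis using l unfolding M by linarith
    qed
    then show "e a \<in> {x \<in> {1..?M}. \<bar>bal_rem d x\<bar> = l}" using rem[of a] l by auto
  next
    fix x assume x: "x \<in> {x \<in> {1..?M}. \<bar>bal_rem d x\<bar> = l}"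
    have lo: "0 \<le> bal_quo d x" using bal_quo_mono[of 0 x d] x by simp
    have hi: "bal_quo d x \<le> int m"
      using bal_quo_mono[of x ?M d] x bal_unique(1)[of "int d" d "int m"] unfolding M by simp
    show "\<exists>a\<in>{- int m..int m}. x = e a"
    proof (cases "bal_rem d x = l")
      case True
      then show ?thesis using lo hi bal_decomp[of x d] by (intro bexI[of _ "bal_quo d x"]) (auto simp: e_def)
    next
      case False
      then have r: "bal_rem d x = - l" using x by auto
      have "bal_quo d x \<noteq> 0"
      proof
        assume "bal_quo d x = 0"
        then show False using bal_decomp[of x d] r x l by simp
      qed
      then show ?thesis using lo hi bal_decomp[of x d] r
        by (intro bexI[of _ "- bal_quo d x"]) (auto simp: e_def)
    qed
  qed
  then have "card {x \<in> {1..?M}. \<bar>bal_rem d x\<bar> = l} = card {- int m..int m}"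
    by (rule bij_betw_same_card[symmetric])
  then show ?thesis by simp
qed

context type_C
begin

definition icoord :: "'a \<Rightarrow> nat \<Rightarrow> int" where
  "icoord p i = \<lfloor>coord p i\<rfloor>"

lemma cube_icoord: "p \<in> cube m \<Longrightarrow> coord p i = of_int (icoord p i) \<and> \<bar>icoord p i\<bar> \<le> int m"
  using cube_coord[of p m i] by (auto simp: icoord_def)

lemma icoord_eqI: "coord p i = of_int x \<Longrightarrow> icoord p i = x"
  by (simp add: icoord_def)

text \<open>The conditions depend only on the set of values at the breaks and say that it is a
  transversal of the d classes of numbers with |remainder| = 1, ..., d. Each class has 2 m + 1
  members.\<close>

lemma residue_points_card:
  assumes K: "K \<subseteq> \<Delta>"
  defines "d \<equiv> card (breaks K)"
  shows "card {p \<in> face_points K ((2 * d + 1) * m + d). inj_on (\<lambda>i. \<bar>bal_rem d (icoord p i)\<bar>) (breaks K) \<and>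
    (\<forall>i\<in>breaks K. bal_rem d (icoord p i) \<noteq> 0)} = (2 * m + 1) ^ d"
proof -
  let ?M = "(2 * d + 1) * m + d"
  define f where "f = (\<lambda>x::real. \<bar>bal_rem d \<lfloor>x\<rfloor>\<bar>)"
  let ?A = "real ` {1..?M}" and ?I = "{1..int d}"
  let ?Q = "{T. T \<subseteq> ?A \<and> card T = d \<and> inj_on f T \<and> f ` T \<subseteq> ?I}"
  let ?R = "{p \<in> face_points K ?M. inj_on (\<lambda>i. \<bar>bal_rem d (icoord p i)\<bar>) (breaks K) \<and> (\<forall>i\<in>breaks K. bal_rem d (icoord p i) \<noteq> 0)}"
  have f_fl: "\<bar>bal_rem d (icoord p i)\<bar> = f (coord p i)" for p i by (simp add: f_def icoord_def)
  have f_range: "f x \<in> ?I \<longleftrightarrow> f x \<noteq> 0" for x using bal_rem_bound[of d "\<lfloor>x\<rfloor>"] by (auto simp: f_def)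
  have iff: "p \<in> ?R \<longleftrightarrow> inj_on f (coord p ` breaks K) \<and> f ` coord p ` breaks K \<subseteq> ?I" if p: "p \<in> face_points K ?M" for p
  proof -
    have "inj_on (coord p) (breaks K)" using dominant_coord_inj[of p] p by (auto simp: face_points_def)
    then have "inj_on (\<lambda>i. f (coord p i)) (breaks K) \<longleftrightarrow> inj_on f (coord p ` breaks K)"
      using comp_inj_on_iff[of "coord p" "breaks K" f] by (simp add: comp_def)
    moreover have "bal_rem d (icoord p i) \<noteq> 0 \<longleftrightarrow> f (coord p i) \<in> ?I" for i
      using f_range[of "coord p i"] unfolding f_fl[symmetric] by simp
    ultimately show ?thesis using p by (simp add: f_fl image_subset_iff)
  qed
  have bij: "bij_betw (\<lambda>t. coord t ` breaks K) (face_points K ?M) {T. T \<subseteq> ?A \<and> card T = d}"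
    unfolding d_def by (rule face_points_values_bij[OF K])
  have "bij_betw (\<lambda>t. coord t ` breaks K) ?R ?Q"
  proof (rule bij_betw_imageI)
    show "inj_on (\<lambda>t. coord t ` breaks K) ?R"
      by (rule inj_on_subset[OF bij_betw_imp_inj_on[OF bij]]) auto
    show "(\<lambda>t. coord t ` breaks K) ` ?R = ?Q"
    proof (intro equalityI subsetI)
      fix T assume "T \<in> (\<lambda>t. coord t ` breaks K) ` ?R"
      then obtain p where p: "p \<in> ?R" "T = coord p ` breaks K" by blast
      then have "p \<in> face_points K ?M" by simp
      then show "T \<in> ?Q" using iff[of p] p bij_betwE[OF bij] by auto
    next
      fix T assume T: "T \<in> ?Q"
      then have "T \<in> (\<lambda>t. coord t ` breaks K) ` face_points K ?M" using bij_betw_imp_surj_on[OF bij] by auto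
      then obtain p where p: "p \<in> face_points K ?M" "T = coord p ` breaks K" by blast
      then have "p \<in> ?R" using iff[OF p(1)] T by blast
      then show "T \<in> (\<lambda>t. coord t ` breaks K) ` ?R" using p(2) by blast
    qed
  qed
  then have "card ?R = card ?Q" by (rule bij_betw_same_card)
  also have "\<dots> = (\<Prod>l\<in>?I. card {x \<in> ?A. f x = l})"
    using card_transversals[of ?A ?I f] by simp
  also have "\<dots> = (\<Prod>l\<in>?I. 2 * m + 1)"
  proof (rule prod.cong[OF refl])
    fix l assume l: "l \<in> ?I"
    have "{x \<in> ?A. f x = l} = real_of_int ` {x \<in> {1..int ?M}. \<bar>bal_rem d x\<bar> = l}"
    proof (intro equalityI subsetI)
      fix x assume "x \<in> {x \<in> ?A. f x = l}"
      then obtain k where k: "x = real k" "k \<in> {1..?M}" "f (real k) = l" by auto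
      then show "x \<in> real_of_int ` {x \<in> {1..int ?M}. \<bar>bal_rem d x\<bar> = l}"
        by (intro image_eqI[of _ _ "int k"]) (simp_all add: f_def del: of_nat_add of_nat_mult)
    next
      fix x assume "x \<in> real_of_int ` {x \<in> {1..int ?M}. \<bar>bal_rem d x\<bar> = l}"
      then obtain z where z: "x = real_of_int z" "1 \<le> z" "z \<le> int ?M" "\<bar>bal_rem d z\<bar> = l" by auto
      then have "x = real (nat z)" "nat z \<in> {1..?M}" by (simp_all add: nat_le_iff del: of_nat_add of_nat_mult)
      then have "x \<in> ?A" by (rule image_eqI)
      then show "x \<in> {x \<in> ?A. f x = l}" using z by (simp add: f_def)
    qed
    then have "card {x \<in> ?A. f x = l} = card {x \<in> {1..int ?M}. \<bar>bal_rem d x\<bar> = l}"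
      using card_image[of real_of_int "{x \<in> {1..int ?M}. \<bar>bal_rem d x\<bar> = l}"]
      by (simp only: inj_on_def of_int_eq_iff simp_thms ball_simps)
    then show "card {x \<in> ?A. f x = l} = 2 * m + 1" using card_residue_class[of l d m] l by simp
  qed
  also have "\<dots> = (2 * m + 1) ^ d" by simp
  finally show ?thesis .
qed

text \<open>Dividing with balanced remainder by \<open>2 d + 1\<close> splits a point of the big cube into a dominant
  point and a generic point that breaks the ties of the former.\<close>

lemma pairs_bij:
  assumes K: "K \<subseteq> \<Delta>"
  defines "d \<equiv> card (breaks K)"
  shows "bij_betw (\<lambda>(t, q). real (2 * d + 1) *\<^sub>R t + q)
    {(t, q). t \<in> cube m \<and> dominant t \<and> t \<in> FS K \<and> q \<in> generic_points K d \<and> (\<forall>\<alpha>\<in>walls t - K. 0 < \<alpha> \<bullet> q)}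
    {p \<in> face_points K ((2 * d + 1) * m + d). inj_on (\<lambda>i. \<bar>bal_rem d (icoord p i)\<bar>) (breaks K) \<and>
      (\<forall>i\<in>breaks K. bal_rem d (icoord p i) \<noteq> 0)}" (is "bij_betw ?h ?P ?R")
proof -
  let ?N = "2 * int d + 1"
  let ?M = "(2 * d + 1) * m + d"
  have co_h: "coord (?h (t, q)) i = of_int (?N * icoord t i + icoord q i)" and fl_h: "icoord (?h (t, q)) i = ?N * icoord t i + icoord q i"
    and rem_h: "bal_rem d (icoord (?h (t, q)) i) = icoord q i" and quo_h: "bal_quo d (icoord (?h (t, q)) i) = icoord t i"
    if "(t, q) \<in> ?P" for t q i
  proof -
    have "t \<in> cube m" "q \<in> cube d" using that by (auto simp: generic_points_def)
    then have c: "coord t i = of_int (icoord t i)" "coord q i = of_int (icoord q i)" "\<bar>icoord q i\<bar> \<le> int d"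
      using cube_icoord by blast+
    show 1: "coord (?h (t, q)) i = of_int (?N * icoord t i + icoord q i)"
      unfolding prod.case coord_linear c(1,2) by simp
    show 2: "icoord (?h (t, q)) i = ?N * icoord t i + icoord q i" using icoord_eqI[OF 1] .
    show "bal_rem d (icoord (?h (t, q)) i) = icoord q i" "bal_quo d (icoord (?h (t, q)) i) = icoord t i"
      unfolding 2 using bal_unique c(3) by auto
  qed
  show ?thesis
  proof (rule bij_betwI')
    fix x y assume x: "x \<in> ?P" and y: "y \<in> ?P"
    show "(?h x = ?h y) = (x = y)"
    proof
      assume eq: "?h x = ?h y"
      obtain t q t' q' where xy: "x = (t, q)" "y = (t', q')" by (cases x, cases y)
      have cube: "t \<in> cube m" "q \<in> cube d" "t' \<in> cube m" "q' \<in> cube d"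
        using x[unfolded xy(1)] y[unfolded xy(2)] by (simp_all add: generic_points_def)
      have "icoord t i = icoord t' i" "icoord q i = icoord q' i" for i
        using rem_h[OF x[unfolded xy(1)], of i] rem_h[OF y[unfolded xy(2)], of i]
          quo_h[OF x[unfolded xy(1)], of i] quo_h[OF y[unfolded xy(2)], of i] eq[unfolded xy]
        by (simp_all only:)
      then have "t = t'" "q = q'"
        using cube cube_icoord by (auto intro!: eqI_coord)
      then show "x = y" using xy by simp
    qed simp
  next
    fix x assume "x \<in> ?P"
    then obtain t q where x: "x = (t, q)" and tq: "(t, q) \<in> ?P" by fastforce
    then have t: "t \<in> cube m" "dominant t" "t \<in> FS K" and q: "q \<in> generic_points K d" "\<And>\<alpha>. \<alpha> \<in> walls t - K \<Longrightarrow> 0 < \<alpha> \<bullet> q"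
      by auto
    have q': "q \<in> cube d" "q \<in> FS K" using q(1) by (auto simp: generic_points_def)
    have cq: "coord q i = of_int (icoord q i)" "\<bar>icoord q i\<bar> \<le> int d" for i using cube_icoord[OF q'(1)] by blast+
    have ct: "coord t i = of_int (icoord t i)" "\<bar>icoord t i\<bar> \<le> int m" for i using cube_icoord[OF t(1)] by blast+
    have "?h x \<in> cube ?M"
      unfolding cube_def
    proof (intro CollectI ballI)
      fix i
      have "?N * \<bar>icoord t i\<bar> \<le> ?N * int m" using ct by (intro mult_left_mono) auto
      moreover have "\<bar>?N * icoord t i\<bar> = ?N * \<bar>icoord t i\<bar>" by (simp add: abs_mult)
      ultimately have "\<bar>?N * icoord t i + icoord q i\<bar> \<le> ?N * int m + int d" using cq(2)[of i] by linarith
      then show "coord (?h x) i \<in> real_of_int ` {- int ?M..int ?M}"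
        unfolding x co_h[OF tq] by (intro imageI) (simp add: abs_le_iff algebra_simps)
    qed
    moreover have "dominant (?h x) \<and> walls (?h x) = K"
      unfolding face_points_iff[OF K]
    proof
      fix i assume i: "i \<in> {1..n}"
      show "if i \<in> breaks K then coord (?h x) (Suc i) < coord (?h x) i else coord (?h x) i = coord (?h x) (Suc i)"
      proof (cases "i \<in> breaks K")
        case False
        then have "icoord t i = icoord t (Suc i)" "icoord q i = icoord q (Suc i)"
          using FS_iff_coord[OF K, of t] FS_iff_coord[OF K, of q] t(3) q'(2) i by (auto simp: icoord_def)
        then show ?thesis using False unfolding x co_h[OF tq] by simp
      next
        case True
        have nth_simple: "nth_simple i \<in> \<Delta>" "nth_simple i \<notin> K" using i True by (auto simp: simple_eq breaks_def)
        have ge: "icoord t (Suc i) \<le> icoord t i"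
          using dominant_coord_antimono[OF t(2), of i "Suc i"] i ct by simp
        \<comment> \<open>If \<open>t\<close> is tied at i, the root lies in
          \<open>walls t - K\<close> and \<open>q\<close> decreases. Otherwise \<open>t\<close>
          drops by at least 1, contributing 2 d + 1, while \<open>q\<close> can rise by at most 2
          d.\<close>
        have "?N * icoord t (Suc i) + icoord q (Suc i) < ?N * icoord t i + icoord q i"
        proof (cases "icoord t (Suc i) = icoord t i")
          case True
          then have "nth_simple i \<in> walls t" using nth_simple nth_simple_inner_zero_iff[of i t] i ct by (auto simp: walls_def)
          then have "0 < nth_simple i \<bullet> q" using q(2) nth_simple by blast
          then have "icoord q (Suc i) < icoord q i" using nth_simple_inner_pos_iff[of i q] i cq(1) by simp
          then show ?thesis using True by simp
        next
          case False
          then have "?N * (icoord t (Suc i) + 1) \<le> ?N * icoord t i" using ge by (intro mult_left_mono) auto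
          then have "?N * icoord t (Suc i) + ?N \<le> ?N * icoord t i" by (simp add: algebra_simps)
          then show ?thesis using cq(2)[of i] cq(2)[of "Suc i"] by linarith
        qed
        then show ?thesis using True unfolding x co_h[OF tq] by (simp only: of_int_less_iff if_True)
      qed
    qed
    moreover have "inj_on (\<lambda>i. \<bar>icoord q i\<bar>) (breaks K) \<and> (\<forall>i\<in>breaks K. icoord q i \<noteq> 0)"
      using generic_points_iff[OF K q'(2,1)] q(1) unfolding cq(1) of_int_abs[symmetric] by (simp add: inj_on_def)
    moreover have "bal_rem d (icoord (?h x) i) = icoord q i" for i unfolding x by (rule rem_h[OF tq])
    ultimately show "?h x \<in> ?R"
      by (simp only: face_points_def mem_Collect_eq) simp
  next
    fix p assume p: "p \<in> ?R"
    then have p': "p \<in> cube ?M" "dominant p" "walls p = K" by (auto simp: face_points_def)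
    have cp: "coord p i = of_int (icoord p i)" "\<bar>icoord p i\<bar> \<le> int ?M" for i using cube_icoord[OF p'(1)] by blast+
    define t where "t = vec (\<lambda>i. of_int (bal_quo d (icoord p i)))"
    define q where "q = vec (\<lambda>i. of_int (bal_rem d (icoord p i)))"
    \<comment> \<open>Zero has quotient and remainder 0, so the convention for coordinate n + 1 is
      inherited by \<open>t\<close> and \<open>q\<close>.\<close>
    have fl0: "icoord p (Suc n) = 0" by (simp add: icoord_def)
    have ct: "coord t i = of_int (bal_quo d (icoord p i))" and cq: "coord q i = of_int (bal_rem d (icoord p i))"
      if "1 \<le> i" "i \<le> Suc n" for i
      using that by (cases "i = Suc n"; simp add: t_def q_def fl0)+
    have step: "if i \<in> breaks K then icoord p (Suc i) < icoord p i else icoord p i = icoord p (Suc i)" if "i \<in> {1..n}" for i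
    proof -
      have "\<forall>i\<in>{1..n}. if i \<in> breaks K then coord p (Suc i) < coord p i else coord p i = coord p (Suc i)"
        using face_points_iff[OF K, of p] p'(2,3) by simp
      from bspec[OF this that] show ?thesis unfolding cp(1) by (auto split: if_splits)
    qed
    have ge: "icoord p (Suc i) \<le> icoord p i" if "i \<in> {1..n}" for i using step[OF that] by (auto split: if_splits)
    have FS: "t \<in> FS K" "q \<in> FS K"
      unfolding FS_iff_coord[OF K] using step ct cq by auto
    have "t \<in> cube m"
      unfolding cube_def
    proof (intro CollectI ballI)
      fix i assume i: "i \<in> {1..n}"
      have "0 \<le> icoord p i" using dominant_coord_antimono[OF p'(2), of i "Suc n"] i cp(1)[of i] by simp
      then have "0 \<le> bal_quo d (icoord p i)" using bal_quo_mono[of 0 "icoord p i" d] by simp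
      moreover have "bal_quo d (icoord p i) \<le> bal_quo d (?N * int m + int d)"
        using cp(2)[of i] by (intro bal_quo_mono) (simp add: algebra_simps)
      then have "bal_quo d (icoord p i) \<le> int m" using bal_unique(1)[of "int d" d "int m"] by simp
      ultimately show "coord t i \<in> real_of_int ` {- int m..int m}" using ct[of i] i by auto
    qed
    moreover have "dominant t"
      unfolding dominant_def simple_eq
      using ge bal_quo_mono by (auto simp: nth_simple_inner_nonneg_iff ct)
    moreover have "q \<in> generic_points K d"
    proof -
      have "q \<in> cube d"
        unfolding cube_def using bal_rem_bound[of d] cq by (auto simp: abs_le_iff minus_le_iff)
      moreover have cqb: "coord q i = of_int (bal_rem d (icoord p i))" if "i \<in> breaks K" for i
        using cq[of i] breaks_bounds[OF that] by simp
      then have "inj_on (\<lambda>i. \<bar>coord q i\<bar>) (breaks K)"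
        using p by (simp add: inj_on_def cqb flip: of_int_abs)
      moreover have "\<forall>i\<in>breaks K. coord q i \<noteq> 0" using p by (simp add: cqb)
      ultimately show ?thesis using generic_points_iff[OF K FS(2)] by blast
    qed
    moreover have "0 < \<alpha> \<bullet> q" if "\<alpha> \<in> walls t - K" for \<alpha>
    proof -
      obtain i where i: "\<alpha> = nth_simple i" "i \<in> {1..n}" using \<open>\<alpha> \<in> walls t - K\<close> by (auto simp: walls_def simple_eq)
      then have ib: "i \<in> breaks K" using \<open>\<alpha> \<in> walls t - K\<close> by (simp add: breaks_def)
      have "nth_simple i \<bullet> t = 0" using \<open>\<alpha> \<in> walls t - K\<close> i by (simp add: walls_def)
      \<comment> \<open>On a wall of \<open>t\<close> the quotients agree, so the strict decrease of
        \<open>p\<close> at a break must come from the remainders.\<close>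
      then have "bal_quo d (icoord p i) = bal_quo d (icoord p (Suc i))" using i by (simp add: nth_simple_inner_zero_iff ct)
      moreover have "icoord p (Suc i) < icoord p i" using step i ib by auto
      ultimately have "bal_rem d (icoord p (Suc i)) < bal_rem d (icoord p i)"
        using bal_decomp[of "icoord p i" d] bal_decomp[of "icoord p (Suc i)" d] by simp
      then show ?thesis using i by (simp add: nth_simple_inner_pos_iff cq)
    qed
    ultimately have "(t, q) \<in> ?P" using FS by auto
    moreover have "p = ?h (t, q)"
    proof (rule eqI_coord)
      fix i assume i: "1 \<le> i" "i \<le> n"
      have "coord (?h (t, q)) i = of_int (?N * bal_quo d (icoord p i) + bal_rem d (icoord p i))"
        using i by (simp add: coord_linear ct cq)
      also have "\<dots> = coord p i" unfolding bal_decomp[symmetric] by (rule cp(1)[symmetric])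
      finally show "coord p i = coord (?h (t, q)) i" by simp
    qed
    ultimately show "\<exists>x\<in>?P. p = ?h x" by blast
  qed
qed

text \<open>The pairs of \<open>pairs_bij\<close> are sorted by the wall set J of their first
  component, which contains \<open>K\<close> exactly when that component lies in
  \<open>FS K\<close>.\<close>

lemma descent_sum:
  assumes K: "K \<subseteq> \<Delta>"
  shows "(\<Sum>J | K \<subseteq> J \<and> J \<subseteq> \<Delta>. (m choose card (breaks J)) * card {w \<in> X_set \<Phi> \<Delta> J. w ` K \<subseteq> \<Delta>}) =
    (2 * m + 1) ^ card (breaks K)"
proof -
  define d where "d = card (breaks K)"
  let ?S = "{J. K \<subseteq> J \<and> J \<subseteq> \<Delta>}"
  let ?Q = "\<lambda>J. {q \<in> generic_points K d. \<forall>\<alpha>\<in>J - K. 0 < \<alpha> \<bullet> q}"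
  let ?P = "{(t, q). t \<in> cube m \<and> dominant t \<and> t \<in> FS K \<and> q \<in> generic_points K d \<and> (\<forall>\<alpha>\<in>walls t - K. 0 < \<alpha> \<bullet> q)}"
  have finS: "finite ?S" by (rule finite_subset[of _ "Pow \<Delta>"]) (auto simp: finite_simple)
  have fin: "finite (face_points J m)" "finite (?Q J)" for J
    by (rule finite_subset[OF _ finite_cube], auto simp: face_points_def generic_points_def)+
  have P: "?P = (\<Union>J\<in>?S. face_points J m \<times> ?Q J)"
  proof -
    have "t \<in> FS K \<longleftrightarrow> K \<subseteq> walls t" for t using K by (auto simp: walls_def)
    moreover have "walls t \<subseteq> \<Delta>" for t by (auto simp: walls_def)
    ultimately show ?thesis by (auto simp: face_points_def)
  qed
  have "(\<Sum>J\<in>?S. (m choose card (breaks J)) * card {w \<in> X_set \<Phi> \<Delta> J. w ` K \<subseteq> \<Delta>}) =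
    (\<Sum>J\<in>?S. card (face_points J m \<times> ?Q J))"
    by (intro sum.cong refl) (simp add: X_set_card face_points_card d_def card_cartesian_product)
  also have "\<dots> = card ?P"
    unfolding P using finS fin by (intro card_UN_disjoint[symmetric]) (auto simp: face_points_def)
  also have "\<dots> = (2 * m + 1) ^ d"
    using bij_betw_same_card[OF pairs_bij[OF K, of m]] residue_points_card[OF K, of m]
    unfolding d_def by simp
  finally show ?thesis unfolding d_def .
qed

subsection \<open>Coefficients of the idempotents\<close>

lemma subset_conj_equiv: "equiv (Pow \<Delta>) (subset_conj \<Phi> \<Delta>)"
proof (rule equivI)
  show "subset_conj \<Phi> \<Delta> \<subseteq> Pow \<Delta> \<times> Pow \<Delta>" by (auto simp: subset_conj_def)
  show "refl_on (Pow \<Delta>) (subset_conj \<Phi> \<Delta>)"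
    unfolding refl_on_def subset_conj_def using reflection_group.id[of \<Phi>] by (auto intro!: bexI[of _ id])
  show "sym (subset_conj \<Phi> \<Delta>)"
  proof (rule symI)
    fix J K assume "(J, K) \<in> subset_conj \<Phi> \<Delta>"
    then obtain w where w: "J \<subseteq> \<Delta>" "K \<subseteq> \<Delta>" "w \<in> W" "w ` J = K" by (auto simp: subset_conj_def)
    then have "inv w ` K = J" by (auto simp: image_image W_app)
    then show "(K, J) \<in> subset_conj \<Phi> \<Delta>" using w W_inv unfolding subset_conj_def by blast
  qed
  show "trans (subset_conj \<Phi> \<Delta>)"
  proof (rule transI)
    fix J K M assume "(J, K) \<in> subset_conj \<Phi> \<Delta>" "(K, M) \<in> subset_conj \<Phi> \<Delta>"
    then obtain v w where vw: "J \<subseteq> \<Delta>" "M \<subseteq> \<Delta>" "v \<in> W" "w \<in> W" "v ` J = K" "w ` K = M"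
      by (auto simp: subset_conj_def)
    then have "w \<circ> v \<in> W" "(w \<circ> v) ` J = M" by (auto intro: W_comp simp only: image_comp[symmetric])
    then show "(J, M) \<in> subset_conj \<Phi> \<Delta>" using vw unfolding subset_conj_def by blast
  qed
qed

lemma class_rank_eq:
  assumes "K \<subseteq> \<Delta>"
  shows "class_rank (subset_class \<Phi> \<Delta> K) = card K"
proof -
  have *: "\<forall>J\<in>subset_class \<Phi> \<Delta> K. card J = card K"
    using W_image_card by (auto simp: subset_class_eq[OF assms])
  have K: "K \<in> subset_class \<Phi> \<Delta> K"
    unfolding subset_class_def by (rule equiv_class_self[OF subset_conj_equiv]) (simp add: assms)
  show ?thesis unfolding class_rank_def
  proof (rule the_equality)
    show "\<forall>J\<in>subset_class \<Phi> \<Delta> K. card J = card K" by (rule *)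
    fix c assume "\<forall>J\<in>subset_class \<Phi> \<Delta> K. card J = c"
    from bspec[OF this K] show "c = card K" by (rule sym)
  qed
qed

lemma subset_class_card_pos: "K \<subseteq> \<Delta> \<Longrightarrow> 0 < card (subset_class \<Phi> \<Delta> K)"
  using finite_subset_class[of K] equiv_class_self[OF subset_conj_equiv, of K]
  by (auto simp: card_gt_0_iff subset_class_def)

lemma sum_over_classes:
  fixes f :: "'a set \<Rightarrow> real"
  shows "(\<Sum>l\<in>subset_classes \<Phi> \<Delta>. \<Sum>J\<in>l. f J) = (\<Sum>J\<in>Pow \<Delta>. f J)"
proof -
  have "(\<Sum>J\<in>\<Union>(subset_classes \<Phi> \<Delta>). f J) = (\<Sum>l\<in>subset_classes \<Phi> \<Delta>. \<Sum>J\<in>l. f J)"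
  proof (subst sum.Union_disjoint)
    show "\<forall>l\<in>subset_classes \<Phi> \<Delta>. finite l"
      using Union_quotient[OF subset_conj_equiv] finite_simple
      by (auto simp: subset_classes_def intro: finite_subset[of _ "Pow \<Delta>"])
    show "\<forall>k\<in>subset_classes \<Phi> \<Delta>. \<forall>l\<in>subset_classes \<Phi> \<Delta>. k \<noteq> l \<longrightarrow> k \<inter> l = {}"
      using quotient_disj[OF subset_conj_equiv] unfolding subset_classes_def by blast
  qed simp
  then show ?thesis
    using Union_quotient[OF subset_conj_equiv] by (simp add: subset_classes_def)
qed

text \<open>Summing over classes and then over their members gives M = g \<beta> applied to the x_K,
  with g as defined below. Since f \<mu> = g by \<open>descent_sum\<close>, multiplying by \<beta>
  on the right gives g \<beta> = f; the coefficient of w in x_K then selects the \<open>K\<close>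
  that avoid the descents of w.\<close>

lemma M_elem_eq:
  assumes w: "w \<in> W"
  shows "M_elem \<Phi> \<Delta> (real (2 * m + 1)) w =
    (\<Sum>K\<in>Pow (\<Delta> - Des \<Phi> \<Delta> w). real (m choose card (breaks K)) / real (2 * m + 1) ^ n)"
proof -
  let ?k = "real (2 * m + 1)"
  let ?c = "\<lambda>K. real (card (subset_class \<Phi> \<Delta> K))"
  let ?\<mu> = "mu_mat \<Phi> \<Delta>" and ?\<beta> = "beta_mat \<Phi> \<Delta>"
  define f where "f = (\<lambda>K. real (m choose card (breaks K)) / ?k ^ n)"
  define g where "g = (\<lambda>K. 1 / (?c K * ?k ^ card K))"
  have finP: "finite (Pow \<Delta>)" by (simp add: finite_simple)
  have c: "?c K \<noteq> 0" if "K \<subseteq> \<Delta>" for K using subset_class_card_pos[OF that] by simp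
  have diag: "?\<mu> J J \<noteq> 0" if J: "J \<subseteq> \<Delta>" for J
  proof -
    \<comment> \<open>The identity has no descents and keeps \<open>J\<close> simple, so diagonal
      entries of \<mu> are nonzero.\<close>
    have "id \<in> {w \<in> X_set \<Phi> \<Delta> J. w ` J \<subseteq> \<Delta>}"
      using J reflection_group.id[of \<Phi>] simple_rho by (auto simp: X_set_def Des_eq)
    moreover have "finite {w \<in> X_set \<Phi> \<Delta> J. w ` J \<subseteq> \<Delta>}"
      by (rule finite_subset[OF _ finite_W]) (auto simp: X_set_def)
    ultimately have "card {w \<in> X_set \<Phi> \<Delta> J. w ` J \<subseteq> \<Delta>} \<noteq> 0" by (subst card_0_eq) blast+
    then show ?thesis using c[OF J] by (simp add: mu_mat_def)
  qed
  have tri: "?\<mu> J K = 0" if "\<not> K \<subseteq> J" for J K using that by (simp add: mu_mat_def)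
  have \<beta>_tri: "?\<beta> J K = 0" if "\<not> K \<subseteq> J" for J K
    unfolding beta_mat_def by (rule matrix_inv_on_triangular(1)[OF finite_simple tri diag that])
  have \<mu>\<beta>: "(\<Sum>L\<in>Pow \<Delta>. ?\<mu> J L * ?\<beta> L K) = (if J = K then 1 else 0)" if "J \<subseteq> \<Delta>" "K \<subseteq> \<Delta>" for J K
    unfolding beta_mat_def by (rule matrix_inv_on_triangular(2)[OF finite_simple tri diag that])
  have f\<mu>: "(\<Sum>J\<in>Pow \<Delta>. f J * ?\<mu> J K) = g K" if K: "K \<subseteq> \<Delta>" for K
  proof -
    let ?S = "{J. K \<subseteq> J \<and> J \<subseteq> \<Delta>}"
    have "(\<Sum>J\<in>Pow \<Delta>. f J * ?\<mu> J K) = (\<Sum>J\<in>?S. f J * ?\<mu> J K)"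
      using finP tri by (intro sum.mono_neutral_right) auto
    also have "\<dots> = (\<Sum>J\<in>?S. real ((m choose card (breaks J)) * card {w \<in> X_set \<Phi> \<Delta> J. w ` K \<subseteq> \<Delta>}) / (?k ^ n * ?c K))"
      by (intro sum.cong refl) (simp add: f_def mu_mat_def)
    also have "\<dots> = real ((2 * m + 1) ^ card (breaks K)) / (?k ^ n * ?c K)"
      unfolding sum_divide_distrib[symmetric] of_nat_sum[symmetric] descent_sum[OF K] ..
    \<comment> \<open>As n = |breaks K| + |K|, the count of \<open>descent_sum\<close> cancels one
      factor and leaves the power of \<open>k\<close> required in \<open>g\<close>.\<close>
    also have "?k ^ n = ?k ^ card (breaks K) * ?k ^ card K"
      using card_breaks[OF K] card_subset_simple[OF K] by (simp flip: power_add)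
    also have "real ((2 * m + 1) ^ card (breaks K)) / (?k ^ card (breaks K) * ?k ^ card K * ?c K) = g K"
      by (simp add: g_def del: of_nat_add of_nat_mult of_nat_Suc)
    finally show ?thesis .
  qed
  have g\<beta>: "(\<Sum>J\<in>Pow \<Delta>. g J * ?\<beta> J K) = f K" if K: "K \<subseteq> \<Delta>" for K
  proof -
    have "(\<Sum>J\<in>Pow \<Delta>. g J * ?\<beta> J K) = (\<Sum>J\<in>Pow \<Delta>. (\<Sum>I\<in>Pow \<Delta>. f I * ?\<mu> I J) * ?\<beta> J K)"
      by (intro sum.cong refl) (simp add: f\<mu>)
    also have "\<dots> = (\<Sum>I\<in>Pow \<Delta>. f I * (\<Sum>J\<in>Pow \<Delta>. ?\<mu> I J * ?\<beta> J K))"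
      by (simp add: sum_distrib_left sum_distrib_right mult.assoc) (rule sum.swap)
    also have "\<dots> = (\<Sum>I\<in>Pow \<Delta>. f I * (if I = K then 1 else 0))"
      by (intro sum.cong refl) (simp add: \<mu>\<beta> K)
    also have "\<dots> = f K" using sum_delta_right(1)[OF finP, of K f] K by simp
    finally show ?thesis .
  qed
  have "M_elem \<Phi> \<Delta> ?k w =
    (\<Sum>l\<in>subset_classes \<Phi> \<Delta>. \<Sum>J\<in>l. g J * (\<Sum>K\<in>Pow J. ?\<beta> J K * x_elem \<Phi> \<Delta> K w))"
    unfolding M_elem_def
  proof (rule sum.cong[OF refl])
    fix l assume l: "l \<in> subset_classes \<Phi> \<Delta>"
    have "g J = 1 / real (card l) / ?k ^ class_rank l" if "J \<in> l" for J
    proof -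
      have "J \<subseteq> \<Delta>" using l that Union_quotient[OF subset_conj_equiv] by (auto simp: subset_classes_def)
      moreover have "l = subset_class \<Phi> \<Delta> J"
      proof -
        obtain K where K: "K \<subseteq> \<Delta>" "l = subset_conj \<Phi> \<Delta> `` {K}"
          using l by (auto simp: subset_classes_def elim: quotientE)
        then have "(K, J) \<in> subset_conj \<Phi> \<Delta>" using that by simp
        then show ?thesis using equiv_class_eq[OF subset_conj_equiv] K(2) by (simp add: subset_class_def)
      qed
      ultimately show ?thesis using class_rank_eq by (simp add: g_def)
    qed
    then show "e_elem \<Phi> \<Delta> l w / ?k ^ class_rank l =
        (\<Sum>J\<in>l. g J * (\<Sum>K\<in>Pow J. ?\<beta> J K * x_elem \<Phi> \<Delta> K w))"
      unfolding e_elem_def sum_distrib_left[of "1 / real (card l)"] sum_divide_distrib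
      by (intro sum.cong refl) (simp add: sum_divide_distrib)
  qed
  also have "\<dots> = (\<Sum>J\<in>Pow \<Delta>. g J * (\<Sum>K\<in>Pow J. ?\<beta> J K * x_elem \<Phi> \<Delta> K w))"
    by (rule sum_over_classes)
  also have "\<dots> = (\<Sum>J\<in>Pow \<Delta>. g J * (\<Sum>K\<in>Pow \<Delta>. ?\<beta> J K * x_elem \<Phi> \<Delta> K w))"
    using \<beta>_tri finP
    by (intro sum.cong refl arg_cong2[where f = "(*)"] sum.mono_neutral_left) auto
  also have "\<dots> = (\<Sum>K\<in>Pow \<Delta>. (\<Sum>J\<in>Pow \<Delta>. g J * ?\<beta> J K) * x_elem \<Phi> \<Delta> K w)"
    by (simp add: sum_distrib_left sum_distrib_right mult.assoc) (rule sum.swap)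
  also have "\<dots> = (\<Sum>K\<in>Pow \<Delta>. f K * x_elem \<Phi> \<Delta> K w)"
    by (intro sum.cong refl) (simp add: g\<beta>)
  also have "\<dots> = (\<Sum>K\<in>Pow (\<Delta> - Des \<Phi> \<Delta> w). f K)"
    using w finP
    by (intro sum.mono_neutral_cong_right) (auto simp: x_elem_def X_set_def indicator_def split: if_splits)
  finally show ?thesis by (simp only: f_def)
qed

end

theorem proposition6:
  fixes b :: "nat \<Rightarrow> 'a::euclidean_space" and k :: nat
  assumes orthonormal: "\<And>i j. i \<in> {1..DIM('a)} \<Longrightarrow> j \<in> {1..DIM('a)} \<Longrightarrow>
      b i \<bullet> b j = (if i = j then 1 else 0)"
    and k: "0 < k" "odd k"
  shows "\<forall>w \<in> weyl_group (C_roots b).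
      cellini_x (C_roots b) (C_simple b) k w = M_elem (C_roots b) (C_simple b) (real k) w \<and>
      cellini_x (C_roots b) (C_simple b) k w = H_elem (C_roots b) (C_simple b) (real k) w"
proof -
  interpret type_C b "DIM('a)"
    by unfold_locales (simp_all add: orthonormal)
  obtain m where k: "k = 2 * m + 1" using k(2) by (rule oddE)
  show ?thesis unfolding k
    by (intro ballI conjI) (simp_all only: cellini_x_eq M_elem_eq H_elem_eq)
qed

end
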